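(* Let $n\ge 2$ be even, $\ell=\lfloor\frac{n-2}{2}\rfloor$, $\mathsf{k}$ a field, and $Q=\mathsf{k}[x_1,\dots,x_n]$ (standard graded). Let $f_1,\dots,f_{n+1}\in Q$ be homogeneous of degree $2$ such that $f_1,\dots,f_n$ is a regular sequence and $f_{n+1}\notin J=(f_1,\dots,f_n)$. Let $I=(f_1,\dots,f_{n+1})$, $G=J:I$, $P=Q/J$ and $A=Q/G$. If $f_{n+1}$ is a maximal rank element of $P$, then $$\beta_{i,j}^Q(A)=\begin{cases}\binom{n}{i}, & \text{if } j=2i \text{ and } 0\le i\le \ell-1, \text{ or if } j=2i-2 \text{ and } \ell+3\le i\le n,\\ \gamma_i(n), & \text{if } j=i+\ell \text{ and } 0\le i\le n,\\ 0, & \text{otherwise.}\end{cases}$$ Consequently, when $n\ge 6$, the sequence $\{\gamma_i(n)\}_i$ satisfies: \begin{enumerate} \item[(1)] $\gamma_1(n)=\gamma_{n-1}(n)=C_{\ell+2}$; \item[(2)] $\gamma_i(n)=\rho_{i+1}(n)$ for all $0\le i\le \ell-1$. \end{enumerate}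
   Context: $\beta_{i,j}^Q(M)=\dim_{\mathsf{k}}\operatorname{Tor}_i^Q(M,\mathsf{k})_j$. A homogeneous element $f$ of degree $d\ge1$ of $Q$ (identified with its image in $P$) is a maximal rank element of $P$ if for each $i\ge 0$ the multiplication map $P_i\xrightarrow{\cdot f}P_{i+d}$ has maximal rank (is injective or surjective). The Catalan numbers are $C_k=\frac{1}{k+1}\binom{2k}{k}$. With $\ell=\lfloor\frac{n-2}{2}\rfloor$ and $n$ even, the sequence $\{\gamma_k(n)\}_{0\le k\le n}$ is defined by: $\gamma_0(n)=1$ if $n=2$ and $\gamma_0(n)=0$ if $n>2$; $\gamma_k(n)=\gamma_{n-k}(n)$ for $1\le k\le n$; and for $1\le k\le \ell+1$, recursively, $$\gamma_k(n)=(-1)^k\binom{n}{k+\ell+2}-\sum_{i=0}^{k-1}(-1)^{i+k}\binom{n-1+k-i}{n-1}\gamma_i(n)-\sum_{i=0}^{\ell-1}(-1)^{i+k}\binom{n-1+\ell+k-2i}{n-1}\binom{n}{i}.$$ The sequence $\{\rho_k(n)\}_{k\ge 0}$ is defined by $\rho_0(n)=0$ and, for $k\ge 1$, $$\rho_k(n)=\sum_{i=0}^{k-1}(-1)^{i+k+1}\binom{n+k-i-1}{n-1}\rho_i(n)+\sum_{i=0}^{\ell}(-1)^{i+k+1}\binom{n+k+\ell-2i}{n-1}\binom{n+1}{i}.$$ *)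

theory Defs
  imports Complex_Main "HOL-Library.Poly_Mapping" "HOL-Library.Set_Algebras"
    "HOL-Library.Cardinality"
begin

section \<open>The polynomial ring and its ideals\<close>

text \<open>
  For a finite type \<open>'v\<close> of variables, the type of finitely supported maps from exponent vectors to
  \<open>'k\<close> is the polynomial ring over \<open>'k\<close> in \<open>CARD('v)\<close> variables. Ideals are submodules of the ring
  over itself, so the ideal generated by \<open>S\<close> is \<open>ideal_span S\<close>.
\<close>

type_synonym ('v, 'k) polynomial = "('v \<Rightarrow>\<^sub>0 nat) \<Rightarrow>\<^sub>0 'k"

lemma module_ring_mult: "module ((*) :: 'a::comm_ring_1 \<Rightarrow> 'a \<Rightarrow> 'a)"
  by unfold_locales (simp_all only: distrib_left distrib_right mult.assoc mult_1_left)

abbreviation ideal_span :: "'a::comm_ring_1 set \<Rightarrow> 'a set" where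
  "ideal_span \<equiv> module.span (*)"

definition monomial_degree :: "('v::finite \<Rightarrow>\<^sub>0 nat) \<Rightarrow> nat" where
  "monomial_degree m = (\<Sum>v\<in>UNIV. Poly_Mapping.lookup m v)"

text \<open>The degree \<open>d\<close> component of the ring; it contains \<open>0\<close> for every \<open>d\<close>.\<close>

definition homog :: "nat \<Rightarrow> ('v::finite, 'k::field) polynomial set" where
  "homog d = {q. \<forall>m\<in>Poly_Mapping.keys q. monomial_degree m = d}"

definition colon :: "'a::comm_ring_1 set \<Rightarrow> 'a set \<Rightarrow> 'a set" where
  "colon J I = {q. \<forall>a\<in>I. q * a \<in> J}"

definition regular_sequence :: "'a::comm_ring_1 list \<Rightarrow> bool" where
  "regular_sequence fs \<longleftrightarrow>
     ideal_span (set fs) \<noteq> UNIV \<and>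
     (\<forall>i<length fs. \<forall>q. fs ! i * q \<in> ideal_span (set (take i fs))
                        \<longrightarrow> q \<in> ideal_span (set (take i fs)))"

section \<open>Graded quotient rings and maximal rank elements\<close>

text \<open>Elements of \<open>Q/J\<close> are cosets \<open>q +o J\<close>.\<close>

definition quot_component ::
    "('v::finite, 'k::field) polynomial set \<Rightarrow> nat \<Rightarrow> ('v, 'k) polynomial set set" where
  "quot_component J i = (\<lambda>q. q +o J) ` homog i"

definition quot_mult :: "'a::comm_ring_1 set \<Rightarrow> 'a \<Rightarrow> 'a set \<Rightarrow> 'a set" where
  "quot_mult J f C = (\<Union>q\<in>C. (f * q) +o J)"

definition maximal_rank_element ::
    "('v::finite, 'k::field) polynomial set \<Rightarrow> nat \<Rightarrow> ('v, 'k) polynomial \<Rightarrow> bool" where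
  "maximal_rank_element J d f \<longleftrightarrow>
     d \<ge> 1 \<and> f \<in> homog d \<and>
     (\<forall>i. inj_on (quot_mult J f) (quot_component J i) \<or>
          quot_mult J f ` quot_component J i = quot_component J (i + d))"

section \<open>Graded free resolutions\<close>

text \<open>
  The graded free module with \<open>r d\<close> generators in degree \<open>d\<close>, that is, the direct sum of the
  \<open>Q(-d)^(r d)\<close>, has the basis of all pairs \<open>(d, s)\<close> with \<open>s < r d\<close>, where \<open>(d, s)\<close> has degree \<open>d\<close>.
  An element is the finitely supported map of its coordinates. There are finitely many generators in
  each degree, but their total number is not required to be finite.
\<close>

definition free_module :: "(nat \<Rightarrow> nat) \<Rightarrow> ((nat \<times> nat) \<Rightarrow>\<^sub>0 'a::zero) set" where
  "free_module r = {x. \<forall>(d, s)\<in>Poly_Mapping.keys x. s < r d}"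

definition free_component ::
    "(nat \<Rightarrow> nat) \<Rightarrow> nat \<Rightarrow> ((nat \<times> nat) \<Rightarrow>\<^sub>0 ('v::finite, 'k::field) polynomial) set" where
  "free_component r j = {x \<in> free_module r. \<forall>(d, s)\<in>Poly_Mapping.keys x.
     d \<le> j \<and> Poly_Mapping.lookup x (d, s) \<in> homog (j - d)}"

definition smult :: "'a::semiring_0 \<Rightarrow> ('b \<Rightarrow>\<^sub>0 'a) \<Rightarrow> ('b \<Rightarrow>\<^sub>0 'a)" where
  "smult c x = Poly_Mapping.map ((*) c) x"

text \<open>The linear map that sends each basis element \<open>b\<close> to \<open>D b\<close>.\<close>

definition linear_ext :: "('b \<Rightarrow> ('c \<Rightarrow>\<^sub>0 'a)) \<Rightarrow> ('b \<Rightarrow>\<^sub>0 'a::semiring_0) \<Rightarrow> ('c \<Rightarrow>\<^sub>0 'a)" where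
  "linear_ext D x = (\<Sum>b\<in>Poly_Mapping.keys x. smult (Poly_Mapping.lookup x b) (D b))"

definition augmentation ::
    "'a::comm_ring_1 set \<Rightarrow> ('b \<Rightarrow> 'a) \<Rightarrow> ('b \<Rightarrow>\<^sub>0 'a) \<Rightarrow> 'a set" where
  "augmentation G e x = (\<Sum>b\<in>Poly_Mapping.keys x. Poly_Mapping.lookup x b * e b) +o G"

text \<open>
  A graded free resolution of \<open>Q/G\<close>: the free module \<open>F\<^sub>i\<close> is given by \<open>r i\<close>, the differential from
  \<open>F\<^sub>i\<^sub>+\<^sub>1\<close> to \<open>F\<^sub>i\<close> by the images \<open>D (i + 1) b\<close> of the basis elements, and the augmentation from \<open>F\<^sub>0\<close>
  to \<open>Q/G\<close> by homogeneous representatives \<open>e b\<close> of the images of the basis elements. All these maps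
  are homogeneous of degree \<open>0\<close>. The value \<open>D 0\<close> is not used.
\<close>

definition graded_free_resolution ::
    "('v::finite, 'k::field) polynomial set \<Rightarrow> (nat \<Rightarrow> nat \<Rightarrow> nat)
      \<Rightarrow> ((nat \<times> nat) \<Rightarrow> ('v, 'k) polynomial)
      \<Rightarrow> (nat \<Rightarrow> (nat \<times> nat) \<Rightarrow> ((nat \<times> nat) \<Rightarrow>\<^sub>0 ('v, 'k) polynomial)) \<Rightarrow> bool" where
  "graded_free_resolution G r e D \<longleftrightarrow>
     (\<forall>d s. s < r 0 d \<longrightarrow> e (d, s) \<in> homog d) \<and>
     (\<forall>i d s. s < r (i + 1) d \<longrightarrow> D (i + 1) (d, s) \<in> free_component (r i) d) \<and>
     augmentation G e ` free_module (r 0) = range (\<lambda>q. q +o G) \<and>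
     {x \<in> free_module (r 0). augmentation G e x = G} = linear_ext (D 1) ` free_module (r 1) \<and>
     (\<forall>i. {x \<in> free_module (r (i + 1)). linear_ext (D (i + 1)) x = 0}
            = linear_ext (D (i + 2)) ` free_module (r (i + 2)))"

section \<open>Tor and graded Betti numbers\<close>

lemma lookup_smult: "Poly_Mapping.lookup (smult c x) b = c * Poly_Mapping.lookup x b"
  by (simp add: smult_def Poly_Mapping.map.rep_eq when_def)

global_interpretation coordinate_space:
    vector_space "smult :: 'k::field \<Rightarrow> ('b \<Rightarrow>\<^sub>0 'k) \<Rightarrow> ('b \<Rightarrow>\<^sub>0 'k)"
  by unfold_locales
    (rule poly_mapping_eqI, simp add: lookup_smult lookup_add distrib_left distrib_right mult.assoc)+

text \<open>
  The residue field is \<open>k = Q/(x\<^sub>1, \<dots>, x\<^sub>n)\<close>. Tensoring \<open>F\<^sub>i\<close> with it gives the graded vector space on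
  the same basis, and the differential becomes the matrix of the constant terms of its entries.
\<close>

definition tensor_component :: "(nat \<Rightarrow> nat) \<Rightarrow> nat \<Rightarrow> ((nat \<times> nat) \<Rightarrow>\<^sub>0 'k::field) set" where
  "tensor_component r j = {v \<in> free_module r. \<forall>(d, s)\<in>Poly_Mapping.keys v. d = j}"

definition tensor_matrix ::
    "('b \<Rightarrow> ('c \<Rightarrow>\<^sub>0 ('v, 'k::field) polynomial)) \<Rightarrow> 'b \<Rightarrow> ('c \<Rightarrow>\<^sub>0 'k)" where
  "tensor_matrix D b = Poly_Mapping.map (\<lambda>q. Poly_Mapping.lookup q 0) (D b)"

definition tor_cycles ::
    "(nat \<Rightarrow> nat \<Rightarrow> nat) \<Rightarrow> (nat \<Rightarrow> (nat \<times> nat) \<Rightarrow> ((nat \<times> nat) \<Rightarrow>\<^sub>0 ('v, 'k::field) polynomial))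
      \<Rightarrow> nat \<Rightarrow> nat \<Rightarrow> ((nat \<times> nat) \<Rightarrow>\<^sub>0 'k) set" where
  "tor_cycles r D i j =
     {v \<in> tensor_component (r i) j. i = 0 \<or> linear_ext (tensor_matrix (D i)) v = 0}"

definition tor_boundaries ::
    "(nat \<Rightarrow> nat \<Rightarrow> nat) \<Rightarrow> (nat \<Rightarrow> (nat \<times> nat) \<Rightarrow> ((nat \<times> nat) \<Rightarrow>\<^sub>0 ('v, 'k::field) polynomial))
      \<Rightarrow> nat \<Rightarrow> nat \<Rightarrow> ((nat \<times> nat) \<Rightarrow>\<^sub>0 'k) set" where
  "tor_boundaries r D i j =
     linear_ext (tensor_matrix (D (i + 1))) ` tensor_component (r (i + 1)) j"

text \<open>
  The dimension of the degree \<open>j\<close> part of the \<open>i\<close>-th homology of the resolution tensored with \<open>k\<close>.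
  Boundaries are cycles and each \<open>tensor_component\<close> has finite dimension, so the dimension of
  the quotient is the difference of the two dimensions.
\<close>

definition tor_dim ::
    "(nat \<Rightarrow> nat \<Rightarrow> nat) \<Rightarrow> (nat \<Rightarrow> (nat \<times> nat) \<Rightarrow> ((nat \<times> nat) \<Rightarrow>\<^sub>0 ('v, 'k::field) polynomial))
      \<Rightarrow> nat \<Rightarrow> nat \<Rightarrow> nat" where
  "tor_dim r D i j =
     coordinate_space.dim (tor_cycles r D i j) - coordinate_space.dim (tor_boundaries r D i j)"

text \<open>
  \<open>graded_betti G i j\<close> is the dimension over \<open>k\<close> of \<open>Tor\<^sub>i(Q/G, k)\<^sub>j\<close>, for a homogeneous ideal \<open>G\<close>.
  It does not depend on the chosen resolution.
\<close>

definition graded_betti :: "('v::finite, 'k::field) polynomial set \<Rightarrow> nat \<Rightarrow> nat \<Rightarrow> nat" where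
  "graded_betti G i j =
     (case SOME (r, e, D). graded_free_resolution G r e D of (r, e, D) \<Rightarrow> tor_dim r D i j)"

section \<open>The numerical sequences\<close>

definition catalan :: "nat \<Rightarrow> rat" where
  "catalan k = 1 / of_nat (k + 1) * of_nat ((2 * k) choose k)"

definition ell :: "nat \<Rightarrow> nat" where
  "ell n = (n - 2) div 2"

text \<open>
  \<open>gamma_seq n k\<close> is meant for even \<open>n \<ge> 2\<close> and \<open>k \<le> n\<close>. For such \<open>n\<close>, \<open>n = 2 * ell n + 2\<close>, so the
  recursion gives the first half of the sequence and the symmetry gives the second half. The symmetry
  also holds at \<open>k \<le> ell n + 1\<close>, \<open>k \<ge> 1\<close>: there \<open>n - k\<close> is \<open>k\<close> itself, or the third equation applies
  to \<open>n - k\<close>.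
\<close>

function gamma_seq :: "nat \<Rightarrow> nat \<Rightarrow> int" where
  "gamma_seq n k =
     (if k = 0 then (if n = 2 then 1 else 0)
      else if k \<le> ell n + 1 then
        (- 1) ^ k * int (n choose (k + ell n + 2))
        - (\<Sum>i = 0..<k. (- 1) ^ (i + k) * int ((n - 1 + k - i) choose (n - 1)) * gamma_seq n i)
        - (\<Sum>i = 0..<ell n. (- 1) ^ (i + k) * int ((n - 1 + ell n + k - 2 * i) choose (n - 1))
                             * int (n choose i))
      else if k \<le> n then gamma_seq n (n - k)
      else 0)"
  by pat_completeness auto
termination
  by (relation "measure snd") (auto simp: ell_def)

declare gamma_seq.simps [simp del]

function rho_seq :: "nat \<Rightarrow> nat \<Rightarrow> int" where
  "rho_seq n k =
     (if k = 0 then 0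
      else
        (\<Sum>i = 0..<k. (- 1) ^ (i + k + 1) * int ((n + k - i - 1) choose (n - 1)) * rho_seq n i)
        + (\<Sum>i = 0..ell n. (- 1) ^ (i + k + 1) * int ((n + k + ell n - 2 * i) choose (n - 1))
                             * int ((n + 1) choose i)))"
  by pat_completeness auto
termination
  by (relation "measure snd") auto

declare rho_seq.simps [simp del]

end

theory Submission
  imports Defs "HOL-Library.Function_Algebras" "HOL-Computational_Algebra.Formal_Power_Series"
begin

text \<open>
  Dimension shifting along a graded free resolution identifies \<open>Tor\<^sub>i(A, k)\<^sub>j\<close> with the Koszul
  homology \<open>H\<^sub>i(x; A)\<^sub>j\<close>. For \<open>P = Q/J\<close> this is found by killing the quadrics one at a time: each of
  them is a nonzerodivisor which annihilates Koszul homology, so that the long exact sequences split.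
  The Euler characteristic then gives the Hilbert function \<open>(1 + t)\<^sup>n\<close> of \<open>P\<close>, and the top Koszul
  homology shows that the socle of \<open>P\<close> is \<open>P\<^sub>n\<close>, which is one-dimensional.

  The maximal rank of \<open>f\<^sub>n\<^sub>+\<^sub>1\<close> determines the Hilbert function of \<open>A\<close> and shows that \<open>A\<close> agrees with \<open>P\<close>
  up to degree \<open>l\<close>, which gives the strands below \<open>j - i = l\<close>. The pairing \<open>(a, b) \<mapsto> a b f\<^sub>n\<^sub>+\<^sub>1\<close> with
  values in \<open>P\<^sub>n\<close> is perfect on \<open>A\<close>, so that the Koszul complex is self-dual, which gives the strands
  above \<open>j - i = l\<close>. The remaining strand is forced by the Hilbert function, and this is the
  recursion for \<open>gamma_seq\<close>.

  The numerical claims are identities between power series which follow from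
  \<open>(1 - t\<^sup>2)\<^sup>n = (1 - t)\<^sup>n (1 + t)\<^sup>n\<close>.
\<close>

section \<open>Finite-dimensional subspaces\<close>

text \<open>Quotients are never formed. A graded module M = Z/B is kept as two families
  \<open>Z\<close>, \<open>B\<close> of finite-dimensional subspaces of one ambient space, indexed
  by integers so that shifts and negative degrees are uniform, and an isomorphism of quotients
  becomes an equality of differences of dimensions. \<open>graded_betti\<close> evaluates a
  resolution picked by \<open>SOME\<close>; Koszul homology is the intrinsic value with which every
  resolution agrees. The number l enters twice. As n = 2l + 2, C(n,i) <= C(n,i+2) for i <= l, with
  the reverse inequality for i >= l; so multiplication by the last quadric is injective on P_i for i
  <= l and surjective onto P_(i+2) for i >= l. And A has socle degree n - 2 = 2l, so duality
  exchanges the strands j - i < l with those j - i > l and maps the strand l to itself. Up to total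
  degree 2l + 1 the upper strands do not contribute to the Euler characteristic. This determines the
  middle strand for i <= l + 1, and duality gives the rest: hence a recursion on one half of
  \<open>gamma_seq\<close> and a symmetry for the other.\<close>

locale fd_space = vector_space scale for scale :: "'k::field \<Rightarrow> 'b::ab_group_add \<Rightarrow> 'b"
begin

text \<open>The ambient polynomial and free modules are infinite-dimensional, so finiteness is a
  property of the single subspace. \<open>dim\<close> is a cardinality and carries information only
  under it.\<close>

definition fin_dim :: "'b set \<Rightarrow> bool" where
  "fin_dim U \<longleftrightarrow> (\<exists>B. finite B \<and> U \<subseteq> span B)"

lemma fin_dim_subset: "fin_dim W \<Longrightarrow> U \<subseteq> W \<Longrightarrow> fin_dim U"
  unfolding fin_dim_def by blast

lemma fin_dim_sum:
  assumes "fin_dim U" "fin_dim W"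
  shows "fin_dim {u + w |u w. u \<in> U \<and> w \<in> W}"
proof -
  obtain A B where "finite A" "U \<subseteq> span A" "finite B" "W \<subseteq> span B"
    using assms unfolding fin_dim_def by blast
  moreover have "span A \<subseteq> span (A \<union> B)" "span B \<subseteq> span (A \<union> B)" by (simp_all add: span_mono)
  ultimately have "finite (A \<union> B) \<and> {u + w |u w. u \<in> U \<and> w \<in> W} \<subseteq> span (A \<union> B)"
    by (auto intro!: span_add)
  then show ?thesis unfolding fin_dim_def by blast
qed

lemma fin_dim_independent:
  assumes "fin_dim U" "independent B" "B \<subseteq> U"
  shows "finite B" "card B \<le> dim U"
proof -
  obtain A where A: "finite A" "U \<subseteq> span A" using assms unfolding fin_dim_def by blast
  show "finite B" using independent_span_bound[OF A(1) assms(2)] assms A by blast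
  obtain C where C: "C \<subseteq> U" "independent C" "U \<subseteq> span C" "card C = dim U"
    using basis_exists by blast
  have "finite C" using independent_span_bound[OF A(1) C(2)] C A by blast
  then show "card B \<le> dim U" using independent_span_bound[OF _ assms(2)] C assms(3) by fastforce
qed

lemma dim_mono_fin_dim: "fin_dim W \<Longrightarrow> U \<subseteq> W \<Longrightarrow> dim U \<le> dim W"
  by (metis basis_exists fin_dim_independent(2) subset_trans)

lemma eq_if_dim_le:
  assumes "fin_dim W" "subspace U" "U \<subseteq> W" "dim W \<le> dim U"
  shows "U = W"
proof -
  obtain B where B: "B \<subseteq> U" "independent B" "U \<subseteq> span B" "card B = dim U"
    using basis_exists by blast
  have "w \<in> span B" if "w \<in> W" for w
  proof (rule ccontr)
    assume w: "w \<notin> span B"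
    then have i: "independent (insert w B)" "w \<notin> B" using B by (auto simp: independent_insertI span_base)
    have "insert w B \<subseteq> W" using that B assms by auto
    note fin_dim_independent[OF assms(1) i(1) this]
    then show False using B \<open>w \<notin> B\<close> assms(4) by simp
  qed
  moreover have "span B \<subseteq> U" using B assms(2) by (simp add: span_minimal)
  ultimately show ?thesis using assms(3) by auto
qed

lemma dim_zero_subspace: "dim {0} = 0"
  by (metis card.empty dim_eq_card_independent dim_span independent_empty span_empty)

lemma fin_dim_zero: "fin_dim {0}"
  unfolding fin_dim_def by (rule exI[of _ "{}"]) auto

end

locale fd_space_pair = vs1: fd_space s1 + vs2: fd_space s2
  for s1 :: "'k::field \<Rightarrow> 'b::ab_group_add \<Rightarrow> 'b" and s2 :: "'k \<Rightarrow> 'c::ab_group_add \<Rightarrow> 'c"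
begin

sublocale vector_space_pair s1 s2 ..

abbreviation "lin \<equiv> Vector_Spaces.linear s1 s2"

lemma subspace_image: "lin f \<Longrightarrow> vs1.subspace U \<Longrightarrow> vs2.subspace (f ` U)"
  using linear_subspace_image by blast

lemma fin_dim_image:
  assumes "lin f" "vs1.fin_dim U" shows "vs2.fin_dim (f ` U)"
proof -
  obtain B where "finite B" "U \<subseteq> vs1.span B" using assms unfolding vs1.fin_dim_def by blast
  then have "finite (f ` B)" "f ` U \<subseteq> vs2.span (f ` B)"
    using linear_span_image[OF assms(1)] by auto
  then show ?thesis unfolding vs2.fin_dim_def by blast
qed

text \<open>A basis \<open>B\<close> of the kernel extends to a basis \<open>C\<close> of
  \<open>U\<close>. On the span of \<open>C - B\<close> the map is injective, so the images of
  \<open>C - B\<close> form a basis of the image.\<close>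

lemma rank_nullity:
  assumes f: "lin f" and U: "vs1.subspace U" "vs1.fin_dim U"
  shows "vs1.dim U = vs1.dim {u \<in> U. f u = 0} + vs2.dim (f ` U)"
proof -
  let ?K = "{u \<in> U. f u = 0}"
  have K: "vs1.subspace ?K"
    using U(1) linear_0[OF f] linear_add[OF f] linear_scale[OF f]
    by (auto simp: vs1.subspace_def)
  obtain B where B: "B \<subseteq> ?K" "vs1.independent B" "?K \<subseteq> vs1.span B"
    using vs1.maximal_independent_subset by blast
  obtain C where C: "B \<subseteq> C" "C \<subseteq> U" "vs1.independent C" "U \<subseteq> vs1.span C"
    using vs1.maximal_independent_subset_extend[of B U] B by blast
  have finC: "finite C" using vs1.fin_dim_independent U C by blast
  have kerB: "x \<in> vs1.span B" if "x \<in> vs1.span C" "f x = 0" for x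
    using that B(3) vs1.span_minimal[OF C(2) U(1)] by blast
  \<comment> \<open>\<open>B\<close> and \<open>C - B\<close> are disjoint parts of one independent
    set: the coordinates of a common element of the two spans are supported in both parts, hence are
    all zero.\<close>
  have disj: "x = 0" if "x \<in> vs1.span B" "x \<in> vs1.span (C - B)" for x
  proof -
    have "vs1.span (C - B) \<inter> vs1.span (C - (C - B)) = {0}" if "C - B \<subseteq> C"
    proof -
      have "y = 0" if y: "y \<in> vs1.span (C - B)" "y \<in> vs1.span B" for y
      proof -
        have "vs1.representation C y = vs1.representation (C - B) y"
          using vs1.representation_extend[OF C(3) y(1)] by auto
        moreover have "vs1.representation C y = vs1.representation B y"
          using vs1.representation_extend[OF C(3) y(2)] C(1) by auto
        ultimately have "vs1.representation C y b = 0" for b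
          using vs1.representation_ne_zero[of "C - B" y b] vs1.representation_ne_zero[of B y b] by fastforce
        moreover have "(\<Sum>b | vs1.representation C y b \<noteq> 0. s1 (vs1.representation C y b) b) = y"
          using vs1.sum_nonzero_representation_eq[OF C(3)] y(1) vs1.span_mono[of "C - B" C] by blast
        ultimately show ?thesis by simp
      qed
      moreover have "C - (C - B) = B" using C(1) by blast
      ultimately show ?thesis using vs1.span_zero by auto
    qed
    moreover have "C - (C - B) = B" using C(1) by blast
    ultimately show ?thesis using that by auto
  qed
  have inj: "inj_on f (vs1.span (C - B))"
  proof (rule inj_onI)
    fix x y assume x: "x \<in> vs1.span (C - B)" and y: "y \<in> vs1.span (C - B)" and eq: "f x = f y"
    have d: "x - y \<in> vs1.span (C - B)" using x y by (rule vs1.span_diff)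
    have "f (x - y) = 0" using eq linear_diff[OF f] by simp
    then have "x - y \<in> vs1.span B" using kerB d vs1.span_mono[of "C - B" C] by blast
    then show "x = y" using disj d by fastforce
  qed
  have ind: "vs2.independent (f ` (C - B))"
    using linear_independent_injective_image[OF f _ inj] vs1.independent_mono[OF C(3)] by blast
  have "f ` U \<subseteq> vs2.span (f ` (C - B))"
  proof
    fix y assume "y \<in> f ` U"
    then obtain u where u: "u \<in> U" "y = f u" by blast
    then have "u \<in> vs1.span (B \<union> (C - B))" using C by (metis Un_Diff_cancel Un_absorb1 subsetD)
    then obtain a b where "u = a + b" "a \<in> vs1.span B" "b \<in> vs1.span (C - B)"
      unfolding vs1.span_Un by blast
    moreover have "f a = 0" using vs1.span_minimal[OF B(1) K] \<open>a \<in> vs1.span B\<close> by blast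
    ultimately show "y \<in> vs2.span (f ` (C - B))"
      using u linear_add[OF f] linear_span_image[OF f] by auto
  qed
  moreover have "f ` (C - B) \<subseteq> f ` U" using C by blast
  ultimately have "vs2.dim (f ` U) = card (f ` (C - B))" using ind vs2.basis_card_eq_dim by metis
  also have "\<dots> = card (C - B)"
    using card_image inj_on_subset[OF inj vs1.span_superset] by blast
  finally have "vs2.dim (f ` U) = card C - card B"
    using C(1) finC by (simp add: card_Diff_subset finite_subset)
  moreover have "vs1.dim U = card C" using vs1.basis_card_eq_dim[OF C(2,4,3)] by simp
  moreover have "vs1.dim ?K = card B" using vs1.basis_card_eq_dim[OF B(1,3,2)] by simp
  moreover have "card B \<le> card C" using C(1) finC by (simp add: card_mono)
  ultimately show ?thesis by simp
qed

end

section \<open>Dimensions of sums and of quotients\<close>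

context fd_space
begin

text \<open>The endomorphism kills a basis of \<open>W\<close> and fixes the other members of a
  basis of the whole space. It stands in for the projection onto the quotient by \<open>W\<close>,
  with values in the same space.\<close>

lemma exists_projection:
  assumes "subspace W"
  obtains \<pi> where "Vector_Spaces.linear scale scale \<pi>" "\<And>x. \<pi> x = 0 \<longleftrightarrow> x \<in> W"
proof -
  interpret fd_space_pair scale scale ..
  obtain B where B: "B \<subseteq> W" "independent B" "W \<subseteq> span B"
    using maximal_independent_subset by blast
  have W: "span B = W" using B assms by (simp add: span_minimal subset_antisym)
  let ?C = "extend_basis B"
  have C: "B \<subseteq> ?C" "independent ?C" "span ?C = UNIV"
    using extend_basis_superset independent_extend_basis span_extend_basis B(2) by auto
  obtain \<pi> where l: "Vector_Spaces.linear scale scale \<pi>" and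
    \<pi>: "\<forall>x\<in>?C. \<pi> x = (if x \<in> B then 0 else x)"
    using linear_independent_extend[OF C(2), of "\<lambda>x. if x \<in> B then 0 else x"] by blast
  have 1: "\<pi> x = 0" if "x \<in> span B" for x
  proof -
    have "\<pi> ` span B = span (\<pi> ` B)" using linear_span_image[OF l] by simp
    also have "\<dots> \<subseteq> span {0}" using \<pi> C(1) by (intro span_mono) auto
    finally show ?thesis using that by auto
  qed
  have 2: "\<pi> x = x" if "x \<in> span (?C - B)" for x
    using linear_eq_on[OF l linear_id that] \<pi> by (auto simp: id_def)
  have "\<pi> x = 0 \<longleftrightarrow> x \<in> W" for x
  proof -
    have "x \<in> span (B \<union> (?C - B))" using C by (metis Un_Diff_cancel Un_absorb1 UNIV_I)
    then obtain a b where "x = a + b" "a \<in> span B" "b \<in> span (?C - B)"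
      unfolding span_Un by blast
    then have "\<pi> x = b" using 1 2 linear_add[OF l] by simp
    then show ?thesis using 1 W \<open>x = a + b\<close> \<open>a \<in> span B\<close> by auto
  qed
  then show thesis using l that by blast
qed

text \<open>The projection that kills \<open>W\<close> has the same image on \<open>U\<close> and on
  the sum, while its kernels there are \<open>U \<inter> W\<close> and \<open>W\<close>;
  rank-nullity is applied to both.\<close>

lemma dim_sum_Int:
  assumes U: "subspace U" "fin_dim U" and W: "subspace W" "fin_dim W"
  shows "dim {u + w |u w. u \<in> U \<and> w \<in> W} + dim (U \<inter> W) = dim U + dim W"
proof -
  interpret fd_space_pair scale scale ..
  obtain \<pi> where l: "Vector_Spaces.linear scale scale \<pi>" and \<pi>: "\<And>x. \<pi> x = 0 \<longleftrightarrow> x \<in> W"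
    using exists_projection[OF W(1)] by blast
  let ?S = "{u + w |u w. u \<in> U \<and> w \<in> W}"
  have S: "subspace ?S" "fin_dim ?S" using U W subspace_sums fin_dim_sum by auto
  have "W \<subseteq> ?S"
  proof
    fix w assume "w \<in> W"
    then show "w \<in> ?S" using subspace_0[OF U(1)] by (intro CollectI exI[of _ 0] exI[of _ w]) auto
  qed
  then have "{u \<in> ?S. \<pi> u = 0} = W" using \<pi> by auto
  moreover have "{u \<in> U. \<pi> u = 0} = U \<inter> W" using \<pi> by auto
  moreover have "\<pi> ` ?S = \<pi> ` U"
  proof
    have "\<pi> (u + w) = \<pi> u" if "w \<in> W" for u w using \<pi>[of w] that linear_add[OF l] by simp
    then show "\<pi> ` ?S \<subseteq> \<pi> ` U" by auto
    show "\<pi> ` U \<subseteq> \<pi> ` ?S"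
    proof (rule image_mono)
      show "U \<subseteq> ?S"
        using subspace_0[OF W(1)] by (metis (mono_tags, lifting) add.right_neutral mem_Collect_eq subsetI)
    qed
  qed
  ultimately show ?thesis using rank_nullity[OF l S] rank_nullity[OF l U] by simp
qed

end

context fd_space_pair
begin

text \<open>The dimension count for an isomorphism U/U' -> W/W' induced by \<open>f\<close>:
  \<open>sub\<close> is surjectivity, and \<open>pre\<close> says that the map is well defined and
  injective. Most comparisons of homology groups below are instances of it.\<close>

lemma dim_diff_eq_dim_diff:
  assumes f: "lin f" and U: "vs1.subspace U" "vs1.fin_dim U" and U': "vs1.subspace U'" "U' \<subseteq> U"
    and W: "vs2.subspace W'" "vs2.fin_dim W'"
    and sub: "W = {f u + w |u w. u \<in> U \<and> w \<in> W'}"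
    and pre: "\<And>u. u \<in> U \<Longrightarrow> f u \<in> W' \<longleftrightarrow> u \<in> U'"
  shows "int (vs1.dim U) - int (vs1.dim U') = int (vs2.dim W) - int (vs2.dim W')"
proof -
  have U'fin: "vs1.fin_dim U'" using U(2) U'(2) vs1.fin_dim_subset by blast
  have "{u \<in> U'. f u = 0} = {u \<in> U. f u = 0}"
    using U' pre vs2.subspace_0[OF W(1)] by (metis (mono_tags, lifting) subset_eq)
  moreover have "f ` U' = f ` U \<inter> W'" using U' pre by blast
  moreover have "W = {u + w |u w. u \<in> f ` U \<and> w \<in> W'}" using sub by blast
  moreover note rank_nullity[OF f U] rank_nullity[OF f U'(1) U'fin]
    vs2.dim_sum_Int[OF subspace_image[OF f U(1)] fin_dim_image[OF f U(2)] W]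
  ultimately show ?thesis by simp
qed

end

section \<open>Bilinear pairings and their radicals\<close>

lemma fd_space_mult: "fd_space ((*) :: 'k::field \<Rightarrow> 'k \<Rightarrow> 'k)"
  by unfold_locales (auto simp: algebra_simps)

context fd_space
begin

lemma dim_le_dim_kernel_Suc:
  fixes g :: "'b \<Rightarrow> 'k"
  assumes "Vector_Spaces.linear scale (*) g" "subspace U" "fin_dim U"
  shows "dim U \<le> dim {u \<in> U. g u = 0} + 1"
proof -
  interpret f: fd_space "(*) :: 'k \<Rightarrow> 'k \<Rightarrow> 'k" by (rule fd_space_mult)
  interpret p: fd_space_pair scale "(*) :: 'k \<Rightarrow> 'k \<Rightarrow> 'k" ..
  have "UNIV \<subseteq> f.span {1}"
    by (metis f.span_base f.span_scale insertI1 mult.right_neutral subsetI)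
  then have "f.dim (g ` U) \<le> card {1::'k}"
    by (meson f.dim_le_card finite.emptyI finite.insertI subset_UNIV subset_trans)
  then show ?thesis using p.rank_nullity[OF assms] by simp
qed

lemma dim_le_dim_common_kernel:
  fixes g :: "'i \<Rightarrow> 'b \<Rightarrow> 'k"
  assumes "finite S" "\<And>i. i \<in> S \<Longrightarrow> Vector_Spaces.linear scale (*) (g i)" "subspace U" "fin_dim U"
  shows "dim U \<le> dim {u \<in> U. \<forall>i\<in>S. g i u = 0} + card S"
  using assms
proof (induction S)
  case (insert i S)
  interpret f: fd_space "(*) :: 'k \<Rightarrow> 'k \<Rightarrow> 'k" by (rule fd_space_mult)
  interpret p: fd_space_pair scale "(*) :: 'k \<Rightarrow> 'k \<Rightarrow> 'k" ..
  let ?V = "{u \<in> U. \<forall>i\<in>S. g i u = 0}"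
  have *: "g i (x + y) = g i x + g i y" "g i (scale c x) = c * g i x" "g i 0 = 0" if "i \<in> S" for i c x y
    using insert.prems(1)[of i] that by (auto simp: p.linear_add p.linear_scale p.linear_0)
  have V: "subspace ?V" using insert.prems(2) * by (auto simp: subspace_def)
  have "fin_dim ?V" using insert.prems(3) by (rule fin_dim_subset) auto
  then have "dim ?V \<le> dim {u \<in> ?V. g i u = 0} + 1"
    using dim_le_dim_kernel_Suc insert.prems V by blast
  moreover have "{u \<in> ?V. g i u = 0} = {u \<in> U. \<forall>i\<in>insert i S. g i u = 0}" by auto
  ultimately show ?case using insert by simp
qed simp

end

context fd_space_pair
begin

text \<open>A basis \<open>B\<close> of the right radical R extends to a basis \<open>C\<close> of
  \<open>W\<close>. An element of \<open>U\<close> orthogonal to \<open>C - B\<close> is orthogonal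
  to all of \<open>W\<close>, so the left radical is cut out of \<open>U\<close> by dim W - dim R
  linear conditions. Exchanging the two sides gives the opposite inequality.\<close>

lemma bilinear_rank_le:
  fixes \<beta> :: "'b \<Rightarrow> 'c \<Rightarrow> 'k"
  assumes l1: "\<And>w. Vector_Spaces.linear s1 (*) (\<lambda>u. \<beta> u w)"
    and l2: "\<And>u. Vector_Spaces.linear s2 (*) (\<beta> u)"
    and U: "vs1.subspace U" "vs1.fin_dim U" and W: "vs2.subspace W" "vs2.fin_dim W"
  shows "vs1.dim U + vs2.dim {w \<in> W. \<forall>u\<in>U. \<beta> u w = 0} \<le> vs2.dim W + vs1.dim {u \<in> U. \<forall>w\<in>W. \<beta> u w = 0}"
proof -
  interpret f: fd_space "(*) :: 'k \<Rightarrow> 'k \<Rightarrow> 'k" by (rule fd_space_mult)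
  interpret p: fd_space_pair s2 "(*) :: 'k \<Rightarrow> 'k \<Rightarrow> 'k" ..
  let ?R = "{w \<in> W. \<forall>u\<in>U. \<beta> u w = 0}"
  obtain B where B: "B \<subseteq> ?R" "vs2.independent B" "?R \<subseteq> vs2.span B"
    using vs2.maximal_independent_subset by blast
  obtain C where C: "B \<subseteq> C" "C \<subseteq> W" "vs2.independent C" "W \<subseteq> vs2.span C"
    using vs2.maximal_independent_subset_extend[of B W] B by blast
  have finC: "finite C" using vs2.fin_dim_independent W C by blast
  have "vs1.dim U \<le> vs1.dim {u \<in> U. \<forall>w\<in>C - B. \<beta> u w = 0} + card (C - B)"
    using finC l1 U by (intro vs1.dim_le_dim_common_kernel) auto
  moreover have "{u \<in> U. \<forall>w\<in>C - B. \<beta> u w = 0} = {u \<in> U. \<forall>w\<in>W. \<beta> u w = 0}"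
  proof -
    have "\<beta> u w = 0" if "u \<in> U" "\<forall>w\<in>C - B. \<beta> u w = 0" "w \<in> W" for u w
    proof -
      have "\<forall>w\<in>C. \<beta> u w = 0" using that B by blast
      moreover have "w \<in> vs2.span C" using that C by blast
      ultimately show ?thesis by (metis p.linear_eq_0_on_span[OF l2])
    qed
    then show ?thesis using C by blast
  qed
  moreover have "card (C - B) = card C - card B" "card B \<le> card C"
    using C(1) finC by (auto simp: card_Diff_subset finite_subset card_mono)
  moreover have "vs2.dim W = card C" using vs2.basis_card_eq_dim[OF C(2,4,3)] by simp
  moreover have "vs2.dim ?R = card B" using vs2.basis_card_eq_dim[OF B(1,3,2)] by simp
  ultimately show ?thesis by simp
qed

lemma bilinear_rank_eq:
  fixes \<beta> :: "'b \<Rightarrow> 'c \<Rightarrow> 'k"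
  assumes l1: "\<And>w. Vector_Spaces.linear s1 (*) (\<lambda>u. \<beta> u w)"
    and l2: "\<And>u. Vector_Spaces.linear s2 (*) (\<beta> u)"
    and U: "vs1.subspace U" "vs1.fin_dim U" and W: "vs2.subspace W" "vs2.fin_dim W"
  shows "vs1.dim U + vs2.dim {w \<in> W. \<forall>u\<in>U. \<beta> u w = 0} = vs2.dim W + vs1.dim {u \<in> U. \<forall>w\<in>W. \<beta> u w = 0}"
proof -
  interpret q: fd_space_pair s2 s1 ..
  have 1: "vs1.dim U + vs2.dim {w \<in> W. \<forall>u\<in>U. \<beta> u w = 0} \<le> vs2.dim W + vs1.dim {u \<in> U. \<forall>w\<in>W. \<beta> u w = 0}"
    by (rule bilinear_rank_le[OF l1 l2 U W])
  have 2: "vs2.dim W + vs1.dim {u \<in> U. \<forall>w\<in>W. \<beta> u w = 0} \<le> vs1.dim U + vs2.dim {w \<in> W. \<forall>u\<in>U. \<beta> u w = 0}"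
    by (rule q.bilinear_rank_le[where \<beta> = "\<lambda>w u. \<beta> u w"]) (rule l1 l2 U W)+
  show ?thesis using 1 2 by (rule order.antisym)
qed

end

section \<open>The Koszul complex of a graded module\<close>

text \<open>The type of variables carries no order. An arbitrary injection into the naturals
  supplies the one that Koszul signs and least variables refer to.\<close>

definition var_index :: "'v::finite \<Rightarrow> nat" where
  "var_index = (SOME f. inj f)"

lemma inj_var_index: "inj (var_index :: 'v::finite \<Rightarrow> nat)"
proof -
  have "\<exists>f :: 'v \<Rightarrow> nat. inj f"
    using finite_imp_inj_to_nat_seg[of "UNIV :: 'v set"] by auto
  then show ?thesis unfolding var_index_def by (rule someI_ex)
qed

lemma var_index_linear: "u \<noteq> v \<Longrightarrow> var_index u < var_index v \<or> var_index v < var_index u"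
  using inj_var_index by (metis injD linorder_neqE_nat)

text \<open>The sign by which e_v wedge e_T differs from the basis vector of
  \<open>insert v T\<close>, for \<open>v\<close> outside \<open>T\<close>.\<close>

definition koszul_sign :: "'v::finite \<Rightarrow> 'v set \<Rightarrow> 'k::field" where
  "koszul_sign v T = (- 1) ^ card {u \<in> T. var_index u < var_index v}"

lemma koszul_sign_square [simp]: "koszul_sign v T * koszul_sign v T = 1"
  by (simp add: koszul_sign_def flip: power_add mult_2)

lemma koszul_sign_insert:
  assumes "v \<notin> T"
  shows "koszul_sign u (insert v T) =
    (if var_index v < var_index u then - koszul_sign u T else koszul_sign u T)"
proof -
  have "{w \<in> insert v T. var_index w < var_index u} =
    (if var_index v < var_index u then insert v {w \<in> T. var_index w < var_index u}
     else {w \<in> T. var_index w < var_index u})" by auto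
  then show ?thesis using assms by (simp add: koszul_sign_def)
qed

text \<open>Of \<open>u\<close> and \<open>v\<close> exactly one precedes the other, so exactly one
  of \<open>koszul_sign u (insert v T)\<close> and \<open>koszul_sign v (insert u T)\<close> differs
  from the sign over \<open>T\<close>. This form is the reason for \<open>bd_bd\<close>, the next
  one for \<open>bd_wedge\<close>.\<close>

lemma koszul_sign_swap:
  assumes "u \<noteq> v" "u \<notin> T" "v \<notin> T"
  shows "(koszul_sign v T * koszul_sign u (insert v T) :: 'k::field) =
    - (koszul_sign u T * koszul_sign v (insert u T))"
  using var_index_linear[OF assms(1)] assms by (auto simp: koszul_sign_insert)

lemma koszul_sign_swap':
  assumes "u \<noteq> v" "u \<notin> T" "v \<notin> T"
  shows "(koszul_sign v (insert u T) * koszul_sign u (insert v T) :: 'k::field) =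
    - (koszul_sign u T * koszul_sign v T)"
  using var_index_linear[OF assms(1)] assms by (auto simp: koszul_sign_insert)

text \<open>A vector space with commuting endomorphisms \<open>X v\<close> is a module over the
  polynomial ring. This form covers at once the ring itself and its free modules, whose elements
  have different types.\<close>

locale poly_space = fd_space sc for sc :: "'k::field \<Rightarrow> 'a::ab_group_add \<Rightarrow> 'a" +
  fixes X :: "'v::finite \<Rightarrow> 'a \<Rightarrow> 'a"
  assumes X_add: "X v (x + y) = X v x + X v y"
    and X_scale: "X v (sc c x) = sc c (X v x)"
    and X_commute: "X u (X v x) = X v (X u x)"
begin

definition csc :: "'k \<Rightarrow> ('v set \<Rightarrow> 'a) \<Rightarrow> ('v set \<Rightarrow> 'a)" where
  "csc c f = (\<lambda>S. sc c (f S))"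

lemma csc_apply: "csc c f S = sc c (f S)"
  by (simp add: csc_def)

sublocale ch: fd_space csc
  by unfold_locales (auto simp: csc_def fun_eq_iff scale_right_distrib scale_left_distrib)

sublocale cc: fd_space_pair csc csc ..
sublocale cv: fd_space_pair csc sc ..
sublocale vc: fd_space_pair sc csc ..
sublocale vv: fd_space_pair sc sc ..

lemma X_zero [simp]: "X v 0 = 0"
  using X_add[of v 0 0] by simp

lemma X_sum: "X v (sum f A) = (\<Sum>i\<in>A. X v (f i))"
  by (induction A rule: infinite_finite_induct) (auto simp: X_add)

text \<open>The Koszul differential by coefficients. A chain is a function on sets of variables, its
  value at \<open>S\<close> being the coefficient of e_S; the coefficient of e_T in the boundary
  collects the contributions of all e_S with \<open>S = insert v T\<close>.\<close>

definition bd :: "('v set \<Rightarrow> 'a) \<Rightarrow> ('v set \<Rightarrow> 'a)" where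
  "bd c T = (\<Sum>v\<in>- T. sc (koszul_sign v T) (X v (c (insert v T))))"

lemma bd_add: "bd (c + d) = bd c + bd d"
  by (rule ext) (simp add: bd_def X_add scale_right_distrib sum.distrib)

lemma bd_scale: "bd (csc a c) = csc a (bd c)"
  by (rule ext) (simp add: csc_apply bd_def X_scale scale_sum_right mult.commute)

lemma linear_bd: "cc.lin bd"
  by (rule Vector_Spaces.linear_iff[THEN iffD2])
    (simp add: bd_add bd_scale ch.vector_space_axioms)

lemma bd_zero [simp]: "bd 0 = 0"
  using cc.linear_0[OF linear_bd] .

lemma bd_diff: "bd (c - d) = bd c - bd d"
  using cc.linear_diff[OF linear_bd] .

lemma bd_sum: "bd (sum f A) = (\<Sum>i\<in>A. bd (f i))"
  using cc.linear_sum[OF linear_bd] .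

text \<open>Two variables outside \<open>T\<close> are removed in either order, and the two
  contributions are opposite by \<open>koszul_sign_swap\<close> and the commutation of the
  \<open>X v\<close>.\<close>

lemma bd_bd [simp]: "bd (bd c) = 0"
proof (rule ext)
  fix T
  let ?t = "\<lambda>(v, u). sc (koszul_sign v T * koszul_sign u (insert v T)) (X v (X u (c (insert u (insert v T)))))"
  let ?P = "{(v, u). v \<notin> T \<and> u \<notin> T \<and> var_index v < var_index u}"
  let ?Q = "{(v, u). v \<notin> T \<and> u \<notin> T \<and> var_index u < var_index v}"
  have "bd (bd c) T = (\<Sum>v\<in>- T. \<Sum>u\<in>- insert v T. ?t (v, u))"
    by (simp add: bd_def X_sum X_scale scale_sum_right)
  also have "\<dots> = sum ?t (SIGMA v:- T. - insert v T)"
    by (subst sum.Sigma) auto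
  also have "(SIGMA v:- T. - insert v T) = ?P \<union> ?Q"
    using var_index_linear by auto
  also have "sum ?t (?P \<union> ?Q) = sum ?t ?P + sum ?t ?Q"
    by (rule sum.union_disjoint) auto
  also have "sum ?t ?Q = (\<Sum>p\<in>?P. ?t (prod.swap p))"
    by (rule sum.reindex_bij_witness[of _ prod.swap prod.swap]) auto
  also have "\<dots> = (\<Sum>p\<in>?P. - ?t p)"
  proof (rule sum.cong)
    fix p assume "p \<in> ?P"
    then obtain v u where p: "p = (v, u)" "v \<notin> T" "u \<notin> T" "u \<noteq> v" by auto
    have "?t (u, v) = sc (koszul_sign u T * koszul_sign v (insert u T)) (X v (X u (c (insert u (insert v T)))))"
      by (simp add: insert_commute X_commute[of u])
    also have "\<dots> = - ?t (v, u)"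
      using koszul_sign_swap[OF p(4,3,2), where 'k = 'k] by simp
    finally show "?t (prod.swap p) = - ?t p" by (simp add: p)
  qed simp
  finally show "bd (bd c) T = 0 T" by (simp add: sum_negf)
qed

definition wedge :: "'v \<Rightarrow> ('v set \<Rightarrow> 'a) \<Rightarrow> ('v set \<Rightarrow> 'a)" where
  "wedge u c S = (if u \<in> S then sc (koszul_sign u (S - {u})) (c (S - {u})) else 0)"

text \<open>Multiplication by a variable is null-homotopic, with exterior multiplication by e_u as
  the homotopy. If \<open>u\<close> is not in \<open>T\<close>, only the term v = u of the boundary
  is nonzero; if it is, the term v = u of \<open>wedge u (bd c)\<close> yields the right-hand side
  and the other terms cancel in pairs by \<open>koszul_sign_swap'\<close>.\<close>

lemma bd_wedge: "bd (wedge u c) + wedge u (bd c) = X u \<circ> c"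
proof (rule ext)
  fix T
  show "(bd (wedge u c) + wedge u (bd c)) T = (X u \<circ> c) T"
  proof (cases "u \<in> T")
    case False
    have "bd (wedge u c) T = (\<Sum>v\<in>- T. if v = u then X u (c T) else 0)"
      unfolding bd_def
    proof (rule sum.cong)
      fix v assume "v \<in> - T"
      then show "sc (koszul_sign v T) (X v (wedge u c (insert v T))) = (if v = u then X u (c T) else 0)"
        using False by (auto simp: wedge_def X_scale)
    qed simp
    then show ?thesis using False by (simp add: wedge_def)
  next
    case True
    define R where "R = T - {u}"
    have T: "T = insert u R" "u \<notin> R" using True by (auto simp: R_def)
    have R: "- R = insert u (- T)" "u \<notin> - T" using True by (auto simp: R_def)
    have "wedge u (bd c) T = sc (koszul_sign u R) (\<Sum>v\<in>- R. sc (koszul_sign v R) (X v (c (insert v R))))"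
      using True by (simp add: wedge_def bd_def R_def)
    also have "\<dots> = X u (c T) + (\<Sum>v\<in>- T. sc (koszul_sign u R * koszul_sign v R) (X v (c (insert v R))))"
      unfolding R(1) using R(2) T by (simp add: scale_right_distrib scale_sum_right)
    finally have 1: "wedge u (bd c) T = X u (c T) + (\<Sum>v\<in>- T. sc (koszul_sign u R * koszul_sign v R) (X v (c (insert v R))))" .
    have "bd (wedge u c) T = (\<Sum>v\<in>- T. - sc (koszul_sign u R * koszul_sign v R) (X v (c (insert v R))))"
      unfolding bd_def
    proof (rule sum.cong)
      fix v assume "v \<in> - T"
      then have v: "v \<notin> R" "v \<noteq> u" using T by auto
      then have "insert v T - {u} = insert v R" using T by auto
      then have "sc (koszul_sign v T) (X v (wedge u c (insert v T))) =
          sc (koszul_sign v (insert u R) * koszul_sign u (insert v R)) (X v (c (insert v R)))"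
        using True by (simp add: wedge_def X_scale T(1))
      then show "sc (koszul_sign v T) (X v (wedge u c (insert v T))) =
          - sc (koszul_sign u R * koszul_sign v R) (X v (c (insert v R)))"
        using koszul_sign_swap'[of u v R, where 'k = 'k] v T by simp
    qed simp
    then show ?thesis using 1 by (simp add: sum_negf)
  qed
qed

text \<open>An integer degree keeps \<open>p - 1\<close> meaningful everywhere; for negative
  \<open>p\<close>, and for \<open>p\<close> above the number of variables, only the zero chain is
  left.\<close>

definition chains :: "int \<Rightarrow> 'a set \<Rightarrow> ('v set \<Rightarrow> 'a) set" where
  "chains p W = {c. \<forall>S. c S \<in> (if int (card S) = p then W else {0})}"

lemma chains_value: "c \<in> chains p W \<Longrightarrow> 0 \<in> W \<Longrightarrow> c S \<in> W"
  unfolding chains_def mem_Collect_eq by (drule spec[of _ S]) (auto split: if_splits)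

lemma chains_mono: "c \<in> chains p W \<Longrightarrow> W \<subseteq> W' \<Longrightarrow> c \<in> chains p W'"
  unfolding chains_def by (auto split: if_splits)

lemma chains_off: "c \<in> chains p W \<Longrightarrow> int (card S) \<noteq> p \<Longrightarrow> c S = 0"
  unfolding chains_def mem_Collect_eq by (drule spec[of _ S]) auto

lemma chains_on: "c \<in> chains p W \<Longrightarrow> int (card S) = p \<Longrightarrow> c S \<in> W"
  unfolding chains_def mem_Collect_eq by (drule spec[of _ S]) auto

lemma chainsI: "(\<And>S. int (card S) = p \<Longrightarrow> c S \<in> W) \<Longrightarrow> (\<And>S. int (card S) \<noteq> p \<Longrightarrow> c S = 0) \<Longrightarrow> c \<in> chains p W"
  unfolding chains_def by auto

lemma chains_map: "c \<in> chains p W \<Longrightarrow> (\<And>x. x \<in> W \<Longrightarrow> f x \<in> W') \<Longrightarrow> f 0 = 0 \<Longrightarrow> f \<circ> c \<in> chains p W'"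
  by (rule chainsI) (auto dest: chains_on chains_off)

lemma chains_comap: "f \<circ> c \<in> chains p W' \<Longrightarrow> c \<in> chains p W \<Longrightarrow> (\<And>x. x \<in> W \<Longrightarrow> f x \<in> W' \<Longrightarrow> x \<in> B) \<Longrightarrow> c \<in> chains p B"
proof (rule chainsI)
  fix S :: "'v set" assume a: "f \<circ> c \<in> chains p W'" "c \<in> chains p W" "\<And>x. x \<in> W \<Longrightarrow> f x \<in> W' \<Longrightarrow> x \<in> B" "int (card (S :: 'v set)) = p"
  show "c S \<in> B" using chains_on[OF a(1,4)] chains_on[OF a(2,4)] a(3) by simp
qed (rule chains_off)

lemma subspace_chains: "subspace W \<Longrightarrow> ch.subspace (chains p W)"
  unfolding ch.subspace_def subspace_def chains_def by (auto simp: csc_apply)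

lemma chains_add: "subspace W \<Longrightarrow> c \<in> chains p W \<Longrightarrow> d \<in> chains p W \<Longrightarrow> c + d \<in> chains p W"
  using ch.subspace_add[OF subspace_chains] .

lemma chains_diff: "subspace W \<Longrightarrow> c \<in> chains p W \<Longrightarrow> d \<in> chains p W \<Longrightarrow> c - d \<in> chains p W"
  using ch.subspace_diff[OF subspace_chains] .

lemma chains_zero: "subspace W \<Longrightarrow> 0 \<in> chains p W"
  using ch.subspace_0[OF subspace_chains] .

lemma chains_uminus: "subspace W \<Longrightarrow> c \<in> chains p W \<Longrightarrow> - c \<in> chains p W"
  using ch.subspace_neg[OF subspace_chains] .

lemma chains_sum: "subspace W \<Longrightarrow> (\<And>i. i \<in> I \<Longrightarrow> c i \<in> chains p W) \<Longrightarrow> sum c I \<in> chains p W"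
  using ch.subspace_sum[OF subspace_chains] .

lemma bd_chains:
  assumes "c \<in> chains p W" "\<And>v x. x \<in> W \<Longrightarrow> X v x \<in> W'" "subspace W'"
  shows "bd c \<in> chains (p - 1) W'"
proof (rule chainsI)
  fix S :: "'v set" assume "int (card S) = p - 1"
  then have "int (card (insert v S)) = p" if "v \<in> - S" for v using that by simp
  then have "X v (c (insert v S)) \<in> W'" if "v \<in> - S" for v
    using that chains_on[OF assms(1)] assms(2) by blast
  then show "bd c S \<in> W'" unfolding bd_def using assms(3) by (intro subspace_sum subspace_scale) auto
next
  fix S :: "'v set" assume "int (card S) \<noteq> p - 1"
  then have "int (card (insert v S)) \<noteq> p" if "v \<in> - S" for v using that by simp
  then have "c (insert v S) = 0" if "v \<in> - S" for v using that chains_off[OF assms(1)] by blast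
  then show "bd c S = 0" unfolding bd_def by (intro sum.neutral) auto
qed

lemma wedge_chains:
  assumes "c \<in> chains p W" "subspace W"
  shows "wedge u c \<in> chains (p + 1) W"
proof (rule chainsI)
  fix S :: "'v set" assume *: "int (card S) = p + 1"
  have "int (card (S - {u})) = p" if "u \<in> S"
  proof -
    have "card S = Suc (card (S - {u}))" using card.remove[OF _ that] by simp
    then show ?thesis using * by simp
  qed
  then show "wedge u c S \<in> W"
    using chains_on[OF assms(1)] assms(2) by (auto simp: wedge_def subspace_scale subspace_0)
next
  fix S :: "'v set" assume *: "int (card S) \<noteq> p + 1"
  have "int (card (S - {u})) \<noteq> p" if "u \<in> S"
  proof -
    have "card S = Suc (card (S - {u}))" using card.remove[OF _ that] by simp
    then show ?thesis using * by simp
  qed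
  then show "wedge u c S = 0"
    using chains_off[OF assms(1)] by (auto simp: wedge_def)
qed

lemma chains_sum_decomp:
  assumes "c \<in> chains p {a + f b |a b. a \<in> A \<and> b \<in> B}" "f 0 = 0"
  obtains a b where "a \<in> chains p A" "b \<in> chains p B" "c = a + (f \<circ> b)"
proof -
  have "\<forall>S. \<exists>x y. int (card S) = p \<longrightarrow> x \<in> A \<and> y \<in> B \<and> c S = x + f y"
    using chains_on[OF assms(1)] by blast
  then obtain a b where ab: "\<And>S. int (card S) = p \<Longrightarrow> a S \<in> A \<and> b S \<in> B \<and> c S = a S + f (b S)" by metis
  let ?a = "\<lambda>S. if int (card S) = p then a S else 0" and ?b = "\<lambda>S. if int (card S) = p then b S else 0"
  show thesis
  proof (rule that)
    show "?a \<in> chains p A" "?b \<in> chains p B" using ab by (auto intro!: chainsI)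
    show "c = ?a + (f \<circ> ?b)" using ab chains_off[OF assms(1)] assms(2) by (auto simp: fun_eq_iff)
  qed
qed

text \<open>Allowing an arbitrary set \<open>A\<close> of index sets makes the dimension of
  \<open>chains\<close> accessible to induction on \<open>A\<close>, which splits off one copy of
  \<open>W\<close> at a time.\<close>

definition families :: "'v set set \<Rightarrow> 'a set \<Rightarrow> ('v set \<Rightarrow> 'a) set" where
  "families A W = {c. \<forall>S. c S \<in> (if S \<in> A then W else {0})}"

lemma chains_families: "chains p W = families {S. int (card S) = p} W"
  by (auto simp: chains_def families_def)

lemma subspace_families: "subspace W \<Longrightarrow> ch.subspace (families A W)"
  unfolding ch.subspace_def subspace_def families_def by (auto simp: csc_apply)

lemma families_dim:
  assumes W: "subspace W" "fin_dim W" and "finite A"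
  shows "ch.fin_dim (families A W) \<and> ch.dim (families A W) = card A * dim W"
  using assms(3)
proof induction
  case empty
  have "families {} W = {0}" by (auto simp: families_def)
  then show ?case by (simp add: ch.fin_dim_zero ch.dim_zero_subspace)
next
  case (insert S A)
  let ?i = "\<lambda>x T. if T = S then x else (0::'a)"
  have lin: "vc.lin ?i"
    by (rule Vector_Spaces.linear_iff[THEN iffD2])
      (auto simp: vector_space_axioms ch.vector_space_axioms fun_eq_iff csc_apply)
  have inj: "{x \<in> W. ?i x = 0} = {0}" using W(1) by (auto simp: fun_eq_iff subspace_0)
  have I: "ch.subspace (?i ` W)" "ch.fin_dim (?i ` W)"
    using vc.subspace_image[OF lin W(1)] vc.fin_dim_image[OF lin W(2)] by auto
  have d: "ch.dim (?i ` W) = dim W" using vc.rank_nullity[OF lin W] inj dim_zero_subspace by simp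
  have eq: "families (insert S A) W = {u + w |u w. u \<in> families A W \<and> w \<in> ?i ` W}"
  proof (intro subset_antisym subsetI)
    fix c assume c: "c \<in> families (insert S A) W"
    have "c = (\<lambda>T. if T = S then 0 else c T) + ?i (c S)" by (auto simp: fun_eq_iff)
    moreover have "(\<lambda>T. if T = S then 0 else c T) \<in> families A W"
      using c subspace_0[OF W(1)] by (auto simp: families_def split: if_splits)
    moreover have "c S \<in> W" using c unfolding families_def by (auto dest: spec[of _ S])
    ultimately show "c \<in> {u + w |u w. u \<in> families A W \<and> w \<in> ?i ` W}" by blast
  next
    fix c assume "c \<in> {u + w |u w. u \<in> families A W \<and> w \<in> ?i ` W}"
    then obtain u x where u: "u \<in> families A W" "x \<in> W" "c = u + ?i x" by blast
    have "u S = 0" using u(1) insert.hyps by (auto simp: families_def dest: spec[of _ S])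
    then show "c \<in> families (insert S A) W"
      using u by (auto simp: families_def split: if_splits)
  qed
  have "families A W \<inter> ?i ` W = {0}"
  proof -
    have "c = 0" if c: "c \<in> families A W" "c = ?i x" for c x
    proof -
      have "c S = 0" using c(1) insert.hyps by (auto simp: families_def dest: spec[of _ S])
      then show ?thesis using c(2) by (auto simp: fun_eq_iff)
    qed
    then show ?thesis
      using ch.subspace_0[OF subspace_families[OF W(1), of A]] ch.subspace_0[OF I(1)] by blast
  qed
  then show ?case
    using ch.dim_sum_Int[OF subspace_families[OF W(1)] conjunct1[OF insert.IH] I]
      ch.fin_dim_sum[OF conjunct1[OF insert.IH] I(2)] d insert
    by (simp add: ch.dim_zero_subspace flip: eq)
qed

lemma fin_dim_chains: "subspace W \<Longrightarrow> fin_dim W \<Longrightarrow> ch.fin_dim (chains p W)"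
  using families_dim by (simp add: chains_families)

lemma dim_chains: "subspace W \<Longrightarrow> fin_dim W \<Longrightarrow> ch.dim (chains p W) = card {S :: 'v set. int (card S) = p} * dim W"
  using families_dim by (simp add: chains_families)

end

section \<open>Koszul homology and nonzerodivisors\<close>

lemma sum_fun_apply: "(sum f A) x = (\<Sum>i\<in>A. f i x)"
  by (induction A rule: infinite_finite_induct) auto

context poly_space
begin

definition graded :: "(int \<Rightarrow> 'a set) \<Rightarrow> bool" where
  "graded Z \<longleftrightarrow> (\<forall>m. subspace (Z m) \<and> fin_dim (Z m) \<and> (\<forall>v. \<forall>x\<in>Z m. X v x \<in> Z (m + 1)))"

lemma gradedD:
  assumes "graded Z"
  shows "subspace (Z m)" "fin_dim (Z m)" "x \<in> Z m \<Longrightarrow> X v x \<in> Z (m + 1)" "0 \<in> Z m"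
  using assms subspace_0 unfolding graded_def by auto

lemma bd_graded:
  assumes "graded Z" "c \<in> chains p (Z m)"
  shows "bd c \<in> chains (p - 1) (Z (m + 1))"
  using bd_chains[OF assms(2)] gradedD[OF assms(1)] by blast

lemma bd_graded':
  assumes "graded Z" "c \<in> chains (p + 1) (Z (m - 1))"
  shows "bd c \<in> chains p (Z m)"
  using bd_graded[OF assms] by simp

text \<open>Cycles of Z/B are represented by their full preimage in the chains of \<open>Z\<close>,
  and \<open>bnd\<close> likewise contains all chains of \<open>B\<close>. The homology of Z/B is
  then the quotient of these two spaces.\<close>

definition cyc :: "(int \<Rightarrow> 'a set) \<Rightarrow> (int \<Rightarrow> 'a set) \<Rightarrow> int \<Rightarrow> int \<Rightarrow> ('v set \<Rightarrow> 'a) set" where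
  "cyc Z B p m = {c \<in> chains p (Z m). bd c \<in> chains (p - 1) (B (m + 1))}"

definition bnd :: "(int \<Rightarrow> 'a set) \<Rightarrow> (int \<Rightarrow> 'a set) \<Rightarrow> int \<Rightarrow> int \<Rightarrow> ('v set \<Rightarrow> 'a) set" where
  "bnd Z B p m = {bd a + b |a b. a \<in> chains (p + 1) (Z (m - 1)) \<and> b \<in> chains p (B m)}"

text \<open>The dimension of \<open>H\<^sub>p\<close> of the Koszul complex of \<open>Z/B\<close>, where \<open>m\<close> is the degree in \<open>Z/B\<close> of the
  coefficients, so that the total degree is \<open>m + p\<close>.\<close>

definition kh :: "(int \<Rightarrow> 'a set) \<Rightarrow> (int \<Rightarrow> 'a set) \<Rightarrow> int \<Rightarrow> int \<Rightarrow> int" where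
  "kh Z B p m = int (ch.dim (cyc Z B p m)) - int (ch.dim (bnd Z B p m))"

lemma bndI: "a \<in> chains (p + 1) (Z (m - 1)) \<Longrightarrow> b \<in> chains p (B m) \<Longrightarrow> bd a + b \<in> bnd Z B p m"
  unfolding bnd_def by blast

lemma subspace_cyc:
  assumes "graded Z" "graded B"
  shows "ch.subspace (cyc Z B p m)" "ch.fin_dim (cyc Z B p m)"
proof -
  show "ch.subspace (cyc Z B p m)"
    using subspace_chains[OF gradedD(1)[OF assms(1)], of p m] subspace_chains[OF gradedD(1)[OF assms(2)], of "p - 1" "m + 1"]
    by (auto simp: ch.subspace_def cyc_def bd_add bd_scale)
  have "cyc Z B p m \<subseteq> chains p (Z m)" by (auto simp: cyc_def)
  then show "ch.fin_dim (cyc Z B p m)"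
    using ch.fin_dim_subset fin_dim_chains gradedD[OF assms(1)] by blast
qed

lemma subspace_bnd:
  assumes "graded Z" "graded B"
  shows "ch.subspace (bnd Z B p m)" "ch.fin_dim (bnd Z B p m)"
proof -
  have eq: "bnd Z B p m = {x + y |x y. x \<in> bd ` chains (p + 1) (Z (m - 1)) \<and> y \<in> chains p (B m)}"
    by (auto simp: bnd_def)
  show "ch.subspace (bnd Z B p m)" unfolding eq
    using ch.subspace_sums cc.subspace_image[OF linear_bd] subspace_chains gradedD assms by simp
  show "ch.fin_dim (bnd Z B p m)" unfolding eq
    using ch.fin_dim_sum cc.fin_dim_image[OF linear_bd] fin_dim_chains gradedD assms by simp
qed

lemma bnd_boundary: "graded B \<Longrightarrow> a \<in> chains (p + 1) (Z (m - 1)) \<Longrightarrow> bd a \<in> bnd Z B p m"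
  using bndI[of a p Z m 0 B] chains_zero gradedD(1) by fastforce

lemma bnd_base: "graded Z \<Longrightarrow> b \<in> chains p (B m) \<Longrightarrow> b \<in> bnd Z B p m"
  using bndI[of 0 p Z m b B] chains_zero gradedD(1) by fastforce

lemma bnd_cyc:
  assumes "graded Z" "graded B" "\<And>m. B m \<subseteq> Z m"
  shows "bnd Z B p m \<subseteq> cyc Z B p m"
proof
  fix c assume "c \<in> bnd Z B p m"
  then obtain a b where ab: "c = bd a + b" "a \<in> chains (p + 1) (Z (m - 1))" "b \<in> chains p (B m)"
    unfolding bnd_def by blast
  have "c \<in> chains p (Z m)"
    using ab bd_graded'[OF assms(1) ab(2)] chains_mono[OF ab(3) assms(3)]
    by (simp add: chains_add gradedD(1)[OF assms(1)])
  moreover have "bd c \<in> chains (p - 1) (B (m + 1))"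
    using ab bd_graded[OF assms(2) ab(3)] by (simp add: bd_add)
  ultimately show "c \<in> cyc Z B p m" by (simp add: cyc_def)
qed

lemma bd_comp:
  assumes "vv.lin f" "\<And>v x. f (X v x) = X v (f x)"
  shows "bd (f \<circ> c) = f \<circ> bd c"
  by (rule ext) (simp add: bd_def vv.linear_sum[OF assms(1)] vv.linear_scale[OF assms(1)] assms(2))

lemma comp_add: "vv.lin f \<Longrightarrow> f \<circ> (c + d) = (f \<circ> c) + (f \<circ> d)"
  by (rule ext) (simp add: vv.linear_add)

lemma comp_diff: "vv.lin f \<Longrightarrow> f \<circ> (c - d) = (f \<circ> c) - (f \<circ> d)"
  by (rule ext) (simp add: vv.linear_diff)

lemma linear_comp: "vv.lin f \<Longrightarrow> cc.lin (\<lambda>c. f \<circ> c)"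
  by (rule Vector_Spaces.linear_iff[THEN iffD2])
    (auto simp: ch.vector_space_axioms fun_eq_iff csc_apply vv.linear_add vv.linear_scale)

end

text \<open>Multiplication by an element \<open>f = \<Sum>\<^sub>v x\<^sub>v g\<^sub>v\<close> of degree \<open>e\<close> of the irrelevant ideal, which is a
  nonzerodivisor on \<open>Z/B\<close>.\<close>

locale regular_multiplication = poly_space sc X
  for sc :: "'k::field \<Rightarrow> 'a::ab_group_add \<Rightarrow> 'a" and X :: "'v::finite \<Rightarrow> 'a \<Rightarrow> 'a" +
  fixes Z B :: "int \<Rightarrow> 'a set" and f :: "'a \<Rightarrow> 'a" and g :: "'v \<Rightarrow> 'a \<Rightarrow> 'a" and e :: int
  assumes graded: "graded Z" "graded B" and sub: "B m \<subseteq> Z m"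
    and f_linear: "vv.lin f" and f_X: "f (X v x) = X v (f x)"
    and f_Z: "x \<in> Z m \<Longrightarrow> f x \<in> Z (m + e)" and f_B: "x \<in> B m \<Longrightarrow> f x \<in> B (m + e)"
    and regular: "x \<in> Z m \<Longrightarrow> f x \<in> B (m + e) \<Longrightarrow> x \<in> B m"
    and g_linear: "vv.lin (g v)" and g_X: "g v (X u x) = X u (g v x)"
    and g_Z: "x \<in> Z m \<Longrightarrow> g v x \<in> Z (m + e - 1)" and g_B: "x \<in> B m \<Longrightarrow> g v x \<in> B (m + e - 1)"
    and f_eq: "f x = (\<Sum>v\<in>UNIV. X v (g v x))"
begin

text \<open>With M = Z/B, these are the relations of M/fM.\<close>

definition B' :: "int \<Rightarrow> 'a set" where
  "B' m = {b + f z |b z. b \<in> B m \<and> z \<in> Z (m - e)}"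

lemma f0: "f 0 = 0"
  using vv.linear_0[OF f_linear] .

lemma graded_B': "graded B'"
  unfolding graded_def
proof (intro allI conjI ballI)
  fix m
  have eq: "B' m = {x + y |x y. x \<in> B m \<and> y \<in> f ` Z (m - e)}" by (auto simp: B'_def)
  show "subspace (B' m)" unfolding eq
    using subspace_sums vv.subspace_image[OF f_linear] gradedD graded by simp
  show "fin_dim (B' m)" unfolding eq
    using fin_dim_sum vv.fin_dim_image[OF f_linear] gradedD graded by simp
  fix v x assume "x \<in> B' m"
  then obtain b z where "b \<in> B m" "z \<in> Z (m - e)" "x = b + f z" unfolding B'_def by blast
  moreover have "X v z \<in> Z (m + 1 - e)"
    using gradedD(3)[OF graded(1) \<open>z \<in> Z (m - e)\<close>] by (simp add: algebra_simps)
  ultimately show "X v x \<in> B' (m + 1)"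
    using gradedD(3)[OF graded(2)] f_X unfolding B'_def by (metis (mono_tags, lifting) X_add mem_Collect_eq)
qed

lemmas sZ = gradedD(1)[OF graded(1)] and sB = gradedD(1)[OF graded(2)] and sB' = gradedD(1)[OF graded_B']

lemma B_B': "B m \<subseteq> B' m"
proof
  fix b assume "b \<in> B m"
  then show "b \<in> B' m"
    using f0 gradedD(4)[OF graded(1)] unfolding B'_def by (intro CollectI exI[of _ b] exI[of _ 0]) simp
qed

lemma f_Z_B': "z \<in> Z (m - e) \<Longrightarrow> f z \<in> B' m"
  using gradedD(4)[OF graded(2)] unfolding B'_def by (intro CollectI exI[of _ 0] exI[of _ z]) simp

lemma chains_B_B': "c \<in> chains p (B m) \<Longrightarrow> c \<in> chains p (B' m)"
  using chains_mono B_B' by blast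

lemma comp_chains_Z: "c \<in> chains p (Z (m - e)) \<Longrightarrow> f \<circ> c \<in> chains p (Z m)"
  by (erule chains_map) (use f_Z f0 in force)+

lemma comp_chains_B: "c \<in> chains p (B (m - e)) \<Longrightarrow> f \<circ> c \<in> chains p (B m)"
  by (erule chains_map) (use f_B f0 in force)+

lemma comp_chains_B': "c \<in> chains p (Z (m - e)) \<Longrightarrow> f \<circ> c \<in> chains p (B' m)"
  by (erule chains_map) (use f_Z_B' f0 in auto)

lemma comp_chains_regular: "c \<in> chains p (Z (m - e)) \<Longrightarrow> f \<circ> c \<in> chains p (B m) \<Longrightarrow> c \<in> chains p (B (m - e))"
  by (erule chains_comap, assumption) (use regular in force)

lemma B'_sub: "B' m \<subseteq> Z m"
proof
  fix x assume "x \<in> B' m"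
  then obtain b z where "x = b + f z" "b \<in> B m" "z \<in> Z (m - e)" unfolding B'_def by blast
  then show "x \<in> Z m" using subspace_add[OF sZ, of b m "f z"] sub f_Z[of z "m - e"] by auto
qed

lemma chains_B'_decomp:
  assumes "c \<in> chains p (B' m)"
  obtains b z where "b \<in> chains p (B m)" "z \<in> chains p (Z (m - e))" "c = b + (f \<circ> z)"
  using chains_sum_decomp[where f = f, OF assms[unfolded B'_def] f0] by blast

text \<open>Since \<open>f\<close> is the sum of the x_v g_v, summing \<open>bd_wedge\<close> over
  the variables exhibits multiplication by \<open>f\<close> as null-homotopic; so \<open>f\<close>
  times a cycle is a boundary modulo \<open>B\<close>.\<close>

lemma homotopy:
  assumes "z \<in> cyc Z B q (m - e)"
  obtains a b where "a \<in> chains (q + 1) (Z (m - 1))" "b \<in> chains q (B m)" "f \<circ> z = bd a + b"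
proof -
  let ?a = "\<Sum>v\<in>UNIV. wedge v (g v \<circ> z)" and ?b = "\<Sum>v\<in>UNIV. wedge v (g v \<circ> bd z)"
  have z: "z \<in> chains q (Z (m - e))" "bd z \<in> chains (q - 1) (B (m - e + 1))"
    using assms unfolding cyc_def by auto
  have g0: "g v 0 = 0" for v using vv.linear_0[OF g_linear] .
  have "?a \<in> chains (q + 1) (Z (m - 1))"
  proof (intro chains_sum wedge_chains sZ)
    fix v
    show "g v \<circ> z \<in> chains q (Z (m - 1))"
      using z(1) by (rule chains_map) (use g_Z[of _ "m - e"] g0 in auto)
  qed
  moreover have "wedge v (g v \<circ> bd z) \<in> chains (q - 1 + 1) (B m)" for v
  proof (intro wedge_chains sB)
    show "g v \<circ> bd z \<in> chains (q - 1) (B m)"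
      using z(2) by (rule chains_map) (use g_B[of _ "m - e + 1"] g0 in auto)
  qed
  then have "?b \<in> chains q (B m)" by (intro chains_sum sB) simp
  moreover have "f \<circ> z = bd ?a + ?b"
  proof -
    have "f \<circ> z = (\<Sum>v\<in>UNIV. X v \<circ> (g v \<circ> z))"
      by (rule ext) (simp add: f_eq sum_fun_apply)
    also have "\<dots> = (\<Sum>v\<in>UNIV. bd (wedge v (g v \<circ> z)) + wedge v (g v \<circ> bd z))"
      by (simp only: bd_wedge[symmetric] bd_comp[OF g_linear g_X])
    finally show ?thesis by (simp only: sum.distrib bd_sum)
  qed
  ultimately show thesis by (rule that)
qed

lemma bd_f: "bd (f \<circ> c) = f \<circ> bd c"
  using bd_comp[OF f_linear f_X] .

text \<open>Injectivity of H_p(M) -> H_p(M/fM). If c = bd a + b + f z, then f (bd z) has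
  coefficients in \<open>B\<close>, regularity makes \<open>z\<close> a cycle of M, and
  \<open>homotopy\<close> turns f z into a boundary of M.\<close>

lemma cyc_bnd_B':
  assumes c: "c \<in> cyc Z B p m"
  shows "c \<in> bnd Z B' p m \<longleftrightarrow> c \<in> bnd Z B p m"
proof
  assume "c \<in> bnd Z B p m"
  then show "c \<in> bnd Z B' p m" using chains_B_B' unfolding bnd_def by blast
next
  assume "c \<in> bnd Z B' p m"
  then obtain a b'' where a: "a \<in> chains (p + 1) (Z (m - 1))" "b'' \<in> chains p (B' m)" "c = bd a + b''"
    unfolding bnd_def by blast
  obtain b z where b: "b \<in> chains p (B m)" "z \<in> chains p (Z (m - e))" "b'' = b + (f \<circ> z)"
    using chains_B'_decomp[OF a(2)] by blast
  have "bd c = bd b + (f \<circ> bd z)" using a b by (simp add: bd_add bd_f)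
  then have "f \<circ> bd z = bd c - bd b" by simp
  moreover have "bd c - bd b \<in> chains (p - 1) (B (m + 1))"
    using c bd_graded[OF graded(2) b(1)] by (intro chains_diff sB) (auto simp: cyc_def)
  moreover have bz: "bd z \<in> chains (p - 1) (Z (m + 1 - e))"
    using bd_graded[OF graded(1) b(2)] by (simp add: algebra_simps)
  ultimately have "bd z \<in> chains (p - 1) (B (m + 1 - e))" using comp_chains_regular by simp
  then have "z \<in> cyc Z B p (m - e)" using b(2) by (simp add: cyc_def algebra_simps)
  then obtain a' b' where a': "a' \<in> chains (p + 1) (Z (m - 1))" "b' \<in> chains p (B m)" "f \<circ> z = bd a' + b'"
    using homotopy by blast
  have "c = bd (a + a') + (b + b')" using a b a' by (simp add: bd_add algebra_simps)
  then show "c \<in> bnd Z B p m"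
    using bndI[of "a + a'" p Z m "b + b'" B] chains_add[OF sZ a(1) a'(1)] chains_add[OF sB b(1) a'(2)] by simp
qed

text \<open>The long exact sequence of \<open>0 \<rightarrow> M(-e) \<rightarrow> M \<rightarrow> M/fM \<rightarrow> 0\<close> splits into short ones, because \<open>f\<close>
  annihilates Koszul homology.\<close>

lemma kh_quotient: "kh Z B' p m = kh Z B p m + kh Z B (p - 1) (m + 1 - e)"
proof -
  \<comment> \<open>\<open>C\<close> collects the cycles of M/fM that come from cycles of M, up to
    boundaries, and \<open>W'\<close> is f times the boundaries of M(-e) plus the chains of
    \<open>B\<close>. The three numbered facts identify H_p(M) with \<open>C\<close> modulo the
    boundaries of M/fM, the cycles of M/fM modulo \<open>C\<close> with W/W' through
    \<open>bd\<close>, and H_(p-1)(M(-e)) with W/W' through \<open>f\<close>.\<close>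
  define C where "C = {c + b |c b. c \<in> cyc Z B p m \<and> b \<in> bnd Z B' p m}"
  define W' where "W' = {f' + b |f' b. f' \<in> (\<lambda>c. f \<circ> c) ` bnd Z B (p - 1) (m + 1 - e) \<and> b \<in> chains (p - 1) (B (m + 1))}"
  note lf = linear_comp[OF f_linear]
  have W': "ch.subspace W'" "ch.fin_dim W'"
    unfolding W'_def
    using ch.subspace_sums[OF cc.subspace_image[OF lf subspace_bnd(1)[OF graded]] subspace_chains[OF sB]]
      ch.fin_dim_sum[OF cc.fin_dim_image[OF lf subspace_bnd(2)[OF graded]] fin_dim_chains[OF sB gradedD(2)[OF graded(2)]]]
    by blast+
  have W'I: "(f \<circ> x) + b \<in> W'" if "x \<in> bnd Z B (p - 1) (m + 1 - e)" "b \<in> chains (p - 1) (B (m + 1))" for x b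
    using that unfolding W'_def by (intro CollectI exI[of _ "f \<circ> x"] exI[of _ b]) blast
  have W'_base: "b \<in> W'" if "b \<in> chains (p - 1) (B (m + 1))" for b
  proof -
    have "f \<circ> (0 :: 'v set \<Rightarrow> 'a) = 0" using f0 by (simp add: fun_eq_iff)
    then show ?thesis using W'I[OF ch.subspace_0[OF subspace_bnd(1)[OF graded]] that] by (simp only: add_0_left)
  qed
  have W'_f: "f \<circ> x \<in> W'" if "x \<in> bnd Z B (p - 1) (m + 1 - e)" for x
    using W'I[OF that chains_zero[OF sB]] by (simp only: add_0_right)
  have sC: "ch.subspace C" "C \<subseteq> cyc Z B' p m"
  proof -
    show "ch.subspace C" unfolding C_def
      using ch.subspace_sums subspace_cyc(1)[OF graded] subspace_bnd(1)[OF graded(1) graded_B'] by blast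
    have "cyc Z B p m \<subseteq> cyc Z B' p m" using chains_B_B' unfolding cyc_def by blast
    moreover note bnd_cyc[OF graded(1) graded_B' B'_sub]
    ultimately show "C \<subseteq> cyc Z B' p m"
      using ch.subspace_add[OF subspace_cyc(1)[OF graded(1) graded_B']] unfolding C_def by blast
  qed
  have 1: "kh Z B p m = int (ch.dim C) - int (ch.dim (bnd Z B' p m))"
    unfolding kh_def
  proof (rule cc.dim_diff_eq_dim_diff[OF ch.linear_id])
    show "C = {id u + w |u w. u \<in> cyc Z B p m \<and> w \<in> bnd Z B' p m}" by (simp add: C_def)
    show "id u \<in> bnd Z B' p m \<longleftrightarrow> u \<in> bnd Z B p m" if "u \<in> cyc Z B p m" for u
      using cyc_bnd_B'[OF that] by simp
    show "bnd Z B p m \<subseteq> cyc Z B p m" using bnd_cyc graded sub by blast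
  qed (use subspace_cyc subspace_bnd graded graded_B' in blast)+
  define W where "W = {bd u + w |u w. u \<in> cyc Z B' p m \<and> w \<in> W'}"
  have 2: "int (ch.dim (cyc Z B' p m)) - int (ch.dim C) = int (ch.dim W) - int (ch.dim W')"
  proof (rule cc.dim_diff_eq_dim_diff[OF linear_bd _ _ sC W'])
    show "W = {bd u + w |u w. u \<in> cyc Z B' p m \<and> w \<in> W'}" by (fact W_def)
    fix u assume u: "u \<in> cyc Z B' p m"
    show "bd u \<in> W' \<longleftrightarrow> u \<in> C"
    proof
      assume "bd u \<in> W'"
      then obtain x b where x: "x \<in> bnd Z B (p - 1) (m + 1 - e)" "b \<in> chains (p - 1) (B (m + 1))" "bd u = (f \<circ> x) + b"
        unfolding W'_def by blast
      from x(1) obtain a b1 where a: "a \<in> chains p (Z (m - e))" "b1 \<in> chains (p - 1) (B (m + 1 - e))" "x = bd a + b1"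
        unfolding bnd_def by (auto simp: algebra_simps)
      have fa: "f \<circ> a \<in> chains p (Z m)" using comp_chains_Z[OF a(1)] .
      have "bd (u - (f \<circ> a)) = (f \<circ> b1) + b"
        using x a by (simp add: bd_diff bd_f comp_add[OF f_linear])
      moreover have "\<dots> \<in> chains (p - 1) (B (m + 1))" using comp_chains_B[OF a(2)] x(2) by (rule chains_add[OF sB])
      ultimately have "u - (f \<circ> a) \<in> cyc Z B p m"
        using u fa chains_diff[OF sZ] by (auto simp: cyc_def)
      moreover have "f \<circ> a \<in> bnd Z B' p m" using bnd_base[OF graded(1), of "f \<circ> a" p B' m] comp_chains_B'[OF a(1)] by simp
      ultimately show "u \<in> C" unfolding C_def by (intro CollectI exI[of _ "u - (f \<circ> a)"] exI[of _ "f \<circ> a"]) auto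
    next
      assume "u \<in> C"
      then obtain c b'' where c: "u = c + b''" "c \<in> cyc Z B p m" "b'' \<in> bnd Z B' p m" unfolding C_def by blast
      from c(3) obtain a b' where a: "b'' = bd a + b'" "b' \<in> chains p (B' m)" unfolding bnd_def by blast
      obtain b z where b: "b \<in> chains p (B m)" "z \<in> chains p (Z (m - e))" "b' = b + (f \<circ> z)"
        using chains_B'_decomp[OF a(2)] by blast
      have "bd z \<in> bnd Z B (p - 1) (m + 1 - e)"
        using bnd_boundary[OF graded(2), of z "p - 1" Z "m + 1 - e"] b(2) by (simp add: algebra_simps)
      then have "f \<circ> bd z \<in> W'" by (rule W'_f)
      moreover have "bd c + bd b \<in> W'"
        using c(2) bd_graded[OF graded(2) b(1)] by (intro W'_base chains_add sB) (auto simp: cyc_def)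
      moreover have "bd u = (bd c + bd b) + (f \<circ> bd z)" using c a b by (simp add: bd_add bd_f)
      ultimately show "bd u \<in> W'" using ch.subspace_add[OF W'(1)] by simp
    qed
  qed (use subspace_cyc graded graded_B' in blast)+
  have 3: "kh Z B (p - 1) (m + 1 - e) = int (ch.dim W) - int (ch.dim W')"
    unfolding kh_def
  proof (rule cc.dim_diff_eq_dim_diff[OF lf _ _ _ _ W'])
    show "bnd Z B (p - 1) (m + 1 - e) \<subseteq> cyc Z B (p - 1) (m + 1 - e)" using bnd_cyc graded sub by blast
    show "W = {(f \<circ> u) + w |u w. u \<in> cyc Z B (p - 1) (m + 1 - e) \<and> w \<in> W'}"
    proof (intro subset_antisym subsetI)
      fix x assume "x \<in> W"
      then obtain u w where u: "x = bd u + w" "u \<in> cyc Z B' p m" "w \<in> W'" unfolding W_def by blast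
      obtain b z where b: "b \<in> chains (p - 1) (B (m + 1))" "z \<in> chains (p - 1) (Z (m + 1 - e))" "bd u = b + (f \<circ> z)"
        using u(2) by (auto simp: cyc_def elim: chains_B'_decomp)
      have "bd (bd u) = bd b + (f \<circ> bd z)" using b(3) by (simp only: bd_add bd_f)
      then have "f \<circ> bd z = - bd b" by (simp add: eq_neg_iff_add_eq_0 add.commute)
      moreover have "- bd b \<in> chains (p - 1 - 1) (B (m + 1 + 1))"
        using bd_graded[OF graded(2) b(1)] chains_uminus[OF sB] by blast
      moreover have "bd z \<in> chains (p - 1 - 1) (Z (m + 1 + 1 - e))"
        using bd_graded[OF graded(1) b(2)] by (simp add: algebra_simps)
      ultimately have "bd z \<in> chains (p - 1 - 1) (B (m + 1 + 1 - e))" using comp_chains_regular by simp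
      then have "z \<in> cyc Z B (p - 1) (m + 1 - e)" using b(2) by (simp add: cyc_def algebra_simps)
      moreover have "b + w \<in> W'" using ch.subspace_add[OF W'(1) W'_base[OF b(1)] u(3)] .
      moreover have "x = (f \<circ> z) + (b + w)" using u b by (simp add: algebra_simps)
      ultimately show "x \<in> {(f \<circ> u) + w |u w. u \<in> cyc Z B (p - 1) (m + 1 - e) \<and> w \<in> W'}" by blast
    next
      fix x assume "x \<in> {(f \<circ> u) + w |u w. u \<in> cyc Z B (p - 1) (m + 1 - e) \<and> w \<in> W'}"
      then obtain z w where z: "z \<in> cyc Z B (p - 1) (m + 1 - e)" "w \<in> W'" "x = (f \<circ> z) + w" by blast
      \<comment> \<open>Surjectivity of the connecting map: f annihilates homology, so there is a
        chain \<open>a\<close> whose boundary is f z modulo \<open>B\<close>, and it is a cycle of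
        M/fM that is sent to the class of \<open>z\<close>.\<close>
      obtain a b where a: "a \<in> chains p (Z m)" "b \<in> chains (p - 1) (B (m + 1))" "f \<circ> z = bd a + b"
        using homotopy[OF z(1)] by auto
      have "bd a = (f \<circ> z) - b" using a by simp
      moreover have "\<dots> \<in> chains (p - 1) (B' (m + 1))"
        using z(1) a(2) by (intro chains_diff sB' comp_chains_B' chains_B_B') (auto simp: cyc_def)
      ultimately have "a \<in> cyc Z B' p m" using a(1) by (simp add: cyc_def)
      moreover have "b + w \<in> W'" using ch.subspace_add[OF W'(1) W'_base[OF a(2)] z(2)] .
      moreover have "x = bd a + (b + w)" using z a by (simp add: algebra_simps)
      ultimately show "x \<in> W" unfolding W_def by blast
    qed
    fix z assume z: "z \<in> cyc Z B (p - 1) (m + 1 - e)"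
    show "(f \<circ> z) \<in> W' \<longleftrightarrow> z \<in> bnd Z B (p - 1) (m + 1 - e)"
    proof
      assume "f \<circ> z \<in> W'"
      then obtain x b where x: "x \<in> bnd Z B (p - 1) (m + 1 - e)" "b \<in> chains (p - 1) (B (m + 1))" "f \<circ> z = (f \<circ> x) + b"
        unfolding W'_def by blast
      have "x \<in> chains (p - 1) (Z (m + 1 - e))"
        using bnd_cyc[OF graded sub] x(1) by (auto simp: cyc_def)
      then have "z - x \<in> chains (p - 1) (Z (m + 1 - e))"
        using z chains_diff[OF sZ] by (auto simp: cyc_def)
      moreover have "f \<circ> (z - x) = b" using x(3) by (simp add: comp_diff[OF f_linear])
      ultimately have "z - x \<in> chains (p - 1) (B (m + 1 - e))" using comp_chains_regular x(2) by simp
      then have "z - x \<in> bnd Z B (p - 1) (m + 1 - e)" using bnd_base[OF graded(1), of "z - x" "p - 1" B "m + 1 - e"] by simp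
      then have "(z - x) + x \<in> bnd Z B (p - 1) (m + 1 - e)"
        using x(1) ch.subspace_add[OF subspace_bnd(1)[OF graded]] by blast
      then show "z \<in> bnd Z B (p - 1) (m + 1 - e)" by simp
    qed (rule W'_f)
  qed (use subspace_cyc subspace_bnd graded in blast)+
  show ?thesis using 1 2 3 unfolding kh_def by linarith
qed

end

section \<open>Syzygies\<close>

context poly_space
begin

lemma cycD: "c \<in> cyc Z B p m \<Longrightarrow> c \<in> chains p (Z m)" "c \<in> cyc Z B p m \<Longrightarrow> bd c \<in> chains (p - 1) (B (m + 1))"
  by (simp_all add: cyc_def)

lemma cycI: "c \<in> chains p (Z m) \<Longrightarrow> bd c \<in> chains (p - 1) (B (m + 1)) \<Longrightarrow> c \<in> cyc Z B p m"
  by (simp add: cyc_def)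

lemma bndE:
  assumes "c \<in> bnd Z B p m"
  obtains a b where "a \<in> chains (p + 1) (Z (m - 1))" "b \<in> chains p (B m)" "c = bd a + b"
  using assms unfolding bnd_def by blast

lemma chains_zero_iff: "c \<in> chains p {0} \<longleftrightarrow> c = 0"
  by (auto simp: chains_def fun_eq_iff)

lemma graded_zero: "graded (\<lambda>_. {0})"
  by (simp add: graded_def fin_dim_zero subspace_single_0)

lemma bd_empty: "bd c {} = (\<Sum>v\<in>UNIV. X v (c {v}))"
  by (simp add: bd_def koszul_sign_def)

text \<open>The subspace x_1 W + ... + x_n W, written x W below: for W a graded piece of a module,
  the part of the next degree that it generates. It is the image of the last Koszul
  differential.\<close>

definition irr :: "'a set \<Rightarrow> 'a set" where
  "irr W = {\<Sum>v\<in>UNIV. X v (y v) |y. \<forall>v. y v \<in> W}"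

lemma irr_eq: "0 \<in> W \<Longrightarrow> irr W = (\<lambda>a. bd a {}) ` chains 1 W"
proof (intro subset_antisym subsetI)
  fix x assume "0 \<in> W" "x \<in> irr W"
  then obtain y where y: "x = (\<Sum>v\<in>UNIV. X v (y v))" "\<And>v. y v \<in> W" unfolding irr_def by blast
  let ?a = "\<lambda>S. if card S = 1 then y (the_elem S) else 0"
  have "?a \<in> chains 1 W" using y by (intro chainsI) auto
  moreover have "x = bd ?a {}" by (simp add: bd_empty y(1))
  ultimately show "x \<in> (\<lambda>a. bd a {}) ` chains 1 W" by blast
next
  fix x assume W: "0 \<in> W" "x \<in> (\<lambda>a. bd a {}) ` chains 1 W"
  then obtain a where a: "a \<in> chains 1 W" "x = bd a {}" by blast
  then have "\<forall>v. a {v} \<in> W" using chains_value W by blast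
  then show "x \<in> irr W" unfolding irr_def a(2) bd_empty by (intro CollectI exI[of _ "\<lambda>v. a {v}"]) auto
qed

lemma linear_bd_empty: "cv.lin (\<lambda>c. bd c {})"
  by (rule Vector_Spaces.linear_iff[THEN iffD2])
    (auto simp: ch.vector_space_axioms vector_space_axioms bd_add bd_scale csc_apply)

lemma linear_eval: "cv.lin (\<lambda>c. c S)"
  by (rule Vector_Spaces.linear_iff[THEN iffD2])
    (auto simp: ch.vector_space_axioms vector_space_axioms csc_apply)

lemma subspace_irr:
  assumes "subspace W" "fin_dim W"
  shows "subspace (irr W)" "fin_dim (irr W)"
proof -
  have eq: "irr W = (\<lambda>a. bd a {}) ` chains 1 W" using irr_eq assms subspace_0 by blast
  show "subspace (irr W)" unfolding eq by (rule cv.subspace_image[OF linear_bd_empty subspace_chains[OF assms(1)]])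
  show "fin_dim (irr W)" unfolding eq by (rule cv.fin_dim_image[OF linear_bd_empty fin_dim_chains[OF assms]])
qed

lemma irr_mono: "W \<subseteq> W' \<Longrightarrow> irr W \<subseteq> irr W'"
  unfolding irr_def by blast

lemma irr_graded: "graded Z \<Longrightarrow> irr (Z m) \<subseteq> Z (m + 1)"
  unfolding irr_def by (auto intro!: subspace_sum gradedD)

lemma chains_0I: "(\<And>S. S \<noteq> {} \<Longrightarrow> c S = 0) \<Longrightarrow> c {} \<in> W \<Longrightarrow> c \<in> chains 0 W"
  by (rule chainsI) auto

lemma chains_0_off: "c \<in> chains 0 W \<Longrightarrow> S \<noteq> {} \<Longrightarrow> c S = 0"
  using chains_off[of c 0 W S] by simp

lemma chains_0_restrict: "c \<in> chains 0 W \<Longrightarrow> c {} \<in> W' \<Longrightarrow> c \<in> chains 0 W'"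
  by (rule chains_0I) (rule chains_0_off)

lemma chains_0_eq: "c \<in> chains 0 W \<Longrightarrow> d \<in> chains 0 W' \<Longrightarrow> c {} = d {} \<Longrightarrow> c = d"
proof (rule ext)
  fix S assume "c \<in> chains 0 W" "d \<in> chains 0 W'" "c {} = d {}"
  then show "c S = d S" by (cases "S = {}") (simp_all add: chains_0_off)
qed

lemma chains_neg: "p < 0 \<Longrightarrow> c \<in> chains p W \<Longrightarrow> c = 0"
  by (rule ext) (simp add: chains_off)

lemma chains_large: "int CARD('v) < p \<Longrightarrow> c \<in> chains p W \<Longrightarrow> c = 0"
proof (rule ext)
  fix S :: "'v set"
  assume "int CARD('v) < p" "c \<in> chains p W"
  moreover have "card S \<le> CARD('v)" by (rule card_mono) auto
  ultimately show "c S = 0 S" by (simp add: chains_off)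
qed

lemma kh_trivial:
  assumes "p < 0 \<or> int CARD('v) < p" "graded Z" "graded B"
  shows "kh Z B p m = 0"
proof -
  have *: "c = 0" if "c \<in> chains p W" for c W using that assms(1) chains_neg chains_large by blast
  have "cyc Z B p m \<subseteq> {0}" using * cycD(1) by blast
  moreover have "bnd Z B p m \<subseteq> {0}"
  proof
    fix c assume "c \<in> bnd Z B p m"
    then obtain a b where ab: "a \<in> chains (p + 1) (Z (m - 1))" "b \<in> chains p (B m)" "c = bd a + b" by (rule bndE)
    have "bd a \<in> chains p (Z m)" using bd_graded'[OF assms(2) ab(1)] .
    then show "c \<in> {0}" by (simp add: ab(3) *[OF ab(2)] *[of _ "Z m"])
  qed
  ultimately have "cyc Z B p m = {0}" "bnd Z B p m = {0}"
    using ch.subspace_0 subspace_cyc(1) subspace_bnd(1) assms by blast+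
  then show ?thesis by (simp add: kh_def)
qed

end

text \<open>\<open>F\<close> models a free module and \<open>N\<close> the syzygies in it; freeness
  enters only through the vanishing of Koszul homology in positive degrees.\<close>

locale acyclic_module = poly_space sc X
  for sc :: "'k::field \<Rightarrow> 'a::ab_group_add \<Rightarrow> 'a" and X :: "'v::finite \<Rightarrow> 'a \<Rightarrow> 'a" +
  fixes F N :: "int \<Rightarrow> 'a set"
  assumes graded: "graded F" "graded N" and sub: "N m \<subseteq> F m"
    and acyclic: "p \<ge> 1 \<Longrightarrow> c \<in> chains p (F m) \<Longrightarrow> bd c = 0 \<Longrightarrow> \<exists>a\<in>chains (p + 1) (F (m - 1)). c = bd a"
begin

lemmas sF = gradedD(1)[OF graded(1)] and sN = gradedD(1)[OF graded(2)]

text \<open>The connecting map H_p(F/N) -> H_(p-1)(N) is induced by \<open>bd\<close>. Its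
  surjectivity comes from H_(p-1)(F) = 0 and its injectivity from H_p(F) = 0, whence the bound on
  \<open>p\<close>. One degree moves from the homological to the internal index.\<close>

lemma kh_syzygy:
  assumes "p \<ge> 2"
  shows "kh F N p m = kh N (\<lambda>_. {0}) (p - 1) (m + 1)"
  unfolding kh_def
proof (rule cc.dim_diff_eq_dim_diff[OF linear_bd])
  show "bnd F N p m \<subseteq> cyc F N p m" using bnd_cyc graded sub by blast
  show "cyc N (\<lambda>_. {0}) (p - 1) (m + 1) =
    {bd u + w |u w. u \<in> cyc F N p m \<and> w \<in> bnd N (\<lambda>_. {0}) (p - 1) (m + 1)}"
  proof (intro subset_antisym subsetI)
    fix c assume "c \<in> cyc N (\<lambda>_. {0}) (p - 1) (m + 1)"
    then have c: "c \<in> chains (p - 1) (N (m + 1))" "bd c = 0" by (auto simp: cyc_def chains_zero_iff)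
    have "c \<in> chains (p - 1) (F (m + 1))" using chains_mono[OF c(1) sub] .
    then obtain a where a: "a \<in> chains p (F m)" "c = bd a"
      using acyclic[of "p - 1" c "m + 1"] assms c(2) by auto
    then have "a \<in> cyc F N p m" using c(1) by (simp add: cyc_def)
    moreover have "0 \<in> bnd N (\<lambda>_. {0}) (p - 1) (m + 1)"
      using ch.subspace_0[OF subspace_bnd(1)[OF graded(2) graded_zero]] .
    ultimately show "c \<in> {bd u + w |u w. u \<in> cyc F N p m \<and> w \<in> bnd N (\<lambda>_. {0}) (p - 1) (m + 1)}"
      using a(2) by (intro CollectI exI[of _ a] exI[of _ 0]) simp
  next
    fix c assume "c \<in> {bd u + w |u w. u \<in> cyc F N p m \<and> w \<in> bnd N (\<lambda>_. {0}) (p - 1) (m + 1)}"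
    then obtain u w where u: "c = bd u + w" "u \<in> cyc F N p m" "w \<in> bnd N (\<lambda>_. {0}) (p - 1) (m + 1)" by blast
    have "bd u \<in> cyc N (\<lambda>_. {0}) (p - 1) (m + 1)" using cycD(2)[OF u(2)] by (simp add: cyc_def chains_zero_iff)
    moreover have "w \<in> cyc N (\<lambda>_. {0}) (p - 1) (m + 1)"
      using bnd_cyc[OF graded(2) graded_zero] u(3) gradedD(4)[OF graded(2)] by blast
    ultimately show "c \<in> cyc N (\<lambda>_. {0}) (p - 1) (m + 1)"
      using ch.subspace_add[OF subspace_cyc(1)[OF graded(2) graded_zero]] u(1) by blast
  qed
  fix u assume u: "u \<in> cyc F N p m"
  show "bd u \<in> bnd N (\<lambda>_. {0}) (p - 1) (m + 1) \<longleftrightarrow> u \<in> bnd F N p m"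
  proof
    assume "bd u \<in> bnd N (\<lambda>_. {0}) (p - 1) (m + 1)"
    then obtain a where a: "a \<in> chains p (N m)" "bd u = bd a"
      unfolding bnd_def by (auto simp: chains_zero_iff)
    have "u - a \<in> chains p (F m)" using chains_diff[OF sF cycD(1)[OF u] chains_mono[OF a(1) sub]] .
    then obtain b where b: "b \<in> chains (p + 1) (F (m - 1))" "u - a = bd b"
      using acyclic[of p "u - a" m] a(2) assms by (auto simp: bd_diff)
    have "u = bd b + a" using b(2) by (simp add: algebra_simps)
    then show "u \<in> bnd F N p m" using bndI[of b p F m a N] b(1) a(1) by simp
  next
    assume "u \<in> bnd F N p m"
    then obtain a b where ab: "b \<in> chains p (N m)" "u = bd a + b" by (rule bndE)
    then show "bd u \<in> bnd N (\<lambda>_. {0}) (p - 1) (m + 1)"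
      using bnd_boundary[OF graded_zero, of b "p - 1" N "m + 1"] by (simp add: bd_add)
  qed
qed (rule subspace_cyc[OF graded] subspace_bnd[OF graded] subspace_bnd[OF graded(2) graded_zero])+

text \<open>In degree 1 the long exact sequence runs into H_0: H_1(F/N) is the kernel of N/xN ->
  F/xF.\<close>

lemma kh_syzygy_1:
  "kh F N 1 m = int (dim (N (m + 1) \<inter> irr (F m))) - int (dim (irr (N m)))"
  unfolding kh_def
proof (rule cv.dim_diff_eq_dim_diff[OF linear_bd_empty])
  have s: "subspace (N (m + 1) \<inter> irr (F m))"
    using subspace_inter sN subspace_irr(1) gradedD[OF graded(1)] by blast
  show "bnd F N 1 m \<subseteq> cyc F N 1 m" using bnd_cyc graded sub by blast
  show "N (m + 1) \<inter> irr (F m) = {bd u {} + w |u w. u \<in> cyc F N 1 m \<and> w \<in> irr (N m)}"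
  proof (intro subset_antisym subsetI)
    fix x assume x: "x \<in> N (m + 1) \<inter> irr (F m)"
    then obtain a where a: "a \<in> chains 1 (F m)" "x = bd a {}"
      using irr_eq gradedD(4)[OF graded(1)] by blast
    have "bd a \<in> chains (1 - 1) (F (m + 1))" using bd_graded[OF graded(1) a(1)] .
    then have "bd a \<in> chains 0 (N (m + 1))" using chains_0_restrict[of "bd a"] a x by simp
    then have "a \<in> cyc F N 1 m" using a(1) by (simp add: cyc_def)
    moreover have "0 \<in> irr (N m)" using subspace_0 subspace_irr gradedD[OF graded(2)] by blast
    ultimately show "x \<in> {bd u {} + w |u w. u \<in> cyc F N 1 m \<and> w \<in> irr (N m)}"
      using a(2) by (intro CollectI exI[of _ a] exI[of _ 0]) simp
  next
    fix x assume "x \<in> {bd u {} + w |u w. u \<in> cyc F N 1 m \<and> w \<in> irr (N m)}"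
    then obtain u w where u: "x = bd u {} + w" "u \<in> cyc F N 1 m" "w \<in> irr (N m)" by blast
    have "bd u {} \<in> N (m + 1)" using chains_on[OF cycD(2)[OF u(2)], of "{}"] by simp
    moreover have "bd u {} \<in> irr (F m)" using cycD(1)[OF u(2)] irr_eq gradedD(4)[OF graded(1)] by blast
    moreover have "w \<in> N (m + 1)" "w \<in> irr (F m)" using u(3) irr_graded[OF graded(2)] irr_mono[OF sub] by blast+
    ultimately show "x \<in> N (m + 1) \<inter> irr (F m)" using subspace_add[OF s] u(1) by blast
  qed
  fix u assume u: "u \<in> cyc F N 1 m"
  show "bd u {} \<in> irr (N m) \<longleftrightarrow> u \<in> bnd F N 1 m"
  proof
    assume "bd u {} \<in> irr (N m)"
    then obtain a where a: "a \<in> chains 1 (N m)" "bd u {} = bd a {}"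
      using irr_eq gradedD(4)[OF graded(2)] by blast
    have "bd u = bd a"
      using chains_0_eq[of "bd u" "N (m + 1)" "bd a" "N (m + 1)"] a(2) cycD(2)[OF u] bd_graded[OF graded(2) a(1)] by simp
    moreover have "u - a \<in> chains 1 (F m)" using chains_diff[OF sF cycD(1)[OF u] chains_mono[OF a(1) sub]] .
    ultimately obtain b where b: "b \<in> chains (1 + 1) (F (m - 1))" "u - a = bd b"
      using acyclic[of 1 "u - a" m] by (auto simp: bd_diff)
    have "u = bd b + a" using b(2) by (simp add: algebra_simps)
    then show "u \<in> bnd F N 1 m" using bndI[of b 1 F m a N] b(1) a(1) by simp
  next
    assume "u \<in> bnd F N 1 m"
    then obtain a b where ab: "b \<in> chains 1 (N m)" "u = bd a + b" by (rule bndE)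
    then show "bd u {} \<in> irr (N m)"
      using irr_eq gradedD(4)[OF graded(2)] by (simp add: bd_add)
  qed
qed (rule subspace_cyc[OF graded] subspace_bnd[OF graded] subspace_irr[OF gradedD(1,2)[OF graded(2)]])+

lemma kh_syzygy_0:
  "kh F N 0 m = int (dim (F m)) - int (dim {x + y |x y. x \<in> irr (F (m - 1)) \<and> y \<in> N m})"
  unfolding kh_def
proof (rule cv.dim_diff_eq_dim_diff[OF linear_eval[of "{}"]])
  have i: "subspace (irr (F (m - 1)))" "fin_dim (irr (F (m - 1)))"
    using subspace_irr[OF gradedD(1,2)[OF graded(1)]] .
  have irr: "irr (F (m - 1)) \<subseteq> F m" using irr_graded[OF graded(1), of "m - 1"] by simp
  show "bnd F N 0 m \<subseteq> cyc F N 0 m" using bnd_cyc graded sub by blast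
  show "subspace {x + y |x y. x \<in> irr (F (m - 1)) \<and> y \<in> N m}" "fin_dim {x + y |x y. x \<in> irr (F (m - 1)) \<and> y \<in> N m}"
    using subspace_sums[OF i(1) sN] fin_dim_sum[OF i(2) gradedD(2)[OF graded(2)]] .
  show "F m = {u {} + w |u w. u \<in> cyc F N 0 m \<and> w \<in> {x + y |x y. x \<in> irr (F (m - 1)) \<and> y \<in> N m}}"
  proof (intro subset_antisym subsetI)
    fix x assume x: "x \<in> F m"
    let ?u = "\<lambda>S. if S = {} then x else 0"
    have u: "?u \<in> chains 0 (F m)" using x by (intro chains_0I) auto
    have "bd ?u = 0" using chains_neg[of "- 1"] bd_graded[OF graded(1) u] by simp
    then have "?u \<in> cyc F N 0 m" using u chains_zero[OF sN] by (intro cycI) simp_all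
    moreover have "0 \<in> irr (F (m - 1))" using subspace_0[OF i(1)] .
    moreover have "0 \<in> N m" using gradedD[OF graded(2)] by blast
    ultimately show "x \<in> {u {} + w |u w. u \<in> cyc F N 0 m \<and> w \<in> {x + y |x y. x \<in> irr (F (m - 1)) \<and> y \<in> N m}}"
      by (intro CollectI exI[of _ ?u] exI[of _ 0]) (simp, metis add_0_left)
  next
    fix x assume "x \<in> {u {} + w |u w. u \<in> cyc F N 0 m \<and> w \<in> {x + y |x y. x \<in> irr (F (m - 1)) \<and> y \<in> N m}}"
    then obtain u y z where u: "x = u {} + (y + z)" "u \<in> cyc F N 0 m" "y \<in> irr (F (m - 1))" "z \<in> N m" by blast
    have "u {} \<in> F m" using chains_on[OF cycD(1)[OF u(2)], of "{}"] by simp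
    moreover have "y \<in> F m" "z \<in> F m" using u irr sub by blast+
    ultimately show "x \<in> F m" unfolding u(1) by (intro subspace_add[OF sF])
  qed
  fix u assume u: "u \<in> cyc F N 0 m"
  show "u {} \<in> {x + y |x y. x \<in> irr (F (m - 1)) \<and> y \<in> N m} \<longleftrightarrow> u \<in> bnd F N 0 m"
  proof
    assume "u {} \<in> {x + y |x y. x \<in> irr (F (m - 1)) \<and> y \<in> N m}"
    then obtain x y where x: "x \<in> irr (F (m - 1))" "y \<in> N m" "u {} = x + y" by blast
    obtain a where a: "a \<in> chains 1 (F (m - 1))" "u {} - y = bd a {}"
      using x irr_eq[OF gradedD(4)[OF graded(1)]] by auto
    have "bd a \<in> chains 0 (F m)" using bd_graded[OF graded(1) a(1)] by simp
    then have "u - bd a \<in> chains 0 (F m)" using chains_diff[OF sF cycD(1)[OF u]] by blast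
    then have "u - bd a \<in> chains 0 (N m)" by (rule chains_0_restrict) (simp add: x flip: a(2))
    then show "u \<in> bnd F N 0 m" using bndI[of a 0 F m "u - bd a" N] a(1) by simp
  next
    assume "u \<in> bnd F N 0 m"
    then obtain a b where ab: "a \<in> chains (0 + 1) (F (m - 1))" "b \<in> chains 0 (N m)" "u = bd a + b" by (rule bndE)
    have "b {} \<in> N m" using chains_on[OF ab(2), of "{}"] by simp
    moreover have "bd a {} \<in> irr (F (m - 1))" using ab(1) irr_eq gradedD(4)[OF graded(1)] by simp
    ultimately show "u {} \<in> {x + y |x y. x \<in> irr (F (m - 1)) \<and> y \<in> N m}"
      using ab(3) by (intro CollectI exI[of _ "bd a {}"] exI[of _ "b {}"]) simp
  qed
qed (rule subspace_cyc[OF graded] subspace_bnd[OF graded])+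

end

section \<open>Comparison of Koszul homology along a homomorphism\<close>

locale poly_space_pair = ps1: poly_space s1 X1 + ps2: poly_space s2 X2
  for s1 :: "'k::field \<Rightarrow> 'a::ab_group_add \<Rightarrow> 'a" and X1 :: "'v::finite \<Rightarrow> 'a \<Rightarrow> 'a"
    and s2 :: "'k \<Rightarrow> 'b::ab_group_add \<Rightarrow> 'b" and X2 :: "'v \<Rightarrow> 'b \<Rightarrow> 'b"
begin

sublocale vp: fd_space_pair s1 s2 ..
sublocale cp: fd_space_pair ps1.csc ps2.csc ..

lemma bd_comp:
  assumes "vp.lin f" "\<And>v x. f (X1 v x) = X2 v (f x)"
  shows "ps2.bd (f \<circ> c) = f \<circ> ps1.bd c"
  by (rule ext) (simp add: ps1.bd_def ps2.bd_def vp.linear_sum[OF assms(1)] vp.linear_scale[OF assms(1)] assms(2))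

lemma comp_add: "vp.lin f \<Longrightarrow> f \<circ> (c + d) = (f \<circ> c) + (f \<circ> d)"
  by (rule ext) (simp add: vp.linear_add)

lemma comp_diff: "vp.lin f \<Longrightarrow> f \<circ> (c - d) = (f \<circ> c) - (f \<circ> d)"
  by (rule ext) (simp add: vp.linear_diff)

lemma linear_comp: "vp.lin f \<Longrightarrow> cp.lin (\<lambda>c. f \<circ> c)"
  by (rule Vector_Spaces.linear_iff[THEN iffD2])
    (auto simp: ps1.ch.vector_space_axioms ps2.ch.vector_space_axioms fun_eq_iff ps1.csc_apply ps2.csc_apply
      vp.linear_add vp.linear_scale)

lemma chains_map: "c \<in> ps1.chains p W \<Longrightarrow> (\<And>x. x \<in> W \<Longrightarrow> f x \<in> W') \<Longrightarrow> f 0 = 0 \<Longrightarrow> f \<circ> c \<in> ps2.chains p W'"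
  by (rule ps2.chainsI) (auto dest: ps1.chains_on ps1.chains_off)

lemma chains_comap:
  assumes "f \<circ> c \<in> ps2.chains p W'" "c \<in> ps1.chains p W" "\<And>x. x \<in> W \<Longrightarrow> f x \<in> W' \<Longrightarrow> x \<in> B"
  shows "c \<in> ps1.chains p B"
proof (rule ps1.chainsI)
  fix S :: "'v set" assume "int (card S) = p"
  then show "c S \<in> B" using ps2.chains_on[OF assms(1)] ps1.chains_on[OF assms(2)] assms(3) by simp
qed (rule ps1.chains_off[OF assms(2)])

lemma chains_lift:
  assumes "d \<in> ps2.chains p W" "\<And>y. y \<in> W \<Longrightarrow> \<exists>x\<in>V. y - f x \<in> B" "f 0 = 0"
  obtains c where "c \<in> ps1.chains p V" "d - (f \<circ> c) \<in> ps2.chains p B"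
proof -
  have "\<forall>S. \<exists>x. int (card S) = p \<longrightarrow> x \<in> V \<and> d S - f x \<in> B"
    using ps2.chains_on[OF assms(1)] assms(2) by metis
  then obtain c where c: "\<And>S. int (card S) = p \<Longrightarrow> c S \<in> V \<and> d S - f (c S) \<in> B" by metis
  show thesis
  proof (rule that[of "\<lambda>S. if int (card S) = p then c S else 0"])
    show "(\<lambda>S. if int (card S) = p then c S else 0) \<in> ps1.chains p V" using c by (auto intro: ps1.chainsI)
    show "d - (f \<circ> (\<lambda>S. if int (card S) = p then c S else 0)) \<in> ps2.chains p B"
      using c ps2.chains_off[OF assms(1)] assms(3) by (auto intro!: ps2.chainsI)
  qed
qed

text \<open>\<open>f\<close> induces an isomorphism Z/B -> Z'/B' of graded modules:
  \<open>fB\<close> makes it well defined and injective, \<open>surj\<close> surjective. Chains are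
  lifted coefficientwise, up to chains of \<open>B'\<close>, and injectivity shows that lifts of
  cycles are cycles.\<close>

lemma kh_transport:
  assumes f: "vp.lin f" "\<And>v x. f (X1 v x) = X2 v (f x)"
    and g: "ps1.graded Z" "ps1.graded B" "ps2.graded Z'" "ps2.graded B'"
    and sub: "\<And>m. B m \<subseteq> Z m" "\<And>m. B' m \<subseteq> Z' m"
    and fZ: "\<And>m x. x \<in> Z m \<Longrightarrow> f x \<in> Z' m"
    and fB: "\<And>m x. x \<in> Z m \<Longrightarrow> f x \<in> B' m \<longleftrightarrow> x \<in> B m"
    and surj: "\<And>m y. y \<in> Z' m \<Longrightarrow> \<exists>x\<in>Z m. y - f x \<in> B' m"
  shows "ps1.kh Z B p m = ps2.kh Z' B' p m"
  unfolding ps1.kh_def ps2.kh_def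
proof (rule cp.dim_diff_eq_dim_diff[OF linear_comp[OF f(1)]])
  note s = ps1.gradedD(1)[OF g(1)] ps1.gradedD(1)[OF g(2)] ps2.gradedD(1)[OF g(3)] ps2.gradedD(1)[OF g(4)]
  have f0: "f 0 = 0" using vp.linear_0[OF f(1)] .
  have cZ: "f \<circ> c \<in> ps2.chains q (Z' k)" if "c \<in> ps1.chains q (Z k)" for c q k
    using that by (rule chains_map) (use fZ f0 in auto)
  have cB: "f \<circ> c \<in> ps2.chains q (B' k)" if "c \<in> ps1.chains q (B k)" for c q k
    using that by (rule chains_map) (use fB sub f0 in auto)
  have cB': "c \<in> ps1.chains q (B k)" if "f \<circ> c \<in> ps2.chains q (B' k)" "c \<in> ps1.chains q (Z k)" for c q k
    using that by (rule chains_comap) (use fB in auto)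
  have lift: "\<exists>c\<in>ps1.chains q (Z k). d - (f \<circ> c) \<in> ps2.chains q (B' k)" if "d \<in> ps2.chains q (Z' k)" for d q k
    using chains_lift[of d q "Z' k" "Z k" f "B' k"] that surj f0 by metis
  show "ps1.bnd Z B p m \<subseteq> ps1.cyc Z B p m" using ps1.bnd_cyc g sub by blast
  show "ps2.cyc Z' B' p m = {(f \<circ> u) + w |u w. u \<in> ps1.cyc Z B p m \<and> w \<in> ps2.bnd Z' B' p m}"
  proof (intro subset_antisym subsetI)
    fix d assume d: "d \<in> ps2.cyc Z' B' p m"
    obtain c where c: "c \<in> ps1.chains p (Z m)" "d - (f \<circ> c) \<in> ps2.chains p (B' m)"
      using lift[OF ps2.cycD(1)[OF d]] by blast
    have "ps2.bd (d - (f \<circ> c)) \<in> ps2.chains (p - 1) (B' (m + 1))" using ps2.bd_graded[OF g(4) c(2)] .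
    then have "ps2.bd d - ps2.bd (d - (f \<circ> c)) \<in> ps2.chains (p - 1) (B' (m + 1))"
      using ps2.chains_diff[OF s(4) ps2.cycD(2)[OF d]] by blast
    moreover have "ps2.bd d - ps2.bd (d - (f \<circ> c)) = f \<circ> ps1.bd c"
      by (simp add: ps2.bd_diff bd_comp[OF f])
    ultimately have "f \<circ> ps1.bd c \<in> ps2.chains (p - 1) (B' (m + 1))" by simp
    then have "c \<in> ps1.cyc Z B p m"
      using c(1) cB' ps1.bd_graded[OF g(1) c(1)] by (intro ps1.cycI) auto
    moreover have "d - (f \<circ> c) \<in> ps2.bnd Z' B' p m"
      using ps2.bnd_base[OF g(3), of "d - (f \<circ> c)" p B' m] c(2) by simp
    moreover have "d = (f \<circ> c) + (d - (f \<circ> c))" by simp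
    ultimately show "d \<in> {(f \<circ> u) + w |u w. u \<in> ps1.cyc Z B p m \<and> w \<in> ps2.bnd Z' B' p m}" by blast
  next
    fix d assume "d \<in> {(f \<circ> u) + w |u w. u \<in> ps1.cyc Z B p m \<and> w \<in> ps2.bnd Z' B' p m}"
    then obtain u w where u: "d = (f \<circ> u) + w" "u \<in> ps1.cyc Z B p m" "w \<in> ps2.bnd Z' B' p m" by blast
    have "f \<circ> u \<in> ps2.cyc Z' B' p m"
      using cZ[OF ps1.cycD(1)[OF u(2)]] cB[OF ps1.cycD(2)[OF u(2)]] by (intro ps2.cycI) (simp_all add: bd_comp[OF f])
    moreover have "w \<in> ps2.cyc Z' B' p m" using ps2.bnd_cyc[OF g(3,4) sub(2)] u(3) by blast
    ultimately show "d \<in> ps2.cyc Z' B' p m" unfolding u(1) by (rule ps2.ch.subspace_add[OF ps2.subspace_cyc(1)[OF g(3,4)]])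
  qed
  fix u assume u: "u \<in> ps1.cyc Z B p m"
  show "f \<circ> u \<in> ps2.bnd Z' B' p m \<longleftrightarrow> u \<in> ps1.bnd Z B p m"
  proof
    assume "f \<circ> u \<in> ps2.bnd Z' B' p m"
    then obtain a' b' where a': "a' \<in> ps2.chains (p + 1) (Z' (m - 1))" "b' \<in> ps2.chains p (B' m)" "f \<circ> u = ps2.bd a' + b'"
      by (rule ps2.bndE)
    obtain a where a: "a \<in> ps1.chains (p + 1) (Z (m - 1))" "a' - (f \<circ> a) \<in> ps2.chains (p + 1) (B' (m - 1))"
      using lift[OF a'(1)] by blast
    have "f \<circ> (u - ps1.bd a) = ps2.bd (a' - (f \<circ> a)) + b'"
      using a'(3) by (simp add: comp_diff[OF f(1)] ps2.bd_diff bd_comp[OF f])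
    moreover have "ps2.bd (a' - (f \<circ> a)) + b' \<in> ps2.chains p (B' m)"
      using ps2.bd_graded'[OF g(4) a(2)] a'(2) by (rule ps2.chains_add[OF s(4)])
    moreover have "u - ps1.bd a \<in> ps1.chains p (Z m)"
      using ps1.chains_diff[OF s(1) ps1.cycD(1)[OF u] ps1.bd_graded'[OF g(1) a(1)]] .
    ultimately have "u - ps1.bd a \<in> ps1.chains p (B m)" using cB' by simp
    then show "u \<in> ps1.bnd Z B p m" using ps1.bndI[of a p Z m "u - ps1.bd a" B] a(1) by simp
  next
    assume "u \<in> ps1.bnd Z B p m"
    then obtain a b where ab: "a \<in> ps1.chains (p + 1) (Z (m - 1))" "b \<in> ps1.chains p (B m)" "u = ps1.bd a + b"
      by (rule ps1.bndE)
    have "f \<circ> u = ps2.bd (f \<circ> a) + (f \<circ> b)" by (simp add: ab(3) comp_add[OF f(1)] bd_comp[OF f])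
    then show "f \<circ> u \<in> ps2.bnd Z' B' p m"
      using ps2.bndI[of "f \<circ> a" p Z' m "f \<circ> b" B'] cZ[OF ab(1)] cB[OF ab(2)] by simp
  qed
qed (rule ps1.subspace_cyc[OF g(1,2)] ps1.subspace_bnd[OF g(1,2)] ps2.subspace_bnd[OF g(3,4)])+

end

section \<open>Euler characteristic, socle and duality\<close>

context poly_space
begin

definition hilb :: "(int \<Rightarrow> 'a set) \<Rightarrow> (int \<Rightarrow> 'a set) \<Rightarrow> int \<Rightarrow> int" where
  "hilb Z B m = int (dim (Z m)) - int (dim (B m))"

lemma rank_bd:
  assumes g: "graded Z" "graded B" and sub: "\<And>m. B m \<subseteq> Z m"
  shows "int (ch.dim (chains p (Z m))) - int (ch.dim (cyc Z B p m)) =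
    int (ch.dim (bnd Z B (p - 1) (m + 1))) - int (ch.dim (chains (p - 1) (B (m + 1))))"
proof (rule cc.dim_diff_eq_dim_diff[OF linear_bd])
  show "bnd Z B (p - 1) (m + 1) = {bd u + w |u w. u \<in> chains p (Z m) \<and> w \<in> chains (p - 1) (B (m + 1))}"
    by (simp add: bnd_def)
  show "bd u \<in> chains (p - 1) (B (m + 1)) \<longleftrightarrow> u \<in> cyc Z B p m" if "u \<in> chains p (Z m)" for u
    using that by (simp add: cyc_def)
  show "cyc Z B p m \<subseteq> chains p (Z m)" by (auto simp: cyc_def)
qed (rule subspace_cyc[OF g] subspace_chains[OF gradedD(1)[OF g(1)]] subspace_chains[OF gradedD(1)[OF g(2)]]
  fin_dim_chains[OF gradedD(1,2)[OF g(1)]] fin_dim_chains[OF gradedD(1,2)[OF g(2)]])+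

lemma card_subsets: "card {S :: 'v set. int (card S) = int k} = CARD('v) choose k"
  using n_subsets[of "UNIV :: 'v set" k] by simp

lemma euler_characteristic:
  assumes g: "graded Z" "graded B" and sub: "\<And>m. B m \<subseteq> Z m"
  shows "(\<Sum>p\<le>CARD('v). (- 1) ^ p * kh Z B (int p) (j - int p)) =
    (\<Sum>p\<le>CARD('v). (- 1) ^ p * int (CARD('v) choose p) * hilb Z B (j - int p))"
proof -
  \<comment> \<open>In total degree \<open>j\<close>, \<open>a p\<close> is the dimension of the
    space of p-chains of Z/B and \<open>b p\<close> that of its boundaries. The contributions of
    \<open>b\<close> telescope in the alternating sum; only its two extreme values survive, and
    these vanish.\<close>
  define a where "a p = int (ch.dim (chains p (Z (j - p)))) - int (ch.dim (chains p (B (j - p))))" for p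
  define b where "b p = int (ch.dim (bnd Z B p (j - p))) - int (ch.dim (chains p (B (j - p))))" for p
  have step: "a p = kh Z B p (j - p) + b p + b (p - 1)" for p
    using rank_bd[OF assms, of p "j - p"] unfolding a_def b_def kh_def by (simp add: algebra_simps)
  have tel: "(\<Sum>p\<le>n. (- 1) ^ p * a (int p)) =
      (\<Sum>p\<le>n. (- 1) ^ p * kh Z B (int p) (j - int p)) + (- 1) ^ n * b (int n) + b (- 1)" for n
    by (induction n) (simp_all add: step algebra_simps)
  have triv: "b p = 0" if "p = - 1 \<or> p = int CARD('v)" for p
  proof -
    have "bnd Z B p (j - p) = chains p (B (j - p))"
    proof (intro subset_antisym subsetI)
      fix c assume "c \<in> bnd Z B p (j - p)"
      then obtain a b where ab: "a \<in> chains (p + 1) (Z (j - p - 1))" "b \<in> chains p (B (j - p))" "c = bd a + b"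
        by (rule bndE)
      have "bd a = 0" using that
      proof
        assume "p = - 1"
        then show ?thesis using chains_neg[OF _ bd_graded'[OF g(1) ab(1)]] by simp
      next
        assume "p = int CARD('v)"
        then show ?thesis using chains_large[OF _ ab(1)] by simp
      qed
      then show "c \<in> chains p (B (j - p))" using ab by simp
    qed (rule bnd_base[OF g(1)])
    then show ?thesis by (simp add: b_def)
  qed
  have "a (int p) = int (CARD('v) choose p) * hilb Z B (j - int p)" for p
    unfolding a_def hilb_def
    using dim_chains[OF gradedD(1,2)[OF g(1)]] dim_chains[OF gradedD(1,2)[OF g(2)]]
    by (simp add: card_subsets[simplified] right_diff_distrib)
  then show ?thesis using tel[of "CARD('v)"] triv by (simp add: mult.assoc)
qed

text \<open>Top Koszul homology is the socle. An element annihilated by all variables is the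
  coefficient of a cycle supported on the full set of variables; there are no chains above this
  degree, so vanishing homology forces the element into \<open>B m\<close>.\<close>

lemma socle:
  assumes g: "graded Z" "graded B" and sub: "\<And>m. B m \<subseteq> Z m"
    and kh: "kh Z B (int CARD('v)) m = 0" and z: "z \<in> Z m" "\<And>v. X v z \<in> B (m + 1)"
  shows "z \<in> B m"
proof -
  let ?n = "int CARD('v)" and ?c = "\<lambda>S :: 'v set. if S = UNIV then z else 0"
  have full: "S = UNIV" if "int (card S) = ?n" for S :: "'v set"
    using that by (simp add: card_eq_UNIV_imp_eq_UNIV)
  have c: "?c \<in> chains ?n (Z m)" using z(1) full by (intro chainsI) auto
  have "?c \<in> cyc Z B ?n m"
  proof (rule cycI, rule c)
    have "sc (koszul_sign v T) (X v (?c (insert v T))) \<in> B (m + 1)" for v T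
      using z(2) gradedD(4)[OF g(2)] by (auto intro: subspace_scale[OF gradedD(1)[OF g(2)]])
    then have "bd ?c T \<in> B (m + 1)" for T
      unfolding bd_def by (intro subspace_sum[OF gradedD(1)[OF g(2)]])
    then show "bd ?c \<in> chains (?n - 1) (B (m + 1))"
      using chains_off[OF bd_graded[OF g(1) c]] by (intro chainsI)
  qed
  moreover have "bnd Z B ?n m = cyc Z B ?n m"
    using kh by (intro ch.eq_if_dim_le subspace_bnd subspace_cyc g bnd_cyc sub) (simp add: kh_def)
  ultimately obtain a b where ab: "a \<in> chains (?n + 1) (Z (m - 1))" "b \<in> chains ?n (B m)" "?c = bd a + b"
    by (metis bndE)
  have "a = 0" using chains_large[OF _ ab(1)] by simp
  then have "?c = b" using ab(3) by simp
  from fun_cong[OF this, of UNIV] show ?thesis using chains_on[OF ab(2), of UNIV] by simp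
qed

end

text \<open>The sign of the shuffle of \<open>S\<close> with its complement would count only
  \<open>w\<close> outside \<open>S\<close>. Counting all \<open>w\<close> changes it by (-1)^(|S|
  choose 2); this makes it a product of factors that do not depend on \<open>S\<close>, and
  \<open>bd\<close> self-adjoint in \<open>chain_pr_bd\<close> without a sign depending on the
  degree.\<close>

definition shuffle_sign :: "'v::finite set \<Rightarrow> 'k::field" where
  "shuffle_sign S = (\<Prod>u\<in>S. (- 1) ^ card {w :: 'v. var_index w < var_index u})"

lemma shuffle_sign_neq_0 [simp]: "shuffle_sign S \<noteq> 0"
  by (simp add: shuffle_sign_def)

lemma shuffle_sign_insert:
  assumes "(v :: 'v::finite) \<notin> T"
  shows "shuffle_sign T * koszul_sign v T = (shuffle_sign (insert v T) * koszul_sign v (- insert v T) :: 'k::field)"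
proof -
  let ?A = "{u \<in> T. var_index u < var_index v}" and ?B = "{u \<in> - insert v T. var_index u < var_index v}"
  have "{w :: 'v. var_index w < var_index v} = ?A \<union> ?B" using assms by auto
  moreover have "card (?A \<union> ?B) = card ?A + card ?B" by (rule card_Un_disjoint) auto
  ultimately have "(- 1) ^ card {w :: 'v. var_index w < var_index v} = (koszul_sign v T * koszul_sign v (- insert v T) :: 'k)"
    by (simp add: koszul_sign_def power_add)
  then have "shuffle_sign (insert v T) * koszul_sign v (- insert v T) =
      koszul_sign v T * (koszul_sign v (- insert v T) * koszul_sign v (- insert v T)) * (shuffle_sign T :: 'k)"
    using assms by (simp add: shuffle_sign_def)
  then show ?thesis by (simp add: mult.commute)
qed

text \<open>A symmetric pairing for which the variables are self-adjoint, perfect between the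
  degrees \<open>m\<close> and \<open>s - m\<close> of Z/B, so that \<open>s\<close> is the socle
  degree. It lives on \<open>Z\<close>, and perfectness says that \<open>B\<close> is its
  radical.\<close>

locale gorenstein = poly_space sc X
  for sc :: "'k::field \<Rightarrow> 'a::ab_group_add \<Rightarrow> 'a" and X :: "'v::finite \<Rightarrow> 'a \<Rightarrow> 'a" +
  fixes Z B :: "int \<Rightarrow> 'a set" and pr :: "'a \<Rightarrow> 'a \<Rightarrow> 'k" and s n :: int
  assumes n_eq: "n = int CARD('v)" and graded: "graded Z" "graded B" and sub: "B m \<subseteq> Z m"
    and pr_add: "pr (x + y) z = pr x z + pr y z" and pr_scale: "pr (sc c x) z = c * pr x z"
    and pr_sym: "pr x y = pr y x" and pr_X: "pr (X v x) y = pr x (X v y)"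
    and perfect: "x \<in> Z m \<Longrightarrow> (\<forall>y\<in>Z (s - m). pr x y = 0) \<longleftrightarrow> x \<in> B m"
begin

lemma pr_add': "pr z (x + y) = pr z x + pr z y"
  by (simp only: pr_sym[of z] pr_add)

lemma pr_scale': "pr z (sc c x) = c * pr z x"
  by (simp only: pr_sym[of z] pr_scale)

lemma pr_zero [simp]: "pr 0 x = 0" "pr x 0 = 0"
  using pr_add[of 0 0 x] pr_add'[of x 0 0] by (simp_all only: add_0_right add_cancel_right_right)

lemma pr_sum: "pr (sum f A) y = (\<Sum>i\<in>A. pr (f i) y)" "pr y (sum f A) = (\<Sum>i\<in>A. pr y (f i))"
  by (induction A rule: infinite_finite_induct) (auto simp: pr_add pr_add')

definition chain_pr :: "('v set \<Rightarrow> 'a) \<Rightarrow> ('v set \<Rightarrow> 'a) \<Rightarrow> 'k" where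
  "chain_pr c d = (\<Sum>S\<in>UNIV. shuffle_sign S * pr (c S) (d (- S)))"

text \<open>Both sides are sums over a set \<open>S\<close> and an element \<open>v\<close> of it;
  the left one takes this form under S = \<open>insert v T\<close>, and the signs agree by
  \<open>shuffle_sign_insert\<close>.\<close>

lemma chain_pr_bd: "chain_pr (bd c) d = chain_pr c (bd d)"
proof -
  have "chain_pr (bd c) d = (\<Sum>T\<in>UNIV. \<Sum>v\<in>- T.
      shuffle_sign T * koszul_sign v T * pr (X v (c (insert v T))) (d (- T)))"
    by (simp add: chain_pr_def bd_def pr_sum pr_scale sum_distrib_left mult.assoc)
  also have "\<dots> = (\<Sum>(T, v)\<in>(SIGMA T:UNIV. - T). shuffle_sign T * koszul_sign v T * pr (X v (c (insert v T))) (d (- T)))"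
    by (subst sum.Sigma) auto
  also have "\<dots> = (\<Sum>(S, v)\<in>(SIGMA S:UNIV. S). shuffle_sign S * koszul_sign v (- S) * pr (c S) (X v (d (insert v (- S)))))"
  proof (rule sum.reindex_bij_witness[of _ "\<lambda>(S, v). (S - {v}, v)" "\<lambda>(T, v). (insert v T, v)"], goal_cases)
    case (4 q)
    then obtain S v where q: "q = (S, v)" "v \<in> S" by auto
    then show ?case by auto
  next
    case (5 p)
    then obtain T v where p: "p = (T, v)" "v \<notin> T" by auto
    have "insert v (- insert v T) = - T" using p(2) by auto
    then show ?case using shuffle_sign_insert[OF p(2), where 'k = 'k] by (simp add: p(1) pr_X)
  qed auto
  also have "\<dots> = (\<Sum>S\<in>UNIV. \<Sum>v\<in>S. shuffle_sign S * koszul_sign v (- S) * pr (c S) (X v (d (insert v (- S)))))"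
    by (subst sum.Sigma) auto
  also have "\<dots> = chain_pr c (bd d)"
    by (simp add: chain_pr_def bd_def pr_sum pr_scale' sum_distrib_left mult.assoc)
  finally show ?thesis .
qed

lemma chain_pr_linear:
  "Vector_Spaces.linear csc (*) (\<lambda>c. chain_pr c d)" "Vector_Spaces.linear csc (*) (chain_pr c)"
proof -
  interpret f: fd_space "(*) :: 'k \<Rightarrow> 'k \<Rightarrow> 'k" by (rule fd_space_mult)
  have "chain_pr (c + c') d = chain_pr c d + chain_pr c' d" "chain_pr c (d + d') = chain_pr c d + chain_pr c d'" for c c' d d'
    by (simp_all add: chain_pr_def pr_add pr_add' distrib_left sum.distrib)
  moreover have "chain_pr (csc a c) d = a * chain_pr c d" "chain_pr c (csc a d) = a * chain_pr c d" for a c d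
    unfolding chain_pr_def csc_apply pr_scale pr_scale' sum_distrib_left
    by (intro sum.cong refl mult.left_commute)+
  ultimately show "Vector_Spaces.linear csc (*) (\<lambda>c. chain_pr c d)" "Vector_Spaces.linear csc (*) (chain_pr c)"
    by (simp_all only: Vector_Spaces.linear_iff ch.vector_space_axioms f.vector_space_axioms simp_thms)
qed

lemma card_compl: "int (card (- S :: 'v set)) = n - int (card S)"
  using card_Un_disjoint[of S "- S"] by (simp add: n_eq)

lemma perfect_right: "y \<in> Z (s - m) \<Longrightarrow> (\<forall>x\<in>Z m. pr x y = 0) \<longleftrightarrow> y \<in> B (s - m)"
  using perfect[of y "s - m"] pr_sym[of y] by simp

text \<open>Testing against chains supported on a single complement \<open>- S\<close> isolates the
  coefficient at \<open>S\<close>, so perfectness passes from coefficients to chains.\<close>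

lemma chain_perfect:
  assumes c: "c \<in> chains p (Z m)"
  shows "(\<forall>d\<in>chains (n - p) (Z (s - m)). chain_pr c d = 0) \<longleftrightarrow> c \<in> chains p (B m)"
proof
  assume *: "\<forall>d\<in>chains (n - p) (Z (s - m)). chain_pr c d = 0"
  show "c \<in> chains p (B m)"
  proof (rule chainsI)
    fix S :: "'v set" assume S: "int (card S) = p"
    have "pr (c S) y = 0" if y: "y \<in> Z (s - m)" for y
    proof -
      let ?d = "\<lambda>T. if T = - S then y else 0"
      have "?d \<in> chains (n - p) (Z (s - m))" 
        using y S card_compl[of S] gradedD(4)[OF graded(1)] by (intro chainsI) auto
      then have "chain_pr c ?d = 0" using * by blast
      moreover have "chain_pr c ?d = (\<Sum>T\<in>UNIV. if T = S then shuffle_sign S * pr (c S) y else 0)"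
        unfolding chain_pr_def by (rule sum.cong) auto
      ultimately show ?thesis by simp
    qed
    then show "c S \<in> B m" using perfect[OF chains_on[OF c S]] by blast
  qed (rule chains_off[OF c])
next
  assume cB: "c \<in> chains p (B m)"
  show "\<forall>d\<in>chains (n - p) (Z (s - m)). chain_pr c d = 0"
  proof
    fix d assume d: "d \<in> chains (n - p) (Z (s - m))"
    have "pr (c S) (d (- S)) = 0" for S
    proof (cases "int (card S) = p")
      case True
      have "d (- S) \<in> Z (s - m)" using chains_on[OF d] card_compl[of S] True by simp
      then show ?thesis using perfect[of "c S" m] chains_on[OF cB True] sub by blast
    qed (simp add: chains_off[OF cB])
    then show "chain_pr c d = 0" by (simp add: chain_pr_def)
  qed
qed

lemma chain_perfect_right:
  assumes d: "d \<in> chains (n - p) (Z (s - m))"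
  shows "(\<forall>c\<in>chains p (Z m). chain_pr c d = 0) \<longleftrightarrow> d \<in> chains (n - p) (B (s - m))"
proof
  assume *: "\<forall>c\<in>chains p (Z m). chain_pr c d = 0"
  show "d \<in> chains (n - p) (B (s - m))"
  proof (rule chainsI)
    fix S :: "'v set" assume S: "int (card S) = n - p"
    have "pr x (d S) = 0" if x: "x \<in> Z m" for x
    proof -
      let ?c = "\<lambda>T. if T = - S then x else 0"
      have "?c \<in> chains p (Z m)" 
        using x S card_compl[of S] gradedD(4)[OF graded(1)] by (intro chainsI) auto
      then have "chain_pr ?c d = 0" using * by blast
      moreover have "chain_pr ?c d = (\<Sum>T\<in>UNIV. if T = - S then shuffle_sign (- S) * pr x (d S) else 0)"
        unfolding chain_pr_def by (rule sum.cong) auto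
      ultimately show ?thesis by simp
    qed
    then show "d S \<in> B (s - m)" using perfect_right[OF chains_on[OF d S]] by blast
  qed (rule chains_off[OF d])
next
  assume dB: "d \<in> chains (n - p) (B (s - m))"
  show "\<forall>c\<in>chains p (Z m). chain_pr c d = 0"
  proof
    fix c assume c: "c \<in> chains p (Z m)"
    have "pr (c S) (d (- S)) = 0" for S
    proof (cases "int (card S) = p")
      case True
      have "d (- S) \<in> B (s - m)" using chains_on[OF dB] card_compl[of S] True by simp
      then show ?thesis using perfect_right[of "d (- S)" m] chains_on[OF c True] sub by blast
    qed (simp add: chains_off[OF c])
    then show "chain_pr c d = 0" by (simp add: chain_pr_def)
  qed
qed

text \<open>By adjointness and perfectness, \<open>bd c\<close> vanishes modulo \<open>B\<close> iff
  \<open>c\<close> is orthogonal to all boundaries. The chains of \<open>B\<close> contained in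
  \<open>bnd\<close> are orthogonal to all chains of \<open>Z\<close>.\<close>

lemma cyc_perp:
  "cyc Z B p m = {c \<in> chains p (Z m). \<forall>d\<in>bnd Z B (n - p) (s - m). chain_pr c d = 0}"
proof -
  have "bd c \<in> chains (p - 1) (B (m + 1)) \<longleftrightarrow> (\<forall>d\<in>bnd Z B (n - p) (s - m). chain_pr c d = 0)"
    if c: "c \<in> chains p (Z m)" for c
  proof -
    have 0: "chain_pr c b = 0" if "b \<in> chains (n - p) (B (s - m))" for b
      using chain_perfect_right[of b p m] that chains_mono[OF that sub] c by blast
    have "bd c \<in> chains (p - 1) (B (m + 1)) \<longleftrightarrow> (\<forall>a\<in>chains (n - (p - 1)) (Z (s - (m + 1))). chain_pr (bd c) a = 0)"
      using chain_perfect[OF bd_graded[OF graded(1) c]] by simp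
    also have "\<dots> \<longleftrightarrow> (\<forall>a\<in>chains (n - p + 1) (Z (s - m - 1)). chain_pr c (bd a) = 0)"
      by (simp add: chain_pr_bd algebra_simps)
    also have "\<dots> \<longleftrightarrow> (\<forall>d\<in>bnd Z B (n - p) (s - m). chain_pr c d = 0)"
    proof
      assume *: "\<forall>a\<in>chains (n - p + 1) (Z (s - m - 1)). chain_pr c (bd a) = 0"
      show "\<forall>d\<in>bnd Z B (n - p) (s - m). chain_pr c d = 0"
      proof
        fix d assume "d \<in> bnd Z B (n - p) (s - m)"
        then obtain a b where ab: "a \<in> chains (n - p + 1) (Z (s - m - 1))" "b \<in> chains (n - p) (B (s - m))" "d = bd a + b"
          by (rule bndE)
        have "chain_pr c d = chain_pr c (bd a) + chain_pr c b"
          using chain_pr_linear(2)[of c] unfolding ab(3) Vector_Spaces.linear_iff by blast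
        then show "chain_pr c d = 0" using * ab(1) 0[OF ab(2)] by simp
      qed
    next
      assume *: "\<forall>d\<in>bnd Z B (n - p) (s - m). chain_pr c d = 0"
      show "\<forall>a\<in>chains (n - p + 1) (Z (s - m - 1)). chain_pr c (bd a) = 0"
      proof
        fix a assume "a \<in> chains (n - p + 1) (Z (s - m - 1))"
        then have "bd a \<in> bnd Z B (n - p) (s - m)" by (rule bnd_boundary[OF graded(2)])
        then show "chain_pr c (bd a) = 0" using * by blast
      qed
    qed
    finally show ?thesis .
  qed
  then show ?thesis by (auto simp: cyc_def)
qed

text \<open>Two rank formulas for \<open>chain_pr\<close>. By \<open>cyc_perp\<close> its left
  radical is the space of cycles when the right argument runs over boundaries, and it is the chains
  of \<open>B\<close> when the right argument runs over all chains; the right radical is in both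
  cases the chains of \<open>B\<close>.\<close>

lemma dim_duality:
  "ch.dim (chains p (Z m)) + ch.dim (chains (n - p) (B (s - m))) =
    ch.dim (bnd Z B (n - p) (s - m)) + ch.dim (cyc Z B p m)"
  "ch.dim (chains p (Z m)) + ch.dim (chains (n - p) (B (s - m))) =
    ch.dim (chains (n - p) (Z (s - m))) + ch.dim (chains p (B m))"
proof -
  note sZ = subspace_chains[OF gradedD(1)[OF graded(1)]] fin_dim_chains[OF gradedD(1,2)[OF graded(1)]]
  let ?C = "chains p (Z m)" and ?D = "chains (n - p) (Z (s - m))" and ?N = "bnd Z B (n - p) (s - m)"
  have "{w \<in> ?N. \<forall>u\<in>?C. chain_pr u w = 0} = chains (n - p) (B (s - m))"
  proof (intro subset_antisym subsetI)
    fix w assume w: "w \<in> {w \<in> ?N. \<forall>u\<in>?C. chain_pr u w = 0}"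
    then have "w \<in> ?D" using bnd_cyc[OF graded sub] cycD(1) by blast
    then show "w \<in> chains (n - p) (B (s - m))" using w chain_perfect_right by blast
  next
    fix w assume w: "w \<in> chains (n - p) (B (s - m))"
    then show "w \<in> {w \<in> ?N. \<forall>u\<in>?C. chain_pr u w = 0}"
      using chain_perfect_right[OF chains_mono[OF w sub]] bnd_base[OF graded(1), of w "n - p" B "s - m"] by blast
  qed
  then show "ch.dim ?C + ch.dim (chains (n - p) (B (s - m))) = ch.dim ?N + ch.dim (cyc Z B p m)"
    using cc.bilinear_rank_eq[OF chain_pr_linear sZ subspace_bnd[OF graded], of p m "n - p" "s - m"]
    by (simp flip: cyc_perp)
  have "{w \<in> ?D. \<forall>u\<in>?C. chain_pr u w = 0} = chains (n - p) (B (s - m))"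
    using chain_perfect_right chains_mono[OF _ sub] by blast
  moreover have "{u \<in> ?C. \<forall>w\<in>?D. chain_pr u w = 0} = chains p (B m)"
    using chain_perfect chains_mono[OF _ sub] by blast
  ultimately show "ch.dim ?C + ch.dim (chains (n - p) (B (s - m))) = ch.dim ?D + ch.dim (chains p (B m))"
    using cc.bilinear_rank_eq[OF chain_pr_linear sZ sZ, of p m "n - p" "s - m"] by simp
qed

lemma kh_duality: "kh Z B p m = kh Z B (n - p) (s - m)"
  using dim_duality[of p m] dim_duality(1)[of "n - p" "s - m"] unfolding kh_def by simp

end

section \<open>The polynomial ring and graded free modules\<close>

abbreviation var_monom :: "'v \<Rightarrow> 'v \<Rightarrow>\<^sub>0 nat" where
  "var_monom v \<equiv> Poly_Mapping.single v 1"

definition poly_scale :: "'k \<Rightarrow> ('v::finite, 'k::field) polynomial \<Rightarrow> ('v, 'k) polynomial" where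
  "poly_scale c q = Poly_Mapping.single 0 c * q"

definition poly_var :: "'v \<Rightarrow> ('v::finite, 'k::field) polynomial \<Rightarrow> ('v, 'k) polynomial" where
  "poly_var v q = Poly_Mapping.single (var_monom v) 1 * q"

definition free_scale :: "'k \<Rightarrow> ('b \<Rightarrow>\<^sub>0 ('v::finite, 'k::field) polynomial) \<Rightarrow> ('b \<Rightarrow>\<^sub>0 ('v, 'k) polynomial)" where
  "free_scale c x = smult (Poly_Mapping.single 0 c) x"

definition free_var :: "'v \<Rightarrow> ('b \<Rightarrow>\<^sub>0 ('v::finite, 'k::field) polynomial) \<Rightarrow> ('b \<Rightarrow>\<^sub>0 ('v, 'k) polynomial)" where
  "free_var v x = smult (Poly_Mapping.single (var_monom v) 1) x"

lemma smult_add: "smult c (x + y) = smult c x + smult c (y :: 'b \<Rightarrow>\<^sub>0 'a::comm_ring_1)"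
  by (rule poly_mapping_eqI) (simp add: lookup_smult lookup_add distrib_left)

lemma smult_add_left: "smult (c + d) x = smult c x + smult d (x :: 'b \<Rightarrow>\<^sub>0 'a::comm_ring_1)"
  by (rule poly_mapping_eqI) (simp add: lookup_smult lookup_add distrib_right)

lemma smult_smult: "smult c (smult d x) = smult (c * d) (x :: 'b \<Rightarrow>\<^sub>0 'a::comm_ring_1)"
  by (rule poly_mapping_eqI) (simp add: lookup_smult mult.assoc)

lemma smult_one: "smult 1 x = (x :: 'b \<Rightarrow>\<^sub>0 'a::comm_ring_1)"
  by (rule poly_mapping_eqI) (simp add: lookup_smult)

lemma smult_zero: "smult c 0 = (0 :: 'b \<Rightarrow>\<^sub>0 'a::comm_ring_1)" "smult 0 x = (0 :: 'b \<Rightarrow>\<^sub>0 'a::comm_ring_1)"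
  by (rule poly_mapping_eqI, simp add: lookup_smult)+

lemma smult_sum: "smult c (sum f A) = (\<Sum>i\<in>A. smult c (f i :: 'b \<Rightarrow>\<^sub>0 'a::comm_ring_1))"
  by (induction A rule: infinite_finite_induct) (simp_all add: smult_zero smult_add)

lemma const_mult: "Poly_Mapping.single 0 c * Poly_Mapping.single 0 d = Poly_Mapping.single (0 :: 'v \<Rightarrow>\<^sub>0 nat) (c * d :: 'k::field)"
  by (simp add: mult_single)

global_interpretation pol: poly_space poly_scale "poly_var :: 'v::finite \<Rightarrow> ('v, 'k::field) polynomial \<Rightarrow> _"
proof unfold_locales
  fix a b :: 'k and x y :: "('v, 'k) polynomial" and u v :: 'v
  show "poly_scale a (x + y) = poly_scale a x + poly_scale a y" by (simp add: poly_scale_def distrib_left)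
  show "poly_scale (a + b) x = poly_scale a x + poly_scale b x" by (simp add: poly_scale_def single_add distrib_right)
  show "poly_scale a (poly_scale b x) = poly_scale (a * b) x"
    by (simp add: poly_scale_def const_mult flip: mult.assoc)
  show "poly_scale 1 x = x" by (simp add: poly_scale_def)
  show "poly_var v (x + y) = poly_var v x + poly_var v y" by (simp add: poly_var_def distrib_left)
  show "poly_var v (poly_scale a x) = poly_scale a (poly_var v x)"
    by (simp add: poly_var_def poly_scale_def mult.left_commute)
  show "poly_var u (poly_var v x) = poly_var v (poly_var u x)"
    by (simp add: poly_var_def mult.left_commute)
qed

global_interpretation fre: poly_space free_scale "free_var :: 'v::finite \<Rightarrow> ('b \<Rightarrow>\<^sub>0 ('v, 'k::field) polynomial) \<Rightarrow> _"
proof unfold_locales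
  fix a b :: 'k and x y :: "'b \<Rightarrow>\<^sub>0 ('v, 'k) polynomial" and u v :: 'v
  show "free_scale a (x + y) = free_scale a x + free_scale a y" by (simp add: free_scale_def smult_add)
  show "free_scale (a + b) x = free_scale a x + free_scale b x" by (simp add: free_scale_def single_add smult_add_left)
  show "free_scale a (free_scale b x) = free_scale (a * b) x" by (simp add: free_scale_def smult_smult const_mult)
  show "free_scale 1 x = x" by (simp add: free_scale_def smult_one)
  show "free_var v (x + y) = free_var v x + free_var v y" by (simp add: free_var_def smult_add)
  show "free_var v (free_scale a x) = free_scale a (free_var v x)"
    by (simp add: free_var_def free_scale_def smult_smult mult.commute)
  show "free_var u (free_var v x) = free_var v (free_var u x)"
    by (simp add: free_var_def smult_smult mult.commute)
qed

lemma monomial_degree_add: "monomial_degree (a + b) = monomial_degree a + monomial_degree b"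
  by (simp add: monomial_degree_def lookup_add sum.distrib)

lemma monomial_degree_var: "monomial_degree (var_monom v) = 1"
  by (simp add: monomial_degree_def lookup_single when_def)

lemma finite_monomials: "finite {a :: 'v::finite \<Rightarrow>\<^sub>0 nat. monomial_degree a \<le> d}"
proof -
  have "Poly_Mapping.lookup a v \<le> d" if "monomial_degree a \<le> d" for a :: "'v \<Rightarrow>\<^sub>0 nat" and v
    using member_le_sum[of v UNIV "Poly_Mapping.lookup a"] that by (simp add: monomial_degree_def)
  then have "Poly_Mapping.lookup ` {a :: 'v \<Rightarrow>\<^sub>0 nat. monomial_degree a \<le> d} \<subseteq> PiE UNIV (\<lambda>_. {..d})"
    by auto
  then have "finite (Poly_Mapping.lookup ` {a :: 'v \<Rightarrow>\<^sub>0 nat. monomial_degree a \<le> d})"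
    by (rule finite_subset) (simp add: finite_PiE)
  then show ?thesis by (rule finite_imageD) (simp add: inj_on_def poly_mapping.lookup_inject)
qed

text \<open>\<open>homog\<close> with integer degrees, so that the graded pieces form a family in
  the sense of \<open>pol.graded\<close>; the piece is zero in negative degrees.
  \<open>free_comp\<close> does the same for \<open>free_component\<close>.\<close>

definition hom_comp :: "int \<Rightarrow> ('v::finite, 'k::field) polynomial set" where
  "hom_comp m = {q. \<forall>a. Poly_Mapping.lookup q a \<noteq> 0 \<longrightarrow> int (monomial_degree a) = m}"

lemma hom_comp_homog: "hom_comp (int d) = homog d"
  by (auto simp: hom_comp_def homog_def in_keys_iff)

definition free_comp :: "(nat \<Rightarrow> nat) \<Rightarrow> int \<Rightarrow> ((nat \<times> nat) \<Rightarrow>\<^sub>0 ('v::finite, 'k::field) polynomial) set" where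
  "free_comp r m = {x. \<forall>d s a. Poly_Mapping.lookup (Poly_Mapping.lookup x (d, s)) a \<noteq> 0 \<longrightarrow>
     s < r d \<and> int (monomial_degree a) + int d = m}"

lemma lookup_nonzero:
  fixes x :: "'a \<Rightarrow>\<^sub>0 'b \<Rightarrow>\<^sub>0 'c::zero"
  shows "Poly_Mapping.lookup x b \<noteq> 0 \<longleftrightarrow> (\<exists>a. Poly_Mapping.lookup (Poly_Mapping.lookup x b) a \<noteq> 0)"
proof -
  have "q \<noteq> 0 \<longleftrightarrow> (\<exists>a. Poly_Mapping.lookup q a \<noteq> 0)" for q :: "'b \<Rightarrow>\<^sub>0 'c"
    by (auto intro: poly_mapping_eqI)
  then show ?thesis .
qed

lemma free_comp_free_component:
  "free_comp r (int j) = (free_component r j :: ((nat \<times> nat) \<Rightarrow>\<^sub>0 ('v::finite, 'k::field) polynomial) set)"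
proof -
  have "x \<in> free_comp r (int j) \<longleftrightarrow> x \<in> free_component r j" for x :: "(nat \<times> nat) \<Rightarrow>\<^sub>0 ('v, 'k) polynomial"
  proof
    assume x: "x \<in> free_comp r (int j)"
    have "s < r d \<and> d \<le> j \<and> Poly_Mapping.lookup x (d, s) \<in> homog (j - d)" if "(d, s) \<in> Poly_Mapping.keys x" for d s
    proof -
      obtain a where "Poly_Mapping.lookup (Poly_Mapping.lookup x (d, s)) a \<noteq> 0"
        using \<open>(d, s) \<in> Poly_Mapping.keys x\<close> unfolding in_keys_iff lookup_nonzero by blast
      then have "s < r d" "int (monomial_degree a) + int d = int j" using x by (auto simp: free_comp_def)
      moreover have "Poly_Mapping.lookup x (d, s) \<in> homog (j - d)"
        using x by (fastforce simp: free_comp_def homog_def in_keys_iff)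
      ultimately show ?thesis by simp
    qed
    then show "x \<in> free_component r j" unfolding free_component_def free_module_def by auto
  next
    assume x: "x \<in> free_component r j"
    show "x \<in> free_comp r (int j)"
      unfolding free_comp_def
    proof (intro CollectI allI impI)
      fix d s a assume a: "Poly_Mapping.lookup (Poly_Mapping.lookup x (d, s)) a \<noteq> 0"
      then have "(d, s) \<in> Poly_Mapping.keys x" unfolding in_keys_iff lookup_nonzero by blast
      then have "s < r d" "d \<le> j" "Poly_Mapping.lookup x (d, s) \<in> homog (j - d)"
        using x unfolding free_component_def free_module_def by auto
      then show "s < r d \<and> int (monomial_degree a) + int d = int j" using a by (auto simp: homog_def in_keys_iff)
    qed
  qed
  then show ?thesis by blast
qed

lemma free_comp_module: "free_comp r m \<subseteq> free_module r"
proof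
  fix x assume x: "x \<in> free_comp r m"
  have "s < r d" if "(d, s) \<in> Poly_Mapping.keys x" for d s
    using that x unfolding in_keys_iff lookup_nonzero free_comp_def by blast
  then show "x \<in> free_module r" by (auto simp: free_module_def)
qed

lemma poly_mapping_sum_single: "x = (\<Sum>b\<in>Poly_Mapping.keys x. Poly_Mapping.single b (Poly_Mapping.lookup x b))"
proof (rule poly_mapping_eqI)
  fix k
  have "Poly_Mapping.lookup (\<Sum>b\<in>Poly_Mapping.keys x. Poly_Mapping.single b (Poly_Mapping.lookup x b)) k =
      (\<Sum>b\<in>Poly_Mapping.keys x. if b = k then Poly_Mapping.lookup x b else 0)"
    by (simp add: lookup_sum lookup_single when_def)
  then show "Poly_Mapping.lookup x k = Poly_Mapping.lookup (\<Sum>b\<in>Poly_Mapping.keys x. Poly_Mapping.single b (Poly_Mapping.lookup x b)) k"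
    by (simp add: in_keys_iff)
qed

lemma lookup_mult_single:
  fixes q :: "('v, 'k::field) polynomial"
  shows "Poly_Mapping.lookup (Poly_Mapping.single e c * q) a = c * Sum_any (\<lambda>b. Poly_Mapping.lookup q b when a = e + b)"
proof -
  have "Poly_Mapping.lookup (Poly_Mapping.single e c * q) a =
      Sum_any (\<lambda>l. (c * Sum_any (\<lambda>b. Poly_Mapping.lookup q b when a = l + b)) when e = l)"
    by (simp only: lookup_mult lookup_single when_mult)
  also have "\<dots> = Sum_any (\<lambda>l. if e = l then c * Sum_any (\<lambda>b. Poly_Mapping.lookup q b when a = e + b) else 0)"
    by (rule arg_cong[where f = Sum_any]) (auto simp: when_def)
  also have "\<dots> = c * Sum_any (\<lambda>b. Poly_Mapping.lookup q b when a = e + b)"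
    using Sum_any_when_equal'[of "\<lambda>_. c * Sum_any (\<lambda>b. Poly_Mapping.lookup q b when a = e + b)" e]
    by (simp add: when_def)
  finally show ?thesis .
qed

lemma lookup_poly_scale: "Poly_Mapping.lookup (poly_scale c q) a = c * Poly_Mapping.lookup q a"
  unfolding poly_scale_def lookup_mult_single by simp

lemma lookup_poly_var:
  "Poly_Mapping.lookup (poly_var v q) a =
    (if Poly_Mapping.lookup a v > 0 then Poly_Mapping.lookup q (a - var_monom v) else 0)"
proof (cases "Poly_Mapping.lookup a v > 0")
  case True
  have "a = var_monom v + b \<longleftrightarrow> b = a - var_monom v" for b
  proof
    assume "b = a - var_monom v"
    then show "a = var_monom v + b"
      using True by (intro poly_mapping_eqI) (auto simp: lookup_add lookup_minus lookup_single when_def)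
  qed simp
  then show ?thesis using True unfolding poly_var_def lookup_mult_single
    by (simp del: One_nat_def)
next
  case False
  then have "a \<noteq> var_monom v + b" for b
    by (metis add_gr_0 less_one lookup_add lookup_single_eq)
  then show ?thesis using False unfolding poly_var_def lookup_mult_single by simp
qed

abbreviation coef :: "('b \<Rightarrow>\<^sub>0 ('v \<Rightarrow>\<^sub>0 nat) \<Rightarrow>\<^sub>0 'k::zero) \<Rightarrow> 'b \<Rightarrow> ('v \<Rightarrow>\<^sub>0 nat) \<Rightarrow> 'k" where
  "coef x b a \<equiv> Poly_Mapping.lookup (Poly_Mapping.lookup x b) a"

lemma coef_eqI: "(\<And>b a. coef x b a = coef y b a) \<Longrightarrow> x = y"
  by (intro poly_mapping_eqI)

lemma coef_free_scale: "coef (free_scale c x) b a = c * coef x b a"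
  using lookup_poly_scale[of c "Poly_Mapping.lookup x b" a] by (simp add: free_scale_def lookup_smult poly_scale_def)

lemma coef_free_var:
  "coef (free_var v x) b a = (if Poly_Mapping.lookup a v > 0 then coef x b (a - var_monom v) else 0)"
  using lookup_poly_var[of v "Poly_Mapping.lookup x b" a] by (simp add: free_var_def lookup_smult poly_var_def)

lemma coef_add: "coef (x + y) b a = coef x b a + coef y b a"
  by (simp add: lookup_add)

lemma coef_sum: "coef (sum f A) b a = (\<Sum>i\<in>A. coef (f i) b a)"
  by (induction A rule: infinite_finite_induct) (simp_all add: lookup_add)

lemma monomial_degree_diff_var:
  "Poly_Mapping.lookup a v > 0 \<Longrightarrow> int (monomial_degree (a - var_monom v)) = int (monomial_degree a) - 1"
proof -
  assume "Poly_Mapping.lookup a v > 0"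
  then have "a = (a - var_monom v) + var_monom v"
    by (intro poly_mapping_eqI) (auto simp: lookup_add lookup_minus lookup_single when_def)
  then have "monomial_degree a = monomial_degree (a - var_monom v) + 1"
    by (metis monomial_degree_add monomial_degree_var)
  then show ?thesis by simp
qed

lemma graded_hom_comp: "pol.graded (hom_comp :: int \<Rightarrow> ('v::finite, 'k::field) polynomial set)"
  unfolding pol.graded_def
proof (intro allI conjI ballI)
  fix m
  show "pol.subspace (hom_comp m :: ('v, 'k) polynomial set)"
    unfolding pol.subspace_def hom_comp_def by (auto simp: lookup_add lookup_poly_scale) (metis add_0)
  let ?B = "(\<lambda>a. Poly_Mapping.single a (1 :: 'k)) ` {a :: 'v \<Rightarrow>\<^sub>0 nat. monomial_degree a \<le> nat m}"
  have "q \<in> pol.span ?B" if "q \<in> hom_comp m" for q :: "('v, 'k) polynomial"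
  proof -
    have "q = (\<Sum>a\<in>Poly_Mapping.keys q. poly_scale (Poly_Mapping.lookup q a) (Poly_Mapping.single a 1))"
      unfolding poly_scale_def mult_single by (simp flip: poly_mapping_sum_single)
    also have "\<dots> \<in> pol.span ?B"
      using that by (intro pol.span_sum pol.span_scale pol.span_base) (auto simp: hom_comp_def in_keys_iff)
    finally show ?thesis .
  qed
  then show "pol.fin_dim (hom_comp m :: ('v, 'k) polynomial set)"
    unfolding pol.fin_dim_def using finite_monomials[of "nat m", where 'v = 'v] by (intro exI[of _ ?B]) auto
  fix v and x :: "('v, 'k) polynomial" assume "x \<in> hom_comp m"
  then show "poly_var v x \<in> hom_comp (m + 1)"
    using monomial_degree_diff_var[of _ v] by (fastforce simp: hom_comp_def lookup_poly_var)
qed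

lemma graded_free_comp: "fre.graded (free_comp r :: int \<Rightarrow> ((nat \<times> nat) \<Rightarrow>\<^sub>0 ('v::finite, 'k::field) polynomial) set)"
  unfolding fre.graded_def
proof (intro allI conjI ballI)
  fix m
  show "fre.subspace (free_comp r m :: ((nat \<times> nat) \<Rightarrow>\<^sub>0 ('v, 'k) polynomial) set)"
    unfolding fre.subspace_def free_comp_def by (auto simp: coef_add coef_free_scale) (metis add_0)+
  let ?I = "SIGMA d:{..nat m}. {..<r d}" and ?M = "{a :: 'v \<Rightarrow>\<^sub>0 nat. monomial_degree a \<le> nat m}"
  let ?B = "(\<lambda>(b, a). Poly_Mapping.single b (Poly_Mapping.single a (1 :: 'k))) ` (?I \<times> ?M)"
  have fin: "finite ?B" using finite_monomials by (intro finite_imageI finite_cartesian_product) auto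
  have "x \<in> fre.span ?B" if x: "x \<in> free_comp r m" for x :: "(nat \<times> nat) \<Rightarrow>\<^sub>0 ('v, 'k) polynomial"
  proof -
    have "x = (\<Sum>b\<in>Poly_Mapping.keys x. \<Sum>a\<in>Poly_Mapping.keys (Poly_Mapping.lookup x b).
        free_scale (coef x b a) (Poly_Mapping.single b (Poly_Mapping.single a 1)))"
    proof -
      have "free_scale c (Poly_Mapping.single b q) = Poly_Mapping.single b (poly_scale c q)"
        for c and b :: "nat \<times> nat" and q :: "('v, 'k) polynomial"
        by (rule poly_mapping_eqI) (simp add: free_scale_def lookup_smult lookup_single poly_scale_def when_def)
      moreover have "(\<Sum>a\<in>A. Poly_Mapping.single b (h a)) = Poly_Mapping.single b (sum h A)"
        for A and b :: "nat \<times> nat" and h :: "('v \<Rightarrow>\<^sub>0 nat) \<Rightarrow> ('v, 'k) polynomial"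
        by (induction A rule: infinite_finite_induct) (simp_all add: single_add)
      moreover have "(\<Sum>a\<in>Poly_Mapping.keys q. poly_scale (Poly_Mapping.lookup q a) (Poly_Mapping.single a 1)) = q"
        for q :: "('v, 'k) polynomial"
        unfolding poly_scale_def mult_single by (simp flip: poly_mapping_sum_single)
      ultimately show ?thesis by (simp flip: poly_mapping_sum_single)
    qed
    also have "\<dots> \<in> fre.span ?B"
    proof (intro fre.span_sum fre.span_scale fre.span_base)
      fix b a assume "b \<in> Poly_Mapping.keys x" "a \<in> Poly_Mapping.keys (Poly_Mapping.lookup x b)"
      moreover obtain d s where "b = (d, s)" by fastforce
      ultimately have "s < r d" "int (monomial_degree a) + int d = m" using x by (auto simp: free_comp_def in_keys_iff)
      then show "Poly_Mapping.single b (Poly_Mapping.single a 1) \<in> ?B" using \<open>b = (d, s)\<close> by force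
    qed
    finally show ?thesis .
  qed
  then show "fre.fin_dim (free_comp r m :: ((nat \<times> nat) \<Rightarrow>\<^sub>0 ('v, 'k) polynomial) set)"
    unfolding fre.fin_dim_def using fin by (intro exI[of _ ?B]) auto
  fix v and x :: "(nat \<times> nat) \<Rightarrow>\<^sub>0 ('v, 'k) polynomial" assume "x \<in> free_comp r m"
  then show "free_var v x \<in> free_comp r (m + 1)"
    using monomial_degree_diff_var[of _ v] by (fastforce simp: free_comp_def coef_free_var)
qed

section \<open>Acyclicity of free modules\<close>

definition least_var :: "'v::finite set \<Rightarrow> 'v" where
  "least_var S = (SOME w. w \<in> S \<and> (\<forall>u\<in>S. var_index w \<le> var_index u))"

lemma least_var:
  assumes "S \<noteq> {}"
  shows "least_var S \<in> S" "u \<in> S \<Longrightarrow> var_index (least_var S) \<le> var_index u"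
proof -
  have "\<exists>w. w \<in> S \<and> (\<forall>u\<in>S. var_index w \<le> var_index u)"
    using ex_min_if_finite[of "var_index ` S"] assms by (auto simp: not_less)
  then have "least_var S \<in> S \<and> (\<forall>u\<in>S. var_index (least_var S) \<le> var_index u)"
    unfolding least_var_def by (rule someI_ex)
  then show "least_var S \<in> S" "u \<in> S \<Longrightarrow> var_index (least_var S) \<le> var_index u" by auto
qed

lemma var_index_antisym: "var_index u \<le> var_index v \<Longrightarrow> var_index v \<le> var_index u \<Longrightarrow> u = v"
  using inj_var_index by (meson injD le_antisym)

lemma least_var_eqI: "w \<in> S \<Longrightarrow> (\<And>u. u \<in> S \<Longrightarrow> var_index w \<le> var_index u) \<Longrightarrow> least_var S = w"
  using least_var[of S] by (intro var_index_antisym) auto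

definition bounded_below :: "'v::finite \<Rightarrow> ('v \<Rightarrow>\<^sub>0 nat) \<Rightarrow> bool" where
  "bounded_below v a \<longleftrightarrow> (\<forall>u. Poly_Mapping.lookup a u > 0 \<longrightarrow> var_index v \<le> var_index u)"

text \<open>Monomials with least variable \<open>v\<close> are divided by it and all others are sent
  to 0, so every monomial except 1 is treated by exactly one \<open>v\<close>. This serves both the
  homotopy for free modules and the decomposition of a polynomial into multiples of the
  variables.\<close>

definition poly_div :: "'v::finite \<Rightarrow> ('v, 'k::field) polynomial \<Rightarrow> ('v, 'k) polynomial" where
  "poly_div v q = Abs_poly_mapping (\<lambda>a. if bounded_below v a then Poly_Mapping.lookup q (a + var_monom v) else 0)"

lemma lookup_poly_div:
  "Poly_Mapping.lookup (poly_div v q) a = (if bounded_below v a then Poly_Mapping.lookup q (a + var_monom v) else 0)"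
proof -
  have "finite ((\<lambda>a. a + var_monom v) -` Poly_Mapping.keys q)"
    by (rule finite_vimageI) (auto simp: inj_on_def)
  then have "finite {a. (if bounded_below v a then Poly_Mapping.lookup q (a + var_monom v) else 0) \<noteq> 0}"
    by (rule finite_subset[rotated]) (auto simp: in_keys_iff)
  then show ?thesis unfolding poly_div_def by (subst lookup_Abs_poly_mapping) auto
qed

definition free_div :: "'v::finite \<Rightarrow> ('b \<Rightarrow>\<^sub>0 ('v, 'k::field) polynomial) \<Rightarrow> ('b \<Rightarrow>\<^sub>0 ('v, 'k) polynomial)" where
  "free_div v x = Poly_Mapping.map (poly_div v) x"

lemma coef_free_div: "coef (free_div v x) b a = (if bounded_below v a then coef x b (a + var_monom v) else 0)"
  by (simp add: free_div_def Poly_Mapping.map.rep_eq when_def lookup_poly_div)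

lemma free_div_zero: "free_div v 0 = 0"
  by (rule coef_eqI) (simp add: coef_free_div)

text \<open>
  The homotopy pairs basis elements of the Koszul complex: with \<open>v\<close> the least variable that divides \<open>x\<^sup>a\<close>
  or belongs to \<open>S\<close>, it sends \<open>x\<^sup>a e\<^sub>S\<close> to \<open>(x\<^sup>a / v) e\<^sub>T\<close>, where \<open>T\<close> is \<open>S\<close> with \<open>v\<close> added, if \<open>v\<close> is not in
  \<open>S\<close>, and to \<open>0\<close> otherwise. Only \<open>1 e\<^sub>\<emptyset>\<close> remains unpaired.
\<close>

definition contract :: "('v::finite set \<Rightarrow> 'b \<Rightarrow>\<^sub>0 ('v, 'k::field) polynomial) \<Rightarrow> 'v set \<Rightarrow> 'b \<Rightarrow>\<^sub>0 ('v, 'k) polynomial" where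
  "contract c S = (if S = {} then 0 else free_div (least_var S) (c (S - {least_var S})))"

lemma coef_contract:
  "coef (contract c S) b a = (if S \<noteq> {} \<and> bounded_below (least_var S) a
    then coef (c (S - {least_var S})) b (a + var_monom (least_var S)) else 0)"
  by (simp add: contract_def coef_free_div)

lemma coef_bd:
  "coef (fre.bd c T) b a = (\<Sum>v\<in>- T. if Poly_Mapping.lookup a v > 0
    then koszul_sign v T * coef (c (insert v T)) b (a - var_monom v) else 0)"
  unfolding fre.bd_def coef_sum coef_free_scale coef_free_var by (rule sum.cong) auto

lemma monom_diff_add: "Poly_Mapping.lookup a v > 0 \<Longrightarrow> a - var_monom v + var_monom v = a"
  by (intro poly_mapping_eqI) (auto simp: lookup_add lookup_minus lookup_single when_def)

text \<open>Let \<open>w\<close> be the least variable that divides x^a or lies in \<open>T\<close>.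
  If it lies in \<open>T\<close>, then \<open>contract (fre.bd c)\<close> returns the coefficient
  itself together with terms that cancel against \<open>fre.bd (contract c)\<close>. Otherwise
  \<open>contract (fre.bd c)\<close> vanishes there, and in \<open>fre.bd (contract c)\<close> only
  the summand of \<open>w\<close> survives. For x^a = 1 and \<open>T\<close> empty there is no such
  variable.\<close>

lemma contract_homotopy:
  fixes c :: "'v::finite set \<Rightarrow> 'b \<Rightarrow>\<^sub>0 ('v, 'k::field) polynomial"
  shows "coef (fre.bd (contract c) T + contract (fre.bd c) T) b a = (if T = {} \<and> a = 0 then 0 else coef (c T) b a)"
proof -
  let ?s = "{u. Poly_Mapping.lookup a u > 0}"
  define w where "w = least_var (?s \<union> T)"
  consider (E) "T = {}" "a = 0" | (A) "w \<in> T" | (B) "w \<notin> T" "w \<in> ?s"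
  proof (cases "?s \<union> T = {}")
    case True
    then have "a = 0" by (intro poly_mapping_eqI) auto
    then show ?thesis using True that by auto
  next
    case False
    then show ?thesis using least_var(1)[OF False] that by (auto simp: w_def)
  qed
  then show ?thesis
  proof cases
    case E
    then show ?thesis by (simp add: coef_add coef_bd coef_contract)
  next
    case A
    have low: "var_index w \<le> var_index u" if "u \<in> ?s \<union> T" for u
      unfolding w_def using that by (intro least_var) auto
    have lT: "least_var T = w" using A low by (intro least_var_eqI) auto
    have bw: "bounded_below w a" using low by (auto simp: bounded_below_def)
    define R where "R = T - {w}"
    have T: "T = insert w R" "w \<notin> R" "- R = insert w (- T)" "w \<notin> - T" using A by (auto simp: R_def)
    have 1: "coef (fre.bd (contract c) T) b a = (\<Sum>v\<in>- T. if Poly_Mapping.lookup a v > 0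
        then - koszul_sign v R * coef (c (insert v R)) b (a + var_monom w - var_monom v) else 0)"
      unfolding coef_bd
    proof (rule sum.cong)
      fix v assume v: "v \<in> - T"
      show "(if Poly_Mapping.lookup a v > 0 then koszul_sign v T * coef (contract c (insert v T)) b (a - var_monom v) else 0) =
        (if Poly_Mapping.lookup a v > 0 then - koszul_sign v R * coef (c (insert v R)) b (a + var_monom w - var_monom v) else 0)"
      proof (cases "Poly_Mapping.lookup a v > 0")
        case True
        have wv: "var_index w < var_index v" "w \<noteq> v"
          using low[of v] True v A var_index_antisym[of w v] by (auto simp: order.order_iff_strict)
        have "least_var (insert v T) = w" using A low True by (intro least_var_eqI) auto
        moreover have "insert v T - {w} = insert v R" using wv by (auto simp: R_def)
        moreover have "bounded_below w (a - var_monom v)"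
          using bw by (auto simp: bounded_below_def lookup_minus)
        moreover have "a - var_monom v + var_monom w = a + var_monom w - var_monom v"
          using True by (intro poly_mapping_eqI) (auto simp: lookup_add lookup_minus lookup_single when_def)
        moreover have "koszul_sign v T = (- koszul_sign v R :: 'k)"
          using wv T by (simp add: koszul_sign_insert)
        ultimately show ?thesis by (simp add: coef_contract)
      qed simp
    qed simp
    have 2: "coef (contract (fre.bd c) T) b a = coef (fre.bd c R) b (a + var_monom w)"
      using A bw lT by (auto simp: coef_contract R_def)
    have "koszul_sign w R = (1 :: 'k)"
    proof -
      have "{u \<in> R. var_index u < var_index w} = {}" using low by (auto simp: R_def not_less)
      then show ?thesis unfolding koszul_sign_def by (simp only: card.empty power_0)
    qed
    then have "coef (fre.bd c R) b (a + var_monom w) = coef (c T) b a + (\<Sum>v\<in>- T. if Poly_Mapping.lookup (a + var_monom w) v > 0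
        then koszul_sign v R * coef (c (insert v R)) b (a + var_monom w - var_monom v) else 0)"
      unfolding coef_bd T(3) using T(4) by (simp add: T(1) lookup_add)
    also have "(\<Sum>v\<in>- T. if Poly_Mapping.lookup (a + var_monom w) v > 0
        then koszul_sign v R * coef (c (insert v R)) b (a + var_monom w - var_monom v) else 0) =
      (\<Sum>v\<in>- T. if Poly_Mapping.lookup a v > 0
        then koszul_sign v R * coef (c (insert v R)) b (a + var_monom w - var_monom v) else 0)"
      using T(4) by (intro sum.cong) (auto simp: lookup_add lookup_single when_def)
    also have "\<dots> = - coef (fre.bd (contract c) T) b a"
      unfolding 1 sum_negf[symmetric] by (rule sum.cong) auto
    finally show ?thesis using 2 A by (auto simp: coef_add)
  next
    case B
    have low: "var_index w \<le> var_index u" if "u \<in> ?s \<union> T" for u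
      unfolding w_def using that by (intro least_var) auto
    have "coef (contract (fre.bd c) T) b a = 0"
    proof (cases "T = {}")
      case False
      have "least_var T \<noteq> w" using least_var(1)[OF False] B by auto
      then have "\<not> var_index (least_var T) \<le> var_index w"
        using low[of "least_var T"] least_var(1)[OF False] var_index_antisym by blast
      then have "\<not> bounded_below (least_var T) a" using B by (auto simp: bounded_below_def)
      then show ?thesis by (simp add: coef_contract)
    qed (simp add: coef_contract)
    moreover have "coef (fre.bd (contract c) T) b a = (\<Sum>v\<in>- T. if v = w then coef (c T) b a else 0)"
      unfolding coef_bd
    proof (rule sum.cong)
      fix v assume v: "v \<in> - T"
      show "(if Poly_Mapping.lookup a v > 0 then koszul_sign v T * coef (contract c (insert v T)) b (a - var_monom v) else 0) =
        (if v = w then coef (c T) b a else 0)"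
      proof (cases "v = w")
        case True
        have "least_var (insert w T) = w" using low B by (intro least_var_eqI) auto
        moreover have "bounded_below w (a - var_monom w)"
          using low by (auto simp: bounded_below_def lookup_minus)
        moreover have "koszul_sign w T = (1 :: 'k)"
        proof -
          have "{u \<in> T. var_index u < var_index w} = {}" using low by (auto simp: not_less)
          then show ?thesis unfolding koszul_sign_def by (simp only: card.empty power_0)
        qed
        moreover have "insert w T - {w} = T" using B by auto
        moreover have "a - var_monom w + var_monom w = a" using B by (intro monom_diff_add) auto
        ultimately show ?thesis using True B by (simp add: coef_contract)
      next
        case False
        let ?l = "least_var (insert v T)"
        \<comment> \<open>After division by \<open>v\<close> the monomial is still divisible by
          \<open>w\<close>, which precedes every element of \<open>insert v T\<close>; so
          \<open>contract\<close> is 0 there.\<close>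
        have "\<not> bounded_below ?l (a - var_monom v)" if "Poly_Mapping.lookup a v > 0"
        proof
          assume "bounded_below ?l (a - var_monom v)"
          moreover have "Poly_Mapping.lookup (a - var_monom v) w > 0"
            using B False by (simp add: lookup_minus lookup_single when_def)
          ultimately have "var_index ?l \<le> var_index w" by (auto simp: bounded_below_def)
          moreover have l: "?l \<in> insert v T" using least_var(1)[of "insert v T"] by auto
          then have "?l \<in> ?s \<union> T" using that by auto
          ultimately have "?l = w" using low var_index_antisym by metis
          then show False using l False B by auto
        qed
        then show ?thesis using False by (simp add: coef_contract)
      qed
    qed simp
    moreover have "a \<noteq> 0" using B by auto
    ultimately show ?thesis using B by (auto simp: coef_add)
  qed
qed

lemma free_div_comp: "x \<in> free_comp r m \<Longrightarrow> free_div v x \<in> free_comp r (m - 1)"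
  unfolding free_comp_def
proof (intro CollectI allI impI)
  fix d s a
  assume x: "x \<in> {x. \<forall>d s a. coef x (d, s) a \<noteq> 0 \<longrightarrow> s < r d \<and> int (monomial_degree a) + int d = m}"
    and "coef (free_div v x) (d, s) a \<noteq> 0"
  then have "coef x (d, s) (a + var_monom v) \<noteq> 0" by (auto simp: coef_free_div split: if_splits)
  then have "s < r d \<and> int (monomial_degree (a + var_monom v)) + int d = m" using x by blast
  then show "s < r d \<and> int (monomial_degree a) + int d = m - 1"
    using monomial_degree_var[of v] by (simp add: monomial_degree_add)
qed

lemma contract_chains:
  assumes "c \<in> fre.chains p (free_comp r m)"
  shows "contract c \<in> fre.chains (p + 1) (free_comp r (m - 1))"
proof (rule fre.chainsI)
  fix S :: "'a set"
  have card: "card S = Suc (card (S - {least_var S}))" if "S \<noteq> {}"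
    using card.remove[OF _ least_var(1)[OF that]] by simp
  show "contract c S \<in> free_comp r (m - 1)" if "int (card S) = p + 1"
  proof (cases "S = {}")
    case False
    then show ?thesis
      using that card fre.chains_on[OF assms, of "S - {least_var S}"] by (simp add: contract_def free_div_comp)
  qed (simp add: contract_def fre.gradedD(4)[OF graded_free_comp])
  show "contract c S = 0" if "int (card S) \<noteq> p + 1"
  proof (cases "S = {}")
    case False
    then show ?thesis
      using that card fre.chains_off[OF assms, of "S - {least_var S}"] by (simp add: contract_def free_div_zero)
  qed (simp add: contract_def)
qed

text \<open>A chain of positive degree has no coefficient at the empty set, the only place where the
  homotopy formula fails; so a cycle is the boundary of its contraction.\<close>

lemma free_acyclic:
  assumes "p \<ge> 1" "c \<in> fre.chains p (free_comp r m)" "fre.bd c = 0"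
  shows "\<exists>a\<in>fre.chains (p + 1) (free_comp r (m - 1)). c = fre.bd a"
proof
  show "contract c \<in> fre.chains (p + 1) (free_comp r (m - 1))" using assms(2) by (rule contract_chains)
  show "c = fre.bd (contract c)"
  proof (rule ext, rule coef_eqI)
    fix T b a
    have "c {} = 0" using fre.chains_off[OF assms(2), of "{}"] assms(1) by simp
    then show "coef (c T) b a = coef (fre.bd (contract c) T) b a"
      using contract_homotopy[of c T b a] assms(3) by (auto simp: coef_add coef_contract split: if_splits)
  qed
qed

text \<open>For \<open>x\<close> viewed as a chain of degree 0, the homotopy formula fails only at
  the constant terms; if these vanish, it writes \<open>x\<close> as a combination of multiples of
  the variables.\<close>

lemma irr_free_comp:
  "fre.irr (free_comp r (m - 1)) = {x \<in> free_comp r m. \<forall>b. coef x b 0 = (0 :: 'k::field)}"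
proof (intro subset_antisym subsetI)
  fix x :: "nat \<times> nat \<Rightarrow>\<^sub>0 ('v::finite, 'k) polynomial"
  assume x: "x \<in> fre.irr (free_comp r (m - 1))"
  then have "x \<in> free_comp r m" using fre.irr_graded[OF graded_free_comp, of r "m - 1"] by auto
  moreover have "coef x b 0 = 0" for b
    using x unfolding fre.irr_def by (auto simp: coef_sum coef_free_var)
  ultimately show "x \<in> {x \<in> free_comp r m. \<forall>b. coef x b 0 = 0}" by blast
next
  fix x :: "nat \<times> nat \<Rightarrow>\<^sub>0 ('v::finite, 'k) polynomial"
  assume x: "x \<in> {x \<in> free_comp r m. \<forall>b. coef x b 0 = 0}"
  let ?c = "\<lambda>S :: 'v set. if S = {} then x else 0"
  have c: "?c \<in> fre.chains 0 (free_comp r m)" using x by (intro fre.chains_0I) auto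
  have "fre.bd ?c = 0" using fre.chains_neg[OF _ fre.bd_graded[OF graded_free_comp c]] by simp
  have "x = fre.bd (contract ?c) {}"
  proof (rule coef_eqI)
    fix b a
    have "coef x b 0 = 0" using x by blast
    then show "coef x b a = coef (fre.bd (contract ?c) {}) b a"
      using contract_homotopy[of ?c "{}" b a] x by (auto simp: coef_add coef_contract split: if_splits)
  qed
  moreover have "contract ?c \<in> fre.chains 1 (free_comp r (m - 1))"
    using contract_chains[OF c] by simp
  ultimately show "x \<in> fre.irr (free_comp r (m - 1))"
    using fre.irr_eq fre.gradedD(4)[OF graded_free_comp] by blast
qed

section \<open>Homogeneous maps of free modules\<close>

definition hom_part :: "int \<Rightarrow> ('v::finite, 'k::field) polynomial \<Rightarrow> ('v, 'k) polynomial" where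
  "hom_part m q = Abs_poly_mapping (\<lambda>a. if int (monomial_degree a) = m then Poly_Mapping.lookup q a else 0)"

lemma lookup_hom_part:
  "Poly_Mapping.lookup (hom_part m q) a = (if int (monomial_degree a) = m then Poly_Mapping.lookup q a else 0)"
proof -
  have "finite {a. (if int (monomial_degree a) = m then Poly_Mapping.lookup q a else 0) \<noteq> 0}"
    by (rule finite_subset[OF _ finite_keys[of q]]) (auto simp: in_keys_iff)
  then show ?thesis unfolding hom_part_def by (subst lookup_Abs_poly_mapping) auto
qed

definition free_part :: "int \<Rightarrow> (nat \<times> nat \<Rightarrow>\<^sub>0 ('v::finite, 'k::field) polynomial) \<Rightarrow> (nat \<times> nat \<Rightarrow>\<^sub>0 ('v, 'k) polynomial)" where
  "free_part m x = Abs_poly_mapping (\<lambda>b. hom_part (m - int (fst b)) (Poly_Mapping.lookup x b))"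

lemma hom_part_zero: "hom_part m 0 = 0"
  by (rule poly_mapping_eqI) (simp add: lookup_hom_part)

lemma lookup_free_part: "Poly_Mapping.lookup (free_part m x) b = hom_part (m - int (fst b)) (Poly_Mapping.lookup x b)"
proof -
  have "finite {b. hom_part (m - int (fst b)) (Poly_Mapping.lookup x b) \<noteq> 0}"
    by (rule finite_subset[OF _ finite_keys[of x]]) (auto simp: in_keys_iff hom_part_zero)
  then show ?thesis unfolding free_part_def by (subst lookup_Abs_poly_mapping) auto
qed

lemma coef_free_part: "coef (free_part m x) b a = (if int (monomial_degree a) + int (fst b) = m then coef x b a else 0)"
  by (auto simp: lookup_free_part lookup_hom_part)

lemma hom_part_comp: "hom_part m q \<in> hom_comp m"
  by (simp add: hom_comp_def lookup_hom_part)

lemma hom_part_id: "q \<in> hom_comp m \<Longrightarrow> hom_part m' q = (if m' = m then q else 0)"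
  by (rule poly_mapping_eqI) (auto simp: hom_comp_def lookup_hom_part)

lemma hom_part_add: "hom_part m (p + q) = hom_part m p + hom_part m q"
  by (rule poly_mapping_eqI) (simp add: lookup_hom_part lookup_add)

lemma hom_part_diff: "hom_part m (p - q) = hom_part m p - hom_part m q"
  by (rule poly_mapping_eqI) (simp add: lookup_hom_part lookup_minus)

lemma hom_part_sum: "hom_part m (sum f A) = (\<Sum>i\<in>A. hom_part m (f i))"
  by (induction A rule: infinite_finite_induct) (simp_all add: hom_part_add hom_part_zero)

lemma hom_part_decomp: "q = (\<Sum>m\<in>(\<lambda>a. int (monomial_degree a)) ` Poly_Mapping.keys q. hom_part m q)"
  by (rule poly_mapping_eqI) (auto simp: lookup_sum lookup_hom_part in_keys_iff)

lemma free_part_comp: "x \<in> free_module r \<Longrightarrow> free_part m x \<in> free_comp r m"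
  unfolding free_comp_def
proof (intro CollectI allI impI)
  fix d s a assume x: "x \<in> free_module r" and a: "coef (free_part m x) (d, s) a \<noteq> 0"
  then have "coef x (d, s) a \<noteq> 0" "int (monomial_degree a) + int d = m"
    by (auto simp: coef_free_part split: if_splits)
  moreover from this have "(d, s) \<in> Poly_Mapping.keys x" by (auto simp: in_keys_iff)
  ultimately show "s < r d \<and> int (monomial_degree a) + int d = m" using x by (auto simp: free_module_def)
qed

lemma free_part_id: "x \<in> free_comp r m \<Longrightarrow> free_part m' x = (if m' = m then x else 0)"
proof (rule coef_eqI)
  fix b :: "nat \<times> nat" and a assume x: "x \<in> free_comp r m"
  obtain d s where "b = (d, s)" by fastforce
  then show "coef (free_part m' x) b a = coef (if m' = m then x else 0) b a"
    using x by (auto simp: free_comp_def coef_free_part)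
qed

lemma free_part_add: "free_part m (x + y) = free_part m x + free_part m y"
  by (rule coef_eqI) (simp add: coef_free_part coef_add)

lemma free_part_zero: "free_part m 0 = 0"
  by (rule coef_eqI) (simp add: coef_free_part)

lemma free_part_sum: "free_part m (sum f A) = (\<Sum>i\<in>A. free_part m (f i))"
  by (induction A rule: infinite_finite_induct) (simp_all add: free_part_add free_part_zero)

lemma free_part_decomp: "\<exists>M. finite M \<and> x = (\<Sum>m\<in>M. free_part m x)"
proof (intro exI conjI)
  let ?M = "(\<lambda>(b, a). int (monomial_degree a) + int (fst b)) `
    (SIGMA b:Poly_Mapping.keys x. Poly_Mapping.keys (Poly_Mapping.lookup x b))"
  show fin: "finite ?M" by simp
  show "x = (\<Sum>m\<in>?M. free_part m x)"
  proof (rule coef_eqI)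
    fix b a
    have "coef (\<Sum>m\<in>?M. free_part m x) b a = (\<Sum>m\<in>?M. if int (monomial_degree a) + int (fst b) = m then coef x b a else 0)"
      by (simp add: coef_sum coef_free_part)
    also have "\<dots> = (if int (monomial_degree a) + int (fst b) \<in> ?M then coef x b a else 0)"
      by (rule sum.delta'[OF fin])
    also have "\<dots> = coef x b a"
    proof (cases "coef x b a = 0")
      case False
      then have "b \<in> Poly_Mapping.keys x" "a \<in> Poly_Mapping.keys (Poly_Mapping.lookup x b)" by (auto simp: in_keys_iff)
      then have "int (monomial_degree a) + int (fst b) \<in> ?M" by force
      then show ?thesis by simp
    qed simp
    finally show "coef x b a = coef (\<Sum>m\<in>?M. free_part m x) b a" by simp
  qed
qed

lemma hom_comp_mult: "p \<in> hom_comp m \<Longrightarrow> q \<in> hom_comp k \<Longrightarrow> p * q \<in> hom_comp (m + k)"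
  unfolding hom_comp_def
proof (intro CollectI allI impI)
  fix a assume pq: "p \<in> {q. \<forall>a. Poly_Mapping.lookup q a \<noteq> 0 \<longrightarrow> int (monomial_degree a) = m}"
    "q \<in> {q. \<forall>a. Poly_Mapping.lookup q a \<noteq> 0 \<longrightarrow> int (monomial_degree a) = k}" "Poly_Mapping.lookup (p * q) a \<noteq> 0"
  then have "a \<in> Poly_Mapping.keys (p * q)" by (simp add: in_keys_iff)
  then obtain b c where "b \<in> Poly_Mapping.keys p" "c \<in> Poly_Mapping.keys q" "a = b + c"
    using keys_mult[of p q] by blast
  then show "int (monomial_degree a) = m + k" using pq by (auto simp: in_keys_iff monomial_degree_add)
qed

lemma hom_part_mult: "q \<in> hom_comp k \<Longrightarrow> hom_part m (p * q) = hom_part (m - k) p * q"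
proof -
  assume q: "q \<in> hom_comp k"
  let ?M = "(\<lambda>a. int (monomial_degree a)) ` Poly_Mapping.keys p"
  have "hom_part m (p * q) = (\<Sum>i\<in>?M. hom_part m (hom_part i p * q))"
    by (subst hom_part_decomp[of p]) (simp add: sum_distrib_right hom_part_sum)
  also have "\<dots> = (\<Sum>i\<in>?M. if i = m - k then hom_part i p * q else 0)"
    using hom_part_id[OF hom_comp_mult[OF hom_part_comp q]] by (intro sum.cong) auto
  also have "\<dots> = (if m - k \<in> ?M then hom_part (m - k) p * q else 0)" by simp
  also have "\<dots> = hom_part (m - k) p * q"
  proof (cases "m - k \<in> ?M")
    case False
    then have "hom_part (m - k) p = 0"
      by (intro poly_mapping_eqI) (auto simp: lookup_hom_part image_iff, metis in_keys_iff)
    then show ?thesis using False by simp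
  qed simp
  finally show ?thesis .
qed

lemma linear_ext_superset:
  assumes "finite K" "Poly_Mapping.keys x \<subseteq> K"
  shows "linear_ext D x = (\<Sum>b\<in>K. smult (Poly_Mapping.lookup x b) (D b :: 'c \<Rightarrow>\<^sub>0 'a::comm_ring_1))"
  unfolding linear_ext_def using assms
  by (intro sum.mono_neutral_left) (auto simp: in_keys_iff smult_zero)

lemma linear_ext_add: "linear_ext D (x + y) = linear_ext D x + linear_ext D (y :: 'b \<Rightarrow>\<^sub>0 'a::comm_ring_1)"
proof -
  let ?K = "Poly_Mapping.keys x \<union> Poly_Mapping.keys y"
  have "Poly_Mapping.keys (x + y) \<subseteq> ?K" by (rule keys_add)
  then show ?thesis
    using linear_ext_superset[of ?K x D] linear_ext_superset[of ?K y D] linear_ext_superset[of ?K "x + y" D]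
    by (simp add: lookup_add smult_add_left sum.distrib)
qed

lemma linear_ext_smult: "linear_ext D (smult c x) = smult c (linear_ext D (x :: 'b \<Rightarrow>\<^sub>0 'a::comm_ring_1))"
proof -
  have "Poly_Mapping.keys (smult c x) \<subseteq> Poly_Mapping.keys x" by (auto simp: in_keys_iff lookup_smult)
  then show ?thesis
    using linear_ext_superset[of "Poly_Mapping.keys x" "smult c x" D] linear_ext_superset[of "Poly_Mapping.keys x" x D]
    by (simp add: lookup_smult smult_sum smult_smult)
qed

lemma linear_ext_zero: "linear_ext D 0 = 0"
  by (simp add: linear_ext_def)

lemma linear_ext_sum: "linear_ext D (sum f A) = (\<Sum>i\<in>A. linear_ext D (f i :: 'b \<Rightarrow>\<^sub>0 'a::comm_ring_1))"
  by (induction A rule: infinite_finite_induct) (simp_all add: linear_ext_add linear_ext_zero)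

lemma linear_ext_single: "linear_ext D (Poly_Mapping.single b c) = smult c (D b :: 'c \<Rightarrow>\<^sub>0 'a::comm_ring_1)"
  by (cases "c = 0") (simp_all add: linear_ext_def smult_zero)

text \<open>The representative in Q of \<open>augmentation\<close>, before passing to the coset, so
  that homogeneous parts can be taken.\<close>

definition aug_map :: "('b \<Rightarrow> 'a) \<Rightarrow> ('b \<Rightarrow>\<^sub>0 'a::comm_ring_1) \<Rightarrow> 'a" where
  "aug_map e x = (\<Sum>b\<in>Poly_Mapping.keys x. Poly_Mapping.lookup x b * e b)"

lemma aug_map_superset:
  assumes "finite K" "Poly_Mapping.keys x \<subseteq> K"
  shows "aug_map e x = (\<Sum>b\<in>K. Poly_Mapping.lookup x b * e b)"
  unfolding aug_map_def using assms by (intro sum.mono_neutral_left) (auto simp: in_keys_iff)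

lemma aug_map_add: "aug_map e (x + y) = aug_map e x + aug_map e y"
proof -
  let ?K = "Poly_Mapping.keys x \<union> Poly_Mapping.keys y"
  have "Poly_Mapping.keys (x + y) \<subseteq> ?K" by (rule keys_add)
  then show ?thesis
    using aug_map_superset[of ?K x e] aug_map_superset[of ?K y e] aug_map_superset[of ?K "x + y" e]
    by (simp add: lookup_add distrib_right sum.distrib)
qed

lemma aug_map_smult: "aug_map e (smult c x) = c * aug_map e x"
proof -
  have "Poly_Mapping.keys (smult c x) \<subseteq> Poly_Mapping.keys x" by (auto simp: in_keys_iff lookup_smult)
  then show ?thesis
    using aug_map_superset[of "Poly_Mapping.keys x" "smult c x" e] aug_map_superset[of "Poly_Mapping.keys x" x e]
    by (simp add: lookup_smult sum_distrib_left mult.assoc)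
qed

lemma aug_map_zero: "aug_map e 0 = 0"
  by (simp add: aug_map_def)

lemma aug_map_sum: "aug_map e (sum f A) = (\<Sum>i\<in>A. aug_map e (f i))"
  by (induction A rule: infinite_finite_induct) (simp_all add: aug_map_add aug_map_zero)

lemma smult_free_comp:
  assumes "q \<in> hom_comp m" "x \<in> free_comp r k"
  shows "smult q x \<in> free_comp r (m + k)"
  unfolding free_comp_def
proof (intro CollectI allI impI)
  fix d s a assume a: "coef (smult q x) (d, s) a \<noteq> 0"
  have "Poly_Mapping.lookup x (d, s) \<in> hom_comp (k - int d)"
    using assms(2) by (force simp: free_comp_def hom_comp_def)
  then have "q * Poly_Mapping.lookup x (d, s) \<in> hom_comp (m + (k - int d))" using assms(1) hom_comp_mult by blast
  then have "int (monomial_degree a) + int d = m + k" using a by (auto simp: lookup_smult hom_comp_def)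
  moreover have "Poly_Mapping.lookup x (d, s) \<noteq> 0" using a by (auto simp: lookup_smult)
  then have "s < r d" using assms(2) unfolding lookup_nonzero free_comp_def by blast
  ultimately show "s < r d \<and> int (monomial_degree a) + int d = m + k" by simp
qed

lemma free_comp_lookup: "x \<in> free_comp r m \<Longrightarrow> Poly_Mapping.lookup x (d, s) \<in> hom_comp (m - int d)"
  by (force simp: free_comp_def hom_comp_def)

lemma free_comp_keys: "x \<in> free_comp r m \<Longrightarrow> (d, s) \<in> Poly_Mapping.keys x \<Longrightarrow> s < r d"
  using free_comp_module[of r m] by (auto simp: free_module_def)

definition homogeneous_matrix ::
    "(nat \<Rightarrow> nat) \<Rightarrow> (nat \<Rightarrow> nat) \<Rightarrow> (nat \<times> nat \<Rightarrow> (nat \<times> nat \<Rightarrow>\<^sub>0 ('v::finite, 'k::field) polynomial)) \<Rightarrow> bool" where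
  "homogeneous_matrix r r' D \<longleftrightarrow> (\<forall>d s. s < r d \<longrightarrow> D (d, s) \<in> free_component r' d)"

lemma linear_ext_free_comp:
  assumes "homogeneous_matrix r r' D" "x \<in> free_comp r m"
  shows "linear_ext D x \<in> free_comp r' m"
  unfolding linear_ext_def
proof (rule fre.subspace_sum[OF fre.gradedD(1)[OF graded_free_comp]])
  fix b assume b: "b \<in> Poly_Mapping.keys x"
  obtain d s where [simp]: "b = (d, s)" by fastforce
  have "D b \<in> free_comp r' (int d)"
    using assms(1) free_comp_keys[OF assms(2)] b by (auto simp: homogeneous_matrix_def free_comp_free_component)
  then show "smult (Poly_Mapping.lookup x b) (D b) \<in> free_comp r' m"
    using smult_free_comp[OF free_comp_lookup[OF assms(2), of d s], of "D b" r' "int d"] by simp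
qed

lemma free_part_linear_ext:
  assumes "homogeneous_matrix r r' D" "x \<in> free_module r"
  shows "free_part m (linear_ext D x) = linear_ext D (free_part m x)"
proof -
  obtain M where M: "finite M" "x = (\<Sum>i\<in>M. free_part i x)" using free_part_decomp by blast
  have *: "free_part m (linear_ext D (free_part i x)) = linear_ext D (free_part m (free_part i x))" for i
    using free_part_id[OF linear_ext_free_comp[OF assms(1) free_part_comp[OF assms(2)]], of m i]
      free_part_id[OF free_part_comp[OF assms(2)], of m i] by (simp add: linear_ext_zero)
  have "free_part m (linear_ext D (\<Sum>i\<in>M. free_part i x)) = linear_ext D (free_part m (\<Sum>i\<in>M. free_part i x))"
    by (simp only: linear_ext_sum free_part_sum *)
  then show ?thesis by (simp only: flip: M(2))
qed

lemma aug_map_hom_comp: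
  assumes "\<And>d s. s < r d \<Longrightarrow> e (d, s) \<in> homog d" "x \<in> free_comp r m"
  shows "aug_map e x \<in> hom_comp m"
  unfolding aug_map_def
proof (rule pol.subspace_sum[OF pol.gradedD(1)[OF graded_hom_comp]])
  fix b assume b: "b \<in> Poly_Mapping.keys x"
  obtain d s where [simp]: "b = (d, s)" by fastforce
  have "e b \<in> hom_comp (int d)"
    using assms(1) free_comp_keys[OF assms(2)] b by (auto simp: hom_comp_homog)
  then show "Poly_Mapping.lookup x b * e b \<in> hom_comp m"
    using hom_comp_mult[OF free_comp_lookup[OF assms(2), of d s], of "e b" "int d"] by simp
qed

lemma hom_part_aug_map:
  assumes "\<And>d s. s < r d \<Longrightarrow> e (d, s) \<in> homog d" "x \<in> free_module r"
  shows "hom_part m (aug_map e x) = aug_map e (free_part m x)"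
proof -
  obtain M where M: "finite M" "x = (\<Sum>i\<in>M. free_part i x)" using free_part_decomp by blast
  have *: "hom_part m (aug_map e (free_part i x)) = aug_map e (free_part m (free_part i x))" for i
    using hom_part_id[OF aug_map_hom_comp[OF assms(1) free_part_comp[OF assms(2)]], of m i]
      free_part_id[OF free_part_comp[OF assms(2)], of m i] by (simp add: aug_map_zero)
  have "hom_part m (aug_map e (\<Sum>i\<in>M. free_part i x)) = aug_map e (free_part m (\<Sum>i\<in>M. free_part i x))"
    by (simp only: aug_map_sum free_part_sum hom_part_sum *)
  then show ?thesis by (simp only: flip: M(2))
qed

lemma free_linear_ext: "Vector_Spaces.linear free_scale free_scale (linear_ext D)"
  by (simp add: Vector_Spaces.linear_iff fre.vector_space_axioms linear_ext_add linear_ext_smult free_scale_def)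

lemma free_var_linear_ext: "linear_ext D (free_var v x) = free_var v (linear_ext D x)"
  by (simp add: free_var_def linear_ext_smult)

lemma free_linear_aug_map: "Vector_Spaces.linear free_scale poly_scale (aug_map e)"
  by (simp add: Vector_Spaces.linear_iff fre.vector_space_axioms pol.vector_space_axioms aug_map_add aug_map_smult
    free_scale_def poly_scale_def)

lemma free_var_aug_map: "aug_map e (free_var v x) = poly_var v (aug_map e x)"
  by (simp add: free_var_def poly_var_def aug_map_smult)

text \<open>Reduction of a free module modulo the irrelevant ideal, that is, the map to its tensor
  product with the residue field.\<close>

definition residue_map :: "('b \<Rightarrow>\<^sub>0 ('v, 'k::field) polynomial) \<Rightarrow> 'b \<Rightarrow>\<^sub>0 'k" where
  "residue_map x = Poly_Mapping.map (\<lambda>q. Poly_Mapping.lookup q 0) x"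

lemma lookup_residue_map: "Poly_Mapping.lookup (residue_map x) b = coef x b 0"
  by (simp add: residue_map_def Poly_Mapping.map.rep_eq when_def)

lemma residue_map_add: "residue_map (x + y) = residue_map x + residue_map y"
  by (rule poly_mapping_eqI) (simp add: lookup_residue_map lookup_add)

lemma linear_residue_map: "Vector_Spaces.linear free_scale smult (residue_map :: ('b \<Rightarrow>\<^sub>0 ('v::finite, 'k::field) polynomial) \<Rightarrow> _)"
proof -
  have "residue_map (free_scale c x) = smult c (residue_map x)" for c and x :: "'b \<Rightarrow>\<^sub>0 ('v, 'k) polynomial"
    by (rule poly_mapping_eqI) (simp add: lookup_residue_map coef_free_scale lookup_smult)
  then show ?thesis
    by (simp add: Vector_Spaces.linear_iff fre.vector_space_axioms coordinate_space.vector_space_axioms residue_map_add)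
qed

lemma lookup_mult_0:
  "Poly_Mapping.lookup (p * q) 0 = Poly_Mapping.lookup p 0 * Poly_Mapping.lookup (q :: ('v, 'k::field) polynomial) 0"
proof -
  have z: "(0 :: 'v \<Rightarrow>\<^sub>0 nat) = a + b \<longleftrightarrow> a = 0 \<and> b = 0" for a b
  proof
    assume *: "0 = a + b"
    have "Poly_Mapping.lookup a v + Poly_Mapping.lookup b v = 0" for v
      using arg_cong[OF *, of "\<lambda>x. Poly_Mapping.lookup x v"] by (simp add: lookup_add)
    then show "a = 0 \<and> b = 0" by (auto intro!: poly_mapping_eqI)
  qed simp
  have "Poly_Mapping.lookup (Poly_Mapping.single a c * q) 0 = (if a = 0 then c * Poly_Mapping.lookup q 0 else 0)" for a c
    unfolding lookup_mult_single z by (simp add: when_def cong: if_cong)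
  then have "Poly_Mapping.lookup ((\<Sum>a\<in>K. Poly_Mapping.single a (g a)) * q) 0 = (\<Sum>a\<in>K. if a = 0 then g a * Poly_Mapping.lookup q 0 else 0)" for K g
    by (simp add: sum_distrib_right lookup_sum)
  from this[of "Poly_Mapping.lookup p" "Poly_Mapping.keys p"] show ?thesis
    by (simp add: in_keys_iff flip: poly_mapping_sum_single)
qed

text \<open>Taking constant terms is a ring homomorphism, so reduction intertwines the differential
  with the matrix of its constant terms.\<close>

lemma residue_map_linear_ext: "residue_map (linear_ext D x) = linear_ext (tensor_matrix D) (residue_map x)"
proof (rule poly_mapping_eqI)
  fix c
  have k: "Poly_Mapping.keys (residue_map x) \<subseteq> Poly_Mapping.keys x"
    by (auto simp: in_keys_iff lookup_residue_map)
  have "Poly_Mapping.lookup (linear_ext (tensor_matrix D) (residue_map x)) c =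
      (\<Sum>b\<in>Poly_Mapping.keys x. coef x b 0 * coef (D b) c 0)"
    unfolding linear_ext_superset[OF finite_keys k]
    by (simp add: lookup_sum lookup_smult lookup_residue_map tensor_matrix_def Poly_Mapping.map.rep_eq when_def
        if_distrib[of "\<lambda>x. _ * x"] cong: if_cong) (rule sum.cong, auto)
  then show "Poly_Mapping.lookup (residue_map (linear_ext D x)) c = Poly_Mapping.lookup (linear_ext (tensor_matrix D) (residue_map x)) c"
    by (simp add: lookup_residue_map linear_ext_def lookup_sum lookup_smult lookup_mult_0)
qed

text \<open>In an element of degree \<open>j\<close>, the coordinate on a generator of degree
  \<open>d\<close> has degree j - d; it has a constant term only for d = j.\<close>

lemma residue_map_component:
  "residue_map ` (free_comp r (int j) :: (nat \<times> nat \<Rightarrow>\<^sub>0 ('v::finite, 'k::field) polynomial) set) = tensor_component r j"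
proof (intro subset_antisym subsetI)
  fix v :: "nat \<times> nat \<Rightarrow>\<^sub>0 'k" assume "v \<in> residue_map ` (free_comp r (int j) :: (nat \<times> nat \<Rightarrow>\<^sub>0 ('v, 'k) polynomial) set)"
  then obtain x :: "nat \<times> nat \<Rightarrow>\<^sub>0 ('v, 'k) polynomial" where x: "x \<in> free_comp r (int j)" "v = residue_map x" by blast
  have "s < r d \<and> d = j" if "(d, s) \<in> Poly_Mapping.keys v" for d s
    using that x by (force simp: in_keys_iff lookup_residue_map free_comp_def monomial_degree_def)
  then show "v \<in> tensor_component r j" by (auto simp: tensor_component_def free_module_def)
next
  fix v :: "nat \<times> nat \<Rightarrow>\<^sub>0 'k" assume v: "v \<in> tensor_component r j"
  let ?x = "Poly_Mapping.map (Poly_Mapping.single 0) v :: nat \<times> nat \<Rightarrow>\<^sub>0 ('v, 'k) polynomial"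
  have c: "coef ?x b a = (if a = 0 then Poly_Mapping.lookup v b else 0)" for b a
    by (auto simp: Poly_Mapping.map.rep_eq when_def lookup_single)
  have "?x \<in> free_comp r (int j)"
    unfolding free_comp_def
  proof (intro CollectI allI impI)
    fix d s and a :: "'v \<Rightarrow>\<^sub>0 nat" assume "coef ?x (d, s) a \<noteq> 0"
    then have "a = 0" "(d, s) \<in> Poly_Mapping.keys v" unfolding c by (auto simp: in_keys_iff split: if_splits)
    then show "s < r d \<and> int (monomial_degree a) + int d = int j"
      using v by (auto simp: tensor_component_def free_module_def monomial_degree_def)
  qed
  moreover have "v = residue_map ?x" by (rule poly_mapping_eqI) (simp add: lookup_residue_map c)
  ultimately show "v \<in> residue_map ` (free_comp r (int j) :: (nat \<times> nat \<Rightarrow>\<^sub>0 ('v, 'k) polynomial) set)" by blast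
qed

section \<open>Tor as Koszul homology\<close>

global_interpretation fp: poly_space_pair
    free_scale "free_var :: 'v::finite \<Rightarrow> (nat \<times> nat \<Rightarrow>\<^sub>0 ('v, 'k::field) polynomial) \<Rightarrow> _" poly_scale poly_var ..

global_interpretation ff: poly_space_pair
    free_scale "free_var :: 'v::finite \<Rightarrow> (nat \<times> nat \<Rightarrow>\<^sub>0 ('v, 'k::field) polynomial) \<Rightarrow> _"
    free_scale "free_var :: 'v::finite \<Rightarrow> (nat \<times> nat \<Rightarrow>\<^sub>0 ('v, 'k::field) polynomial) \<Rightarrow> _" ..

global_interpretation coord: fd_space "smult :: 'k::field \<Rightarrow> ('b \<Rightarrow>\<^sub>0 'k) \<Rightarrow> _" ..

global_interpretation fc: fd_space_pair
    "free_scale :: 'k \<Rightarrow> (nat \<times> nat \<Rightarrow>\<^sub>0 ('v::finite, 'k::field) polynomial) \<Rightarrow> _" "smult :: 'k \<Rightarrow> (nat \<times> nat \<Rightarrow>\<^sub>0 'k) \<Rightarrow> _" ..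

definition homogeneous_ideal :: "('v::finite, 'k::field) polynomial set \<Rightarrow> bool" where
  "homogeneous_ideal G \<longleftrightarrow> 0 \<in> G \<and> (\<forall>p\<in>G. \<forall>q\<in>G. p + q \<in> G) \<and> (\<forall>p. \<forall>q\<in>G. p * q \<in> G) \<and> (\<forall>q\<in>G. \<forall>m. hom_part m q \<in> G)"

lemma homogeneous_idealD:
  assumes "homogeneous_ideal G"
  shows "0 \<in> G" "p \<in> G \<Longrightarrow> q \<in> G \<Longrightarrow> p + q \<in> G" "q \<in> G \<Longrightarrow> p * q \<in> G" "q \<in> G \<Longrightarrow> hom_part m q \<in> G"
    "q \<in> G \<Longrightarrow> - q \<in> G" "p \<in> G \<Longrightarrow> q \<in> G \<Longrightarrow> p - q \<in> G"
proof -
  show *: "0 \<in> G" "p \<in> G \<Longrightarrow> q \<in> G \<Longrightarrow> p + q \<in> G" "\<And>p q. q \<in> G \<Longrightarrow> p * q \<in> G" "q \<in> G \<Longrightarrow> hom_part m q \<in> G" for p q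
    using assms unfolding homogeneous_ideal_def by auto
  show **: "q \<in> G \<Longrightarrow> - q \<in> G" for q using *(3)[of q "- 1"] by simp
  show "p \<in> G \<Longrightarrow> q \<in> G \<Longrightarrow> p - q \<in> G" using *(2)[of p "- q"] **[of q] by simp
qed

definition ideal_comp :: "('v::finite, 'k::field) polynomial set \<Rightarrow> int \<Rightarrow> ('v, 'k) polynomial set" where
  "ideal_comp G m = G \<inter> hom_comp m"

lemma graded_ideal_comp: "homogeneous_ideal G \<Longrightarrow> pol.graded (ideal_comp G)"
  unfolding pol.graded_def
proof (intro allI conjI ballI)
  fix m assume G: "homogeneous_ideal G"
  note D = homogeneous_idealD[OF G] and g = pol.gradedD[OF graded_hom_comp]
  show "pol.subspace (ideal_comp G m)"
    using D g(1)[of m] by (auto simp: pol.subspace_def ideal_comp_def poly_scale_def)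
  show "pol.fin_dim (ideal_comp G m)"
    using g(2)[of m] by (rule pol.fin_dim_subset) (simp add: ideal_comp_def)
  show "poly_var v x \<in> ideal_comp G (m + 1)" if "x \<in> ideal_comp G m" for v x
    using that D(3) g(3)[of x m v] by (auto simp: ideal_comp_def poly_var_def)
qed

lemma coset_eq_iff: "homogeneous_ideal G \<Longrightarrow> p +o G = q +o G \<longleftrightarrow> p - q \<in> G"
proof
  assume G: "homogeneous_ideal G" and "p +o G = q +o G"
  then have "p \<in> q +o G" using homogeneous_idealD(1)[OF G] by (metis add.right_neutral set_plus_intro2)
  then show "p - q \<in> G" by (rule set_plus_imp_minus)
next
  assume G: "homogeneous_ideal G" and d: "p - q \<in> G"
  have "x \<in> a +o G" if "x \<in> b +o G" "b - a \<in> G" for a b x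
  proof (rule set_minus_imp_plus)
    have "x - b \<in> G" using that(1) by (rule set_plus_imp_minus)
    then have "(x - b) + (b - a) \<in> G" using that(2) homogeneous_idealD(2)[OF G] by blast
    then show "x - a \<in> G" by simp
  qed
  moreover have "q - p \<in> G" using homogeneous_idealD(5)[OF G d] by simp
  ultimately show "p +o G = q +o G" using d by blast
qed

lemma coset_eq_self_iff: "homogeneous_ideal G \<Longrightarrow> p +o G = G \<longleftrightarrow> p \<in> G"
  using coset_eq_iff[of G p 0] by simp

lemma augmentation_eq: "augmentation G e x = aug_map e x +o G"
  by (simp add: augmentation_def aug_map_def)

locale resolution =
  fixes G :: "('v::finite, 'k::field) polynomial set" and r :: "nat \<Rightarrow> nat \<Rightarrow> nat"
    and e :: "nat \<times> nat \<Rightarrow> ('v, 'k) polynomial"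
    and D :: "nat \<Rightarrow> nat \<times> nat \<Rightarrow> (nat \<times> nat \<Rightarrow>\<^sub>0 ('v, 'k) polynomial)"
  assumes G: "homogeneous_ideal G" and res: "graded_free_resolution G r e D"
begin

abbreviation F :: "nat \<Rightarrow> int \<Rightarrow> (nat \<times> nat \<Rightarrow>\<^sub>0 ('v, 'k) polynomial) set" where
  "F i \<equiv> free_comp (r i)"

abbreviation L :: "nat \<Rightarrow> (nat \<times> nat \<Rightarrow>\<^sub>0 ('v, 'k) polynomial) \<Rightarrow> (nat \<times> nat \<Rightarrow>\<^sub>0 ('v, 'k) polynomial)" where
  "L i \<equiv> linear_ext (D i)"

text \<open>The syzygies in F_i: the kernel of the map out of F_i, which for \<open>i = 0\<close> is
  the augmentation to Q/G.\<close>

definition N :: "nat \<Rightarrow> int \<Rightarrow> (nat \<times> nat \<Rightarrow>\<^sub>0 ('v, 'k) polynomial) set" where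
  "N i m = {x \<in> F i m. if i = 0 then aug_map e x \<in> G else L i x = 0}"

lemma e_hom: "s < r 0 d \<Longrightarrow> e (d, s) \<in> homog d"
  using res by (simp add: graded_free_resolution_def)

lemma D_hom: "homogeneous_matrix (r (Suc i)) (r i) (D (Suc i))"
  using res by (auto simp: graded_free_resolution_def homogeneous_matrix_def)

lemma aug_surj: "augmentation G e ` free_module (r 0) = range (\<lambda>q. q +o G)"
  using res by (simp add: graded_free_resolution_def)

lemma exact:
  "{x \<in> free_module (r i). if i = 0 then aug_map e x \<in> G else L i x = 0} = L (Suc i) ` free_module (r (Suc i))"
proof (cases i)
  case 0
  then show ?thesis using res coset_eq_self_iff[OF G] by (simp add: graded_free_resolution_def augmentation_eq)
next
  case (Suc k)
  then show ?thesis using res by (simp add: graded_free_resolution_def)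
qed

text \<open>Exactness is stated without regard to degrees. All maps preserve degree, so the
  homogeneous part of a preimage of a homogeneous element is again a preimage.\<close>

lemma N_image: "N i m = L (Suc i) ` F (Suc i) m"
proof (intro subset_antisym subsetI)
  fix x assume x: "x \<in> N i m"
  then have "x \<in> F i m" "x \<in> L (Suc i) ` free_module (r (Suc i))"
    using exact[of i] free_comp_module[of "r i" m] by (auto simp: N_def)
  then obtain y where y: "y \<in> free_module (r (Suc i))" "x = L (Suc i) y" by blast
  have "x = free_part m x" using free_part_id[OF \<open>x \<in> F i m\<close>, of m] by simp
  also have "\<dots> = L (Suc i) (free_part m y)" unfolding y(2) by (rule free_part_linear_ext[OF D_hom y(1)])
  finally show "x \<in> L (Suc i) ` F (Suc i) m" using free_part_comp[OF y(1)] by blast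
next
  fix x assume "x \<in> L (Suc i) ` F (Suc i) m"
  then obtain y where y: "y \<in> F (Suc i) m" "x = L (Suc i) y" by blast
  then have "x \<in> L (Suc i) ` free_module (r (Suc i))" using free_comp_module[of "r (Suc i)" m] by blast
  then have "if i = 0 then aug_map e x \<in> G else L i x = 0" unfolding exact[symmetric] by blast
  moreover have "x \<in> F i m" using linear_ext_free_comp[OF D_hom y(1)] y(2) by simp
  ultimately show "x \<in> N i m" by (simp add: N_def)
qed

lemma graded_N: "fre.graded (N i)"
  unfolding fre.graded_def
proof (intro allI conjI ballI)
  fix m
  note g = fre.gradedD[OF graded_free_comp[of "r (Suc i)"]]
  show "fre.subspace (N i m)"
    unfolding N_image by (rule fre.vv.subspace_image[OF free_linear_ext g(1)])
  show "fre.fin_dim (N i m)"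
    unfolding N_image by (rule fre.vv.fin_dim_image[OF free_linear_ext g(2)])
  show "free_var v x \<in> N i (m + 1)" if x: "x \<in> N i m" for v x
  proof -
    obtain y where y: "y \<in> F (Suc i) m" "x = L (Suc i) y" using x unfolding N_image by blast
    show ?thesis unfolding N_image y(2) free_var_linear_ext[symmetric] by (intro imageI g(3) y(1))
  qed
qed

lemma N_F: "N i m \<subseteq> F i m"
  by (auto simp: N_def)

sublocale ac: acyclic_module free_scale free_var "F i" "N i" for i
  by unfold_locales (simp_all add: graded_free_comp graded_N N_F free_acyclic)

lemma kh_aug: "pol.kh hom_comp (ideal_comp G) p m = fre.kh (F 0) (N 0) p m"
proof (rule fp.kh_transport[symmetric, OF free_linear_aug_map free_var_aug_map graded_free_comp graded_N
    graded_hom_comp graded_ideal_comp[OF G] N_F])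
  show "ideal_comp G m \<subseteq> hom_comp m" for m by (simp add: ideal_comp_def)
  show h: "aug_map e x \<in> hom_comp m" if "x \<in> F 0 m" for x m using aug_map_hom_comp[OF e_hom that] .
  show "aug_map e x \<in> ideal_comp G m \<longleftrightarrow> x \<in> N 0 m" if "x \<in> F 0 m" for x m
    using that h[OF that] by (simp add: ideal_comp_def N_def)
  show "\<exists>x\<in>F 0 m. y - aug_map e x \<in> ideal_comp G m" if y: "y \<in> hom_comp m" for y m
  proof -
    have "y +o G \<in> augmentation G e ` free_module (r 0)" unfolding aug_surj by blast
    then obtain x where x: "x \<in> free_module (r 0)" "y +o G = aug_map e x +o G"
      unfolding augmentation_eq by blast
    then have "hom_part m (y - aug_map e x) \<in> G" using coset_eq_iff[OF G] homogeneous_idealD(4)[OF G] by blast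
    moreover have "hom_part m (y - aug_map e x) = y - aug_map e (free_part m x)"
      using hom_part_id[OF y, of m] hom_part_aug_map[OF e_hom x(1)] by (simp add: hom_part_diff)
    ultimately show ?thesis
      using free_part_comp[OF x(1)] hom_part_comp[of m "y - aug_map e x"] unfolding ideal_comp_def by auto
  qed
qed

text \<open>Exactness makes F_(i+1)/N_(i+1) isomorphic to N_i, which brings the syzygy module back
  into the form that \<open>kh_syzygy\<close> treats.\<close>

lemma kh_image: "fre.kh (F (Suc i)) (N (Suc i)) p m = fre.kh (N i) (\<lambda>_. {0}) p m"
proof (rule ff.kh_transport[OF free_linear_ext free_var_linear_ext graded_free_comp graded_N graded_N fre.graded_zero N_F])
  show "{0} \<subseteq> N i m" for m using fre.gradedD(4)[OF graded_N] by simp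
  show "L (Suc i) x \<in> N i m" if "x \<in> F (Suc i) m" for x m using that unfolding N_image by blast
  show "L (Suc i) x \<in> {0} \<longleftrightarrow> x \<in> N (Suc i) m" if "x \<in> F (Suc i) m" for x m using that by (simp add: N_def)
  show "\<exists>x\<in>F (Suc i) m. y - L (Suc i) x \<in> {0}" if "y \<in> N i m" for y m using that unfolding N_image by auto
qed

text \<open>Dimension shifting: \<open>kh_syzygy\<close> and \<open>kh_image\<close> in turn replace
  a module by its first syzygy, with the total degree p + m preserved. The bound on \<open>k\<close>
  keeps every use of \<open>kh_syzygy\<close> in homological degree at least 2.\<close>

lemma kh_shift: "int k < p \<Longrightarrow> pol.kh hom_comp (ideal_comp G) p m = fre.kh (F k) (N k) (p - int k) (m + int k)"
proof (induction k)
  case (Suc k)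
  then have "pol.kh hom_comp (ideal_comp G) p m = fre.kh (F k) (N k) (p - int k) (m + int k)" by simp
  also have "\<dots> = fre.kh (N k) (\<lambda>_. {0}) (p - int k - 1) (m + int k + 1)"
    using Suc.prems by (intro ac.kh_syzygy) simp
  also have "\<dots> = fre.kh (F (Suc k)) (N (Suc k)) (p - int k - 1) (m + int k + 1)" by (simp only: kh_image)
  finally show ?case by (simp add: algebra_simps)
qed (simp add: kh_aug)

lemma residue_kernel:
  assumes "x \<in> F i m"
  shows "residue_map x = 0 \<longleftrightarrow> x \<in> fre.irr (F i (m - 1))"
proof -
  have "residue_map x = 0 \<longleftrightarrow> (\<forall>b. coef x b 0 = 0)"
    by (metis lookup_residue_map lookup_zero poly_mapping_eqI)
  then show ?thesis using assms unfolding irr_free_comp by blast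
qed

lemma boundaries_image: "tor_boundaries r D i j = residue_map ` N i (int j)"
proof -
  have "tor_boundaries r D i j = linear_ext (tensor_matrix (D (Suc i))) ` residue_map ` F (Suc i) (int j)"
    using residue_map_component[of "r (Suc i)" j, where 'v = 'v and 'k = 'k] by (simp add: tor_boundaries_def)
  then show ?thesis by (simp add: N_image image_image residue_map_linear_ext)
qed

lemma boundaries_subspace: "coordinate_space.subspace (tor_boundaries r D i j)" "coord.fin_dim (tor_boundaries r D i j)"
  unfolding boundaries_image
  by (rule fc.subspace_image[OF linear_residue_map fre.gradedD(1)[OF graded_N]],
      rule fc.fin_dim_image[OF linear_residue_map fre.gradedD(2)[OF graded_N]])

lemma tor_dim_int:
  assumes "tor_boundaries r D i j \<subseteq> tor_cycles r D i j" "coord.fin_dim (tor_cycles r D i j)"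
  shows "int (tor_dim r D i j) = int (coordinate_space.dim (tor_cycles r D i j)) - int (coordinate_space.dim (tor_boundaries r D i j))"
  using coord.dim_mono_fin_dim[OF assms(2,1)] by (simp add: tor_dim_def)

lemma residue_fin_dim: "coord.fin_dim (tensor_component (r i) j :: (nat \<times> nat \<Rightarrow>\<^sub>0 'k) set)"
  unfolding residue_map_component[where 'v = 'v, symmetric]
  by (rule fc.fin_dim_image[OF linear_residue_map fre.gradedD(2)[OF graded_free_comp]])

lemma tor_dim_0: "int (tor_dim r D 0 j) = pol.kh hom_comp (ideal_comp G) 0 (int j)"
proof -
  have cyc: "tor_cycles r D 0 j = residue_map ` F 0 (int j)"
    using residue_map_component[of "r 0" j, where 'v = 'v and 'k = 'k] by (simp add: tor_cycles_def)
  have sub: "tor_boundaries r D 0 j \<subseteq> tor_cycles r D 0 j"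
    unfolding boundaries_image cyc using N_F by blast
  have fin: "coord.fin_dim (tor_cycles r D 0 j)"
    using residue_fin_dim by (rule coord.fin_dim_subset) (auto simp: tor_cycles_def)
  let ?U = "{x + y |x y. x \<in> fre.irr (F 0 (int j - 1)) \<and> y \<in> N 0 (int j)}"
  note gF = fre.gradedD[OF graded_free_comp[of "r 0"]]
  have irr: "fre.irr (F 0 (int j - 1)) \<subseteq> F 0 (int j)"
    using fre.irr_graded[OF graded_free_comp, of "r 0" "int j - 1"] by simp
  have UF: "?U \<subseteq> F 0 (int j)"
    using irr N_F[of 0 "int j"] fre.subspace_add[OF gF(1)] by blast
  have "int (fre.dim (F 0 (int j))) - int (fre.dim ?U) =
      int (coordinate_space.dim (tor_cycles r D 0 j)) - int (coordinate_space.dim (tor_boundaries r D 0 j))"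
  proof (rule fc.dim_diff_eq_dim_diff[OF linear_residue_map gF(1,2) _ UF boundaries_subspace])
    show "fre.subspace ?U"
      by (intro fre.subspace_sums fre.subspace_irr(1) gF fre.gradedD(1)[OF graded_N])
    show "tor_cycles r D 0 j = {residue_map u + w |u w. u \<in> F 0 (int j) \<and> w \<in> tor_boundaries r D 0 j}"
    proof (intro subset_antisym subsetI)
      fix v assume "v \<in> tor_cycles r D 0 j"
      then obtain u where "u \<in> F 0 (int j)" "v = residue_map u" unfolding cyc by blast
      then show "v \<in> {residue_map u + w |u w. u \<in> F 0 (int j) \<and> w \<in> tor_boundaries r D 0 j}"
        using coordinate_space.subspace_0[OF boundaries_subspace(1)] by (intro CollectI exI[of _ u] exI[of _ 0]) simp
    next
      fix v assume "v \<in> {residue_map u + w |u w. u \<in> F 0 (int j) \<and> w \<in> tor_boundaries r D 0 j}"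
      then obtain u y where u: "v = residue_map u + residue_map y" "u \<in> F 0 (int j)" "y \<in> N 0 (int j)"
        unfolding boundaries_image by blast
      then have "u + y \<in> F 0 (int j)" using N_F[of 0 "int j"] fre.subspace_add[OF gF(1)] by blast
      then show "v \<in> tor_cycles r D 0 j" unfolding cyc u(1) by (simp flip: residue_map_add)
    qed
    fix u assume u: "u \<in> F 0 (int j)"
    show "residue_map u \<in> tor_boundaries r D 0 j \<longleftrightarrow> u \<in> ?U"
    proof
      assume "residue_map u \<in> tor_boundaries r D 0 j"
      then obtain y where y: "y \<in> N 0 (int j)" "residue_map u = residue_map y" unfolding boundaries_image by blast
      have "u - y \<in> F 0 (int j)" using u y N_F[of 0 "int j"] fre.subspace_diff[OF gF(1)] by blast
      moreover have "residue_map (u - y) = 0" using y(2) by (simp add: fc.linear_diff[OF linear_residue_map])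
      ultimately have "u - y \<in> fre.irr (F 0 (int j - 1))" using residue_kernel by blast
      moreover have "u = (u - y) + y" by simp
      ultimately show "u \<in> ?U" using y(1) by blast
    next
      assume "u \<in> ?U"
      then obtain x y where x: "x \<in> fre.irr (F 0 (int j - 1))" "y \<in> N 0 (int j)" "u = x + y" by blast
      have "residue_map x = 0" using x(1) residue_kernel irr by blast
      then show "residue_map u \<in> tor_boundaries r D 0 j"
        using x unfolding boundaries_image by (simp add: residue_map_add)
    qed
  qed
  then show ?thesis using tor_dim_int[OF sub fin] kh_aug[of 0 "int j"] ac.kh_syzygy_0[of 0 "int j"] by simp
qed

text \<open>Both sides are compared with U/U', where \<open>U\<close> consists of the elements whose
  image lies in x F_k and \<open>U'\<close> of those whose image lies in x N_k. The differential
  maps U/U' isomorphically onto the intersection of N_k and x F_k modulo x N_k, which is Koszul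
  homology by \<open>kh_syzygy_1\<close>; reduction maps U/U' isomorphically onto Tor.\<close>

lemma tor_dim_Suc: "int (tor_dim r D (Suc k) j) = pol.kh hom_comp (ideal_comp G) (int (Suc k)) (int j - int (Suc k))"
proof -
  let ?j = "int j" and ?I = "fre.irr (F k (int j - 1))" and ?J = "fre.irr (N k (int j - 1))"
  note gF = fre.gradedD[OF graded_free_comp[of "r (Suc k)"]] and gF' = fre.gradedD[OF graded_free_comp[of "r k"]]
    and gN = fre.gradedD[OF graded_N]
  note sI = fre.subspace_irr[OF gF'(1,2)] and sJ = fre.subspace_irr[OF gN(1,2)]
  define U where "U = {x \<in> F (Suc k) ?j. L (Suc k) x \<in> ?I}"
  define U' where "U' = {x \<in> F (Suc k) ?j. L (Suc k) x \<in> ?J}"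
  note lL = free_linear_ext[of "D (Suc k)"]
  have JI: "?J \<subseteq> ?I" using N_F by (rule fre.irr_mono)
  have sU: "fre.subspace U" "fre.fin_dim U" "fre.subspace U'" "U' \<subseteq> U"
  proof -
    show "fre.subspace U" "fre.subspace U'"
      using gF(1)[of ?j] sI(1)[of "?j - 1"] sJ(1)[of k "?j - 1"]
      by (auto simp: fre.subspace_def U_def U'_def linear_ext_add linear_ext_zero fre.vv.linear_scale[OF lL])
    show "fre.fin_dim U" using gF(2)[of ?j] by (rule fre.fin_dim_subset) (auto simp: U_def)
    show "U' \<subseteq> U" using JI by (auto simp: U_def U'_def)
  qed
  have JN: "?J \<subseteq> N k ?j" using fre.irr_graded[OF graded_N, of k "?j - 1"] by simp
  have 1: "int (fre.dim U) - int (fre.dim U') = int (fre.dim (N k ?j \<inter> ?I)) - int (fre.dim ?J)"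
  proof (rule fre.vv.dim_diff_eq_dim_diff[OF lL sU sJ])
    show "N k ?j \<inter> ?I = {L (Suc k) u + w |u w. u \<in> U \<and> w \<in> ?J}"
    proof (intro subset_antisym subsetI)
      fix x assume "x \<in> N k ?j \<inter> ?I"
      then obtain u where "u \<in> U" "x = L (Suc k) u" unfolding N_image U_def by blast
      then show "x \<in> {L (Suc k) u + w |u w. u \<in> U \<and> w \<in> ?J}"
        using fre.subspace_0[OF sJ(1)] by (intro CollectI exI[of _ u] exI[of _ 0]) simp
    next
      fix x assume "x \<in> {L (Suc k) u + w |u w. u \<in> U \<and> w \<in> ?J}"
      then obtain u w where u: "x = L (Suc k) u + w" "u \<in> U" "w \<in> ?J" by blast
      have "L (Suc k) u \<in> N k ?j" "L (Suc k) u \<in> ?I" using u(2) unfolding N_image U_def by blast+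
      moreover have "w \<in> N k ?j" "w \<in> ?I" using u(3) JN JI by blast+
      ultimately show "x \<in> N k ?j \<inter> ?I"
        unfolding u(1) using fre.subspace_add[OF gN(1)] fre.subspace_add[OF sI(1)] by blast
    qed
    show "L (Suc k) u \<in> ?J \<longleftrightarrow> u \<in> U'" if "u \<in> U" for u using that by (auto simp: U_def U'_def)
  qed
  have lres: "linear_ext (tensor_matrix (D (Suc k))) (residue_map x) = 0 \<longleftrightarrow> L (Suc k) x \<in> ?I" if "x \<in> F (Suc k) ?j" for x
    using residue_kernel[OF linear_ext_free_comp[OF D_hom that]] by (simp add: residue_map_linear_ext)
  have cyc: "tor_cycles r D (Suc k) j = residue_map ` U"
    unfolding tor_cycles_def residue_map_component[of "r (Suc k)" j, where 'v = 'v and 'k = 'k, symmetric]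
    using lres by (auto simp: U_def)
  have NU: "N (Suc k) ?j \<subseteq> U"
    using fre.subspace_0[OF sI(1)] by (auto simp: N_def U_def)
  have sub: "tor_boundaries r D (Suc k) j \<subseteq> tor_cycles r D (Suc k) j"
    unfolding boundaries_image cyc using NU by blast
  have fin: "coord.fin_dim (tor_cycles r D (Suc k) j)"
    unfolding cyc by (rule fc.fin_dim_image[OF linear_residue_map sU(2)])
  have 2: "int (fre.dim U) - int (fre.dim U') =
      int (coordinate_space.dim (tor_cycles r D (Suc k) j)) - int (coordinate_space.dim (tor_boundaries r D (Suc k) j))"
  proof (rule fc.dim_diff_eq_dim_diff[OF linear_residue_map sU boundaries_subspace])
    show "tor_cycles r D (Suc k) j = {residue_map u + w |u w. u \<in> U \<and> w \<in> tor_boundaries r D (Suc k) j}"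
    proof (intro subset_antisym subsetI)
      fix v assume "v \<in> tor_cycles r D (Suc k) j"
      then obtain u where "u \<in> U" "v = residue_map u" unfolding cyc by blast
      then show "v \<in> {residue_map u + w |u w. u \<in> U \<and> w \<in> tor_boundaries r D (Suc k) j}"
        using coordinate_space.subspace_0[OF boundaries_subspace(1)] by (intro CollectI exI[of _ u] exI[of _ 0]) simp
    next
      fix v assume "v \<in> {residue_map u + w |u w. u \<in> U \<and> w \<in> tor_boundaries r D (Suc k) j}"
      then obtain u y where u: "v = residue_map u + residue_map y" "u \<in> U" "y \<in> N (Suc k) ?j"
        unfolding boundaries_image by blast
      then have "u + y \<in> U" using NU fre.subspace_add[OF sU(1)] by blast
      then show "v \<in> tor_cycles r D (Suc k) j" unfolding cyc u(1) by (simp flip: residue_map_add)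
    qed
    fix u assume u: "u \<in> U"
    show "residue_map u \<in> tor_boundaries r D (Suc k) j \<longleftrightarrow> u \<in> U'"
    proof
      assume "residue_map u \<in> tor_boundaries r D (Suc k) j"
      then obtain y where y: "y \<in> N (Suc k) ?j" "residue_map u = residue_map y" unfolding boundaries_image by blast
      have "u - y \<in> F (Suc k) ?j"
        using u y N_F[of "Suc k" ?j] fre.subspace_diff[OF gF(1)] unfolding U_def by blast
      moreover have "residue_map (u - y) = 0" using y(2) by (simp add: fc.linear_diff[OF linear_residue_map])
      ultimately have "u - y \<in> fre.irr (F (Suc k) (?j - 1))" using residue_kernel by blast
      \<comment> \<open>The differential carries x F_(k+1) into x N_k and kills the syzygy
        \<open>y\<close>, so the image of \<open>u\<close> lies in x N_k.\<close>
      then obtain z where z: "u - y = (\<Sum>v\<in>UNIV. free_var v (z v))" "\<And>v. z v \<in> F (Suc k) (?j - 1)"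
        unfolding fre.irr_def by blast
      have "L (Suc k) u = L (Suc k) (u - y) + L (Suc k) y" by (simp flip: linear_ext_add)
      also have "L (Suc k) y = 0" using y(1) by (simp add: N_def)
      finally have "L (Suc k) u = (\<Sum>v\<in>UNIV. free_var v (L (Suc k) (z v)))"
        by (simp add: z(1) linear_ext_sum free_var_linear_ext)
      moreover have "L (Suc k) (z v) \<in> N k (?j - 1)" for v using z(2) unfolding N_image by blast
      ultimately have "L (Suc k) u \<in> ?J"
        unfolding fre.irr_def by (intro CollectI exI[of _ "\<lambda>v. L (Suc k) (z v)"]) simp
      then show "u \<in> U'" using u by (simp add: U_def U'_def)
    next
      assume "u \<in> U'"
      then obtain z where z: "L (Suc k) u = (\<Sum>v\<in>UNIV. free_var v (z v))" "\<And>v. z v \<in> N k (?j - 1)"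
        unfolding U'_def fre.irr_def by blast
      \<comment> \<open>Conversely, the image of \<open>u\<close> lifts to an element of x F_(k+1).
        Its difference to \<open>u\<close> is a syzygy with the same reduction as
        \<open>u\<close>.\<close>
      then obtain y where y: "\<And>v. y v \<in> F (Suc k) (?j - 1)" "\<And>v. z v = L (Suc k) (y v)"
        unfolding N_image image_iff by metis
      let ?s = "\<Sum>v\<in>UNIV. free_var v (y v)"
      have sI': "?s \<in> fre.irr (F (Suc k) (?j - 1))" using y(1) unfolding fre.irr_def by blast
      then have sF: "?s \<in> F (Suc k) ?j" using fre.irr_graded[OF graded_free_comp, of "r (Suc k)" "?j - 1"] by auto
      have "u - ?s \<in> F (Suc k) ?j" using u sF fre.subspace_diff[OF gF(1)] unfolding U_def by blast
      moreover have "L (Suc k) (u - ?s) = 0"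
        by (simp add: fre.vv.linear_diff[OF lL] z(1) y(2) linear_ext_sum free_var_linear_ext)
      ultimately have "u - ?s \<in> N (Suc k) ?j" by (simp add: N_def)
      moreover have "residue_map ?s = 0" using sI' residue_kernel[OF sF] by blast
      then have "residue_map u = residue_map (u - ?s)" by (simp add: fc.linear_diff[OF linear_residue_map])
      ultimately show "residue_map u \<in> tor_boundaries r D (Suc k) j" unfolding boundaries_image by blast
    qed
  qed
  have "pol.kh hom_comp (ideal_comp G) (int (Suc k)) (?j - int (Suc k)) = fre.kh (F k) (N k) 1 (?j - 1)"
    using kh_shift[of k "int (Suc k)" "?j - int (Suc k)"] by simp
  also have "\<dots> = int (fre.dim (N k ?j \<inter> ?I)) - int (fre.dim ?J)"
    using ac.kh_syzygy_1[of k "?j - 1"] by simp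
  finally show ?thesis using 1 2 tor_dim_int[OF sub fin] by simp
qed

lemma tor_dim_kh: "int (tor_dim r D i j) = pol.kh hom_comp (ideal_comp G) (int i) (int j - int i)"
  by (cases i) (simp_all add: tor_dim_0 tor_dim_Suc)

end

section \<open>Existence of resolutions\<close>

definition graded_submodule :: "(nat \<Rightarrow> nat) \<Rightarrow> (nat \<times> nat \<Rightarrow>\<^sub>0 ('v::finite, 'k::field) polynomial) set \<Rightarrow> bool" where
  "graded_submodule r M \<longleftrightarrow> M \<subseteq> free_module r \<and> 0 \<in> M \<and> (\<forall>x\<in>M. \<forall>y\<in>M. x + y \<in> M) \<and>
     (\<forall>q. \<forall>x\<in>M. smult q x \<in> M) \<and> (\<forall>m. \<forall>x\<in>M. free_part m x \<in> M)"

lemma free_module_add: "x \<in> free_module r \<Longrightarrow> y \<in> free_module r \<Longrightarrow> x + y \<in> free_module r"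
  using keys_add[of x y] by (auto simp: free_module_def)

lemma free_module_smult: "x \<in> free_module r \<Longrightarrow> smult q (x :: nat \<times> nat \<Rightarrow>\<^sub>0 'a::comm_ring_1) \<in> free_module r"
  by (auto simp: free_module_def in_keys_iff lookup_smult)

lemma free_module_zero: "0 \<in> free_module r"
  by (simp add: free_module_def)

lemma free_module_part: "x \<in> free_module r \<Longrightarrow> free_part m x \<in> free_module r"
  using free_part_comp free_comp_module by blast

lemma free_comp_neg: "m < 0 \<Longrightarrow> free_comp r m = {0}"
proof (intro subset_antisym subsetI)
  fix x assume "m < 0" "x \<in> free_comp r m"
  then have "coef x b a = 0" for b a unfolding free_comp_def by (cases b) force
  then show "x \<in> {0}" by (auto intro: coef_eqI)
qed (simp add: fre.gradedD(4)[OF graded_free_comp])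

text \<open>A basis over the field of each graded piece of \<open>M\<close> serves as the set of
  generators of that degree. These generators are redundant and may be infinite in number, which
  \<open>graded_free_resolution\<close> permits.\<close>

lemma graded_submodule_generators:
  fixes M :: "(nat \<times> nat \<Rightarrow>\<^sub>0 ('v::finite, 'k::field) polynomial) set"
  assumes M: "graded_submodule r M"
  shows "\<exists>r' D. homogeneous_matrix r' r D \<and> linear_ext D ` free_module r' = M"
proof -
  have M0: "0 \<in> M" and Madd: "x \<in> M \<Longrightarrow> y \<in> M \<Longrightarrow> x + y \<in> M" and Msm: "x \<in> M \<Longrightarrow> smult q x \<in> M"
    and Mpart: "x \<in> M \<Longrightarrow> free_part m x \<in> M" and MF: "M \<subseteq> free_module r" for x y q m
    using M unfolding graded_submodule_def by auto
  note g = fre.gradedD[OF graded_free_comp[of r]]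
  have "\<exists>f k. f ` {..<k} \<subseteq> M \<inter> free_comp r (int d) \<and> M \<inter> free_comp r (int d) \<subseteq> fre.span (f ` {..<k :: nat})" for d
  proof -
    obtain B where B: "B \<subseteq> M \<inter> free_comp r (int d)" "fre.independent B" "M \<inter> free_comp r (int d) \<subseteq> fre.span B"
      using fre.maximal_independent_subset by blast
    have "fre.fin_dim (M \<inter> free_comp r (int d))" using g(2)[of "int d"] by (rule fre.fin_dim_subset) simp
    then have "finite B" using fre.fin_dim_independent(1) B by blast
    then obtain f where "bij_betw f {0..<card B} B" using ex_bij_betw_nat_finite by blast
    then have "f ` {..<card B} = B" by (simp add: bij_betw_def atLeast0LessThan)
    then show ?thesis using B by (intro exI[of _ f] exI[of _ "card B"]) simp
  qed
  then obtain f k where fk: "\<And>d. f d ` {..<k d} \<subseteq> M \<inter> free_comp r (int d)"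
      "\<And>d. M \<inter> free_comp r (int d) \<subseteq> fre.span (f d ` {..<k d :: nat})" by metis
  define D where "D = (\<lambda>(d, s). f d s)"
  have DM: "D (d, s) \<in> M" "D (d, s) \<in> free_comp r (int d)" if "s < k d" for d s
    using fk(1)[of d] that by (auto simp: D_def)
  let ?I = "linear_ext D ` free_module k"
  have I: "fre.subspace ?I"
  proof -
    have "fre.subspace (free_module k :: (nat \<times> nat \<Rightarrow>\<^sub>0 ('v, 'k) polynomial) set)"
      unfolding fre.subspace_def free_scale_def
      by (auto intro: free_module_zero free_module_add free_module_smult)
    then show ?thesis by (rule fre.vv.subspace_image[OF free_linear_ext])
  qed
  have "homogeneous_matrix k r D"
    using DM(2) by (simp add: homogeneous_matrix_def free_comp_free_component)
  moreover have "?I = M"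
  proof (intro subset_antisym subsetI)
    fix y assume "y \<in> ?I"
    then obtain x where x: "x \<in> free_module k" "y = linear_ext D x" by blast
    have "(\<Sum>b\<in>K. smult (Poly_Mapping.lookup x b) (D b)) \<in> M" if "finite K" "K \<subseteq> Poly_Mapping.keys x" for K
      using that
    proof induction
      case (insert b K)
      obtain d s where b: "b = (d, s)" by fastforce
      then have "s < k d" using insert.prems x(1) by (auto simp: free_module_def)
      then show ?case using insert DM(1) Madd Msm b by simp
    qed (simp add: M0)
    then show "y \<in> M" unfolding x(2) linear_ext_def by simp
  next
    fix x assume x: "x \<in> M"
    have gen: "f d ` {..<k d} \<subseteq> ?I" for d
    proof
      fix y assume "y \<in> f d ` {..<k d}"
      then obtain s where s: "s < k d" "y = D (d, s)" by (auto simp: D_def)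
      have "Poly_Mapping.single (d, s) 1 \<in> (free_module k :: (nat \<times> nat \<Rightarrow>\<^sub>0 ('v, 'k) polynomial) set)"
        using s(1) by (simp add: free_module_def)
      moreover have "y = linear_ext D (Poly_Mapping.single (d, s) 1)" by (simp add: s(2) linear_ext_single smult_one)
      ultimately show "y \<in> ?I" by blast
    qed
    have part: "free_part m x \<in> ?I" for m
    proof (cases "m < 0")
      case True
      then have "free_part m x = 0" using free_part_comp[of x r m] x MF free_comp_neg by blast
      then show ?thesis using fre.subspace_0[OF I] by simp
    next
      case False
      then have "free_part m x \<in> M \<inter> free_comp r (int (nat m))"
        using Mpart[OF x] free_part_comp[of x r m] x MF by auto
      then show ?thesis using fk(2) fre.span_minimal[OF gen I] by blast
    qed
    obtain K where K: "finite K" "x = (\<Sum>m\<in>K. free_part m x)" using free_part_decomp by blast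
    have "(\<Sum>m\<in>K. free_part m x) \<in> ?I" by (rule fre.subspace_sum[OF I part])
    then show "x \<in> ?I" using K(2) by simp
  qed
  ultimately show ?thesis by blast
qed

lemma graded_submodule_kernel:
  assumes "homogeneous_matrix r r' D"
  shows "graded_submodule r {x \<in> free_module r. linear_ext D x = 0}"
  unfolding graded_submodule_def
  by (auto simp: free_module_zero linear_ext_zero free_module_add linear_ext_add free_module_smult linear_ext_smult
    smult_zero free_module_part free_part_linear_ext[OF assms, symmetric] free_part_zero)

lemma graded_submodule_augmentation_kernel:
  assumes "homogeneous_ideal G" "\<And>d s. s < r d \<Longrightarrow> e (d, s) \<in> homog d"
  shows "graded_submodule r {x \<in> free_module r. aug_map e x \<in> G}"
  unfolding graded_submodule_def
  using homogeneous_idealD[OF assms(1)]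
  by (auto simp: free_module_zero aug_map_zero free_module_add aug_map_add free_module_smult aug_map_smult
    free_module_part hom_part_aug_map[OF assms(2), symmetric])

lemma graded_free_resolution_exists:
  fixes G :: "('v::finite, 'k::field) polynomial set"
  assumes G: "homogeneous_ideal G"
  shows "\<exists>r e D. graded_free_resolution G r e D"
proof -
  \<comment> \<open>F_0 is Q itself, with the single generator 1 of degree 0.\<close>
  define r0 :: "nat \<Rightarrow> nat" where "r0 d = (if d = 0 then 1 else 0)" for d
  define e :: "nat \<times> nat \<Rightarrow> ('v, 'k) polynomial" where "e b = 1" for b :: "nat \<times> nat"
  have e: "e (d, s) \<in> homog d" if "s < r0 d" for d s
    using that by (auto simp: e_def r0_def homog_def monomial_degree_def split: if_splits)
  \<comment> \<open>\<open>K n\<close> is the kernel that the next module has to cover. Dependent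
    choice passes along the latest module with its differential; at \<open>n = 0\<close> there is no
    differential yet, and the augmentation takes its place.\<close>
  define K where "K n \<rho> \<Delta> = {x \<in> free_module \<rho>. if n = 0 then aug_map e x \<in> G else linear_ext \<Delta> x = 0}"
    for n :: nat and \<rho> and \<Delta> :: "nat \<times> nat \<Rightarrow> (nat \<times> nat \<Rightarrow>\<^sub>0 ('v, 'k) polynomial)"
  define P where "P n s \<longleftrightarrow> (if n = 0 then fst s = r0 else \<exists>\<rho>. homogeneous_matrix (fst s) \<rho> (snd s))"
    for n :: nat and s :: "(nat \<Rightarrow> nat) \<times> (nat \<times> nat \<Rightarrow> (nat \<times> nat \<Rightarrow>\<^sub>0 ('v, 'k) polynomial))"
  define Q where "Q n s t \<longleftrightarrow> homogeneous_matrix (fst t) (fst s) (snd t) \<and>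
      linear_ext (snd t) ` free_module (fst t) = K n (fst s) (snd s)"
    for n :: nat and s t :: "(nat \<Rightarrow> nat) \<times> (nat \<times> nat \<Rightarrow> (nat \<times> nat \<Rightarrow>\<^sub>0 ('v, 'k) polynomial))"
  have "\<exists>S. \<forall>n. P n (S n) \<and> Q n (S n) (S (Suc n))"
  proof (rule dependent_nat_choice)
    show "\<exists>s. P 0 s" by (auto simp: P_def)
    fix s n assume s: "P n s"
    have "graded_submodule (fst s) (K n (fst s) (snd s))"
    proof (cases "n = 0")
      case True
      then show ?thesis using s graded_submodule_augmentation_kernel[OF G, of r0 e] e by (simp add: K_def P_def)
    next
      case False
      then show ?thesis using s graded_submodule_kernel by (auto simp: K_def P_def)
    qed
    then obtain r' D where "homogeneous_matrix r' (fst s) D" "linear_ext D ` free_module r' = K n (fst s) (snd s)"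
      using graded_submodule_generators by blast
    then show "\<exists>t. P (Suc n) t \<and> Q n s t" by (intro exI[of _ "(r', D)"]) (auto simp: P_def Q_def)
  qed
  then obtain S where S: "\<And>n. P n (S n)" "\<And>n. Q n (S n) (S (Suc n))" by blast
  define r where "r n = fst (S n)" for n
  define D where "D n = snd (S n)" for n
  have r0: "r 0 = r0" using S(1)[of 0] by (simp add: P_def r_def)
  have h: "homogeneous_matrix (r (Suc n)) (r n) (D (Suc n))" for n
    using S(2)[of n] by (simp add: Q_def r_def D_def)
  have ex: "linear_ext (D (Suc n)) ` free_module (r (Suc n)) = K n (r n) (D n)" for n
    using S(2)[of n] by (simp add: Q_def r_def D_def)
  have "graded_free_resolution G r e D"
    unfolding graded_free_resolution_def
  proof (intro conjI allI impI)
    show "e (d, s) \<in> homog d" if "s < r 0 d" for d s using that e r0 by simp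
    show "D (i + 1) (d, s) \<in> free_component (r i) d" if "s < r (i + 1) d" for i d s
      using h[of i] that by (simp add: homogeneous_matrix_def)
    show "augmentation G e ` free_module (r 0) = range (\<lambda>q. q +o G)"
    proof (intro subset_antisym subsetI)
      fix C assume "C \<in> range (\<lambda>q. q +o G)"
      then obtain q where q: "C = q +o G" by blast
      have "Poly_Mapping.single (0, 0) q \<in> free_module (r 0)" by (simp add: free_module_def r0 r0_def)
      moreover have "aug_map e (Poly_Mapping.single (0, 0) q) = q"
        by (cases "q = 0") (simp_all add: aug_map_def e_def)
      ultimately show "C \<in> augmentation G e ` free_module (r 0)"
        unfolding q augmentation_eq by (metis (mono_tags, lifting) imageI)
    qed (auto simp: augmentation_eq)
    show "{x \<in> free_module (r 0). augmentation G e x = G} = linear_ext (D 1) ` free_module (r 1)"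
      using ex[of 0] coset_eq_self_iff[OF G] by (simp add: K_def augmentation_eq)
    show "{x \<in> free_module (r (i + 1)). linear_ext (D (i + 1)) x = 0} = linear_ext (D (i + 2)) ` free_module (r (i + 2))" for i
      using ex[of "Suc i"] by (simp add: K_def)
  qed
  then show ?thesis by blast
qed

text \<open>Existence of a resolution makes the choice by \<open>SOME\<close> meaningful, and the
  right-hand side does not mention the resolution: this is the independence of the choice.\<close>

lemma graded_betti_kh:
  assumes G: "homogeneous_ideal G"
  shows "int (graded_betti G i j) = pol.kh hom_comp (ideal_comp G) (int i) (int j - int i)"
proof -
  define t where "t = (SOME (r, e, D). graded_free_resolution G r e D)"
  obtain r e D where t: "t = (r, e, D)" by (cases t)
  have "\<exists>s. case s of (r, e, D) \<Rightarrow> graded_free_resolution G r e D"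
    using graded_free_resolution_exists[OF G] by auto
  then have "case t of (r, e, D) \<Rightarrow> graded_free_resolution G r e D" unfolding t_def by (rule someI_ex)
  then have "resolution G r e D" using G t by (simp add: resolution_def)
  then have "int (tor_dim r D i j) = pol.kh hom_comp (ideal_comp G) (int i) (int j - int i)"
    by (rule resolution.tor_dim_kh)
  then show ?thesis unfolding graded_betti_def t_def[symmetric] t by simp
qed

section \<open>Ideals generated by homogeneous elements\<close>

lemma homogeneous_ideal_span:
  fixes S :: "('v::finite, 'k::field) polynomial set"
  assumes "\<And>a. a \<in> S \<Longrightarrow> \<exists>d. a \<in> hom_comp d"
  shows "homogeneous_ideal (ideal_span S)"
  unfolding homogeneous_ideal_def
proof (intro conjI allI ballI)
  note m = module_ring_mult[where 'a = "('v, 'k) polynomial"]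
  show "0 \<in> ideal_span S" by (rule module.span_zero[OF m])
  show "p + q \<in> ideal_span S" if "p \<in> ideal_span S" "q \<in> ideal_span S" for p q
    using module.span_add[OF m that] .
  show "p * q \<in> ideal_span S" if "q \<in> ideal_span S" for p q
    using module.span_scale[OF m that] .
  show "hom_part i q \<in> ideal_span S" if "q \<in> ideal_span S" for q i
    using that
  proof (induction rule: module.span_induct_alt[OF m, consumes 1])
    case 1
    then show ?case by (simp add: hom_part_zero module.span_zero[OF m])
  next
    case (2 c a y)
    obtain d where "a \<in> hom_comp d" using assms 2 by blast
    then have "hom_part i (c * a) = hom_part (i - d) c * a" by (rule hom_part_mult)
    then show ?case
      using 2 by (simp add: hom_part_add module.span_add[OF m] module.span_scale[OF m] module.span_base[OF m])
  qed
qed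

lemma ideal_span_insert:
  "q \<in> ideal_span (insert a S) \<longleftrightarrow> (\<exists>b\<in>ideal_span S. \<exists>c. q = b + c * (a :: 'a::comm_ring_1))"
proof
  assume "q \<in> ideal_span (insert a S)"
  then obtain c where "q - c * a \<in> ideal_span S" unfolding module.span_breakdown_eq[OF module_ring_mult] by blast
  then show "\<exists>b\<in>ideal_span S. \<exists>c. q = b + c * a" by (intro bexI[of _ "q - c * a"] exI[of _ c]) simp
next
  assume "\<exists>b\<in>ideal_span S. \<exists>c. q = b + c * a"
  then obtain b c where "b \<in> ideal_span S" "q = b + c * a" by blast
  then show "q \<in> ideal_span (insert a S)"
    unfolding module.span_breakdown_eq[OF module_ring_mult] by (intro exI[of _ c]) simp
qed

lemma colon_span_insert:
  fixes S :: "('v::finite, 'k::field) polynomial set"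
  assumes "homogeneous_ideal (ideal_span S)"
  shows "colon (ideal_span S) (ideal_span (insert a S)) = {q. q * a \<in> ideal_span S}"
proof (intro subset_antisym subsetI)
  fix q assume "q \<in> colon (ideal_span S) (ideal_span (insert a S))"
  then show "q \<in> {q. q * a \<in> ideal_span S}"
    using module.span_base[OF module_ring_mult, of a "insert a S"] by (simp add: colon_def)
next
  note D = homogeneous_idealD[OF assms]
  fix q assume q: "q \<in> {q. q * a \<in> ideal_span S}"
  have "q * x \<in> ideal_span S" if x: "x \<in> ideal_span (insert a S)" for x
  proof -
    obtain b c where b: "b \<in> ideal_span S" "x = b + c * a" using x unfolding ideal_span_insert by blast
    have "q * b + c * (q * a) \<in> ideal_span S" using q b D(2,3) by simp
    then show ?thesis using b(2) by (simp add: algebra_simps)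
  qed
  then show "q \<in> colon (ideal_span S) (ideal_span (insert a S))" by (simp add: colon_def)
qed

lemma homogeneous_ideal_colon:
  assumes J: "homogeneous_ideal J" and a: "a \<in> hom_comp d"
  shows "homogeneous_ideal {q. q * a \<in> J}"
  unfolding homogeneous_ideal_def
proof (intro conjI allI ballI CollectI)
  note D = homogeneous_idealD[OF J]
  show "0 * a \<in> J" using D(1) by simp
  show "(p + q) * a \<in> J" if "p \<in> {q. q * a \<in> J}" "q \<in> {q. q * a \<in> J}" for p q
    using that D(2) by (simp add: distrib_right)
  show "(p * q) * a \<in> J" if "q \<in> {q. q * a \<in> J}" for p q
    using that D(3) by (simp add: mult.assoc)
  show "hom_part m q * a \<in> J" if "q \<in> {q. q * a \<in> J}" for q m
    using that D(4)[of "q * a" "m + d"] hom_part_mult[OF a, of "m + d" q] by simp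
qed

lemma linear_mult: "Vector_Spaces.linear poly_scale poly_scale ((*) (f :: ('v::finite, 'k::field) polynomial))"
  by (simp add: Vector_Spaces.linear_iff pol.vector_space_axioms distrib_left poly_scale_def mult.left_commute)

text \<open>Every monomial of positive degree is divided by its least variable and by no other.
  Unlike the formula with partial derivatives, this holds in every characteristic.\<close>

lemma poly_euler_decomp:
  fixes f :: "('v::finite, 'k::field) polynomial"
  assumes "f \<in> hom_comp e" "e \<noteq> 0"
  shows "f = (\<Sum>v\<in>UNIV. poly_var v (poly_div v f))"
proof (rule poly_mapping_eqI)
  fix a :: "'v \<Rightarrow>\<^sub>0 nat"
  let ?s = "{u. Poly_Mapping.lookup a u > 0}"
  show "Poly_Mapping.lookup f a = Poly_Mapping.lookup (\<Sum>v\<in>UNIV. poly_var v (poly_div v f)) a"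
  proof (cases "?s = {}")
    case True
    then have "a = 0" by (intro poly_mapping_eqI) auto
    then show ?thesis using assms by (auto simp: hom_comp_def monomial_degree_def lookup_sum lookup_poly_var)
  next
    case False
    define w where "w = least_var ?s"
    have w: "w \<in> ?s" "\<And>u. u \<in> ?s \<Longrightarrow> var_index w \<le> var_index u"
      unfolding w_def using least_var[OF False] by auto
    have "Poly_Mapping.lookup (poly_var v (poly_div v f)) a = (if v = w then Poly_Mapping.lookup f a else 0)" for v
    proof (cases "Poly_Mapping.lookup a v > 0")
      case True
      have "bounded_below v (a - var_monom v) \<longleftrightarrow> v = w"
      proof
        assume b: "bounded_below v (a - var_monom v)"
        show "v = w"
        proof (rule ccontr)
          assume "v \<noteq> w"
          then have "Poly_Mapping.lookup (a - var_monom v) w > 0" using w(1) by (simp add: lookup_minus lookup_single when_def)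
          then have "var_index v \<le> var_index w" using b by (auto simp: bounded_below_def)
          moreover have "v \<in> ?s" using True by simp
          then have "var_index w \<le> var_index v" by (rule w(2))
          ultimately have "v = w" by (rule var_index_antisym)
          then show False using \<open>v \<noteq> w\<close> by contradiction
        qed
      next
        assume "v = w"
        then show "bounded_below v (a - var_monom v)" using w(2) by (auto simp: bounded_below_def lookup_minus)
      qed
      then show ?thesis
        using True by (simp only: lookup_poly_var lookup_poly_div monom_diff_add[OF True] if_True)
    next
      case False
      then show ?thesis using w(1) by (auto simp: lookup_poly_var)
    qed
    then show ?thesis by (simp add: lookup_sum)
  qed
qed

lemma poly_div_hom_comp: "q \<in> hom_comp m \<Longrightarrow> poly_div v q \<in> hom_comp (m - 1)"
  unfolding hom_comp_def
proof (intro CollectI allI impI)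
  fix a assume q: "q \<in> {q. \<forall>a. Poly_Mapping.lookup q a \<noteq> 0 \<longrightarrow> int (monomial_degree a) = m}"
    and "Poly_Mapping.lookup (poly_div v q) a \<noteq> 0"
  then have "Poly_Mapping.lookup q (a + var_monom v) \<noteq> 0" by (auto simp: lookup_poly_div split: if_splits)
  then have "int (monomial_degree (a + var_monom v)) = m" using q by blast
  then show "int (monomial_degree a) = m - 1" using monomial_degree_var[of v] by (simp add: monomial_degree_add)
qed

lemma ideal_comp_sub: "ideal_comp G m \<subseteq> hom_comp m"
  by (simp add: ideal_comp_def)

lemma ideal_comp_mult:
  assumes "homogeneous_ideal G" "f \<in> hom_comp e" "x \<in> ideal_comp G m"
  shows "f * x \<in> ideal_comp G (m + e)"
  using homogeneous_idealD(3)[OF assms(1), of x f] hom_comp_mult[OF assms(2), of x m] assms(3)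
  by (simp add: ideal_comp_def add.commute[of m])

text \<open>\<open>kh_quotient\<close> for the quotient by the ideal of \<open>S\<close>, with
  \<open>poly_div v f\<close> as the cofactor of x_v; a nonzero degree places \<open>f\<close> in
  the irrelevant ideal. The relations \<open>B'\<close> of the locale turn out to be the graded
  pieces of the enlarged ideal.\<close>

lemma kh_ideal_insert:
  fixes S :: "('v::finite, 'k::field) polynomial set"
  assumes S: "\<And>a. a \<in> S \<Longrightarrow> \<exists>d. a \<in> hom_comp d" and f: "f \<in> hom_comp e" "e \<noteq> 0"
    and reg: "\<And>q. f * q \<in> ideal_span S \<Longrightarrow> q \<in> ideal_span S"
  shows "pol.kh hom_comp (ideal_comp (ideal_span (insert f S))) p m =
    pol.kh hom_comp (ideal_comp (ideal_span S)) p m + pol.kh hom_comp (ideal_comp (ideal_span S)) (p - 1) (m + 1 - e)"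
proof -
  let ?J = "ideal_span S"
  have J: "homogeneous_ideal ?J" using S by (rule homogeneous_ideal_span)
  note D = homogeneous_idealD[OF J]
  interpret reg: regular_multiplication poly_scale poly_var hom_comp "ideal_comp ?J" "(*) f" "\<lambda>v. (*) (poly_div v f)" e
  proof unfold_locales
    have gh: "poly_div v f * x \<in> hom_comp (m + e - 1)" if "x \<in> hom_comp m" for v x m
      using hom_comp_mult[OF poly_div_hom_comp[OF f(1)] that, of v] by (simp add: algebra_simps)
    show "pol.graded hom_comp" "pol.graded (ideal_comp ?J)" by (rule graded_hom_comp, rule graded_ideal_comp[OF J])
    show "ideal_comp ?J m \<subseteq> hom_comp m" for m by (rule ideal_comp_sub)
    show "f * (x + y) = f * x + f * y" for x y by (rule distrib_left)
    show "poly_div v f * (x + y) = poly_div v f * x + poly_div v f * y" for v x y by (rule distrib_left)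
    show "f * poly_scale c x = poly_scale c (f * x)" for c x by (simp add: poly_scale_def mult.left_commute)
    show "poly_div v f * poly_scale c x = poly_scale c (poly_div v f * x)" for v c x
      by (simp add: poly_scale_def mult.left_commute)
    show "f * poly_var v x = poly_var v (f * x)" for v x
      by (simp add: poly_var_def mult.left_commute)
    show "poly_div u f * poly_var v x = poly_var v (poly_div u f * x)" for u v x
      by (simp add: poly_var_def mult.left_commute)
    show "f * x \<in> hom_comp (m + e)" if "x \<in> hom_comp m" for x m
      using hom_comp_mult[OF f(1) that] by (simp add: add.commute)
    show "f * x \<in> ideal_comp ?J (m + e)" if "x \<in> ideal_comp ?J m" for x m
      using ideal_comp_mult[OF J f(1) that] .
    show "x \<in> ideal_comp ?J m" if "x \<in> hom_comp m" "f * x \<in> ideal_comp ?J (m + e)" for x m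
      using that reg by (simp add: ideal_comp_def)
    show "poly_div v f * x \<in> hom_comp (m + e - 1)" if "x \<in> hom_comp m" for v x m
      using gh[OF that] .
    show "poly_div v f * x \<in> ideal_comp ?J (m + e - 1)" if "x \<in> ideal_comp ?J m" for v x m
      using that gh[of x m v] D(3) by (simp add: ideal_comp_def)
    show "f * x = (\<Sum>v\<in>UNIV. poly_var v (poly_div v f * x))" for x
      by (subst poly_euler_decomp[OF f]) (simp add: sum_distrib_right poly_var_def mult.assoc)
  qed
  have "reg.B' = ideal_comp (ideal_span (insert f S))"
  proof (rule ext, intro subset_antisym subsetI)
    fix m x assume "x \<in> reg.B' m"
    then obtain b z where b: "b \<in> ideal_comp ?J m" "z \<in> hom_comp (m - e)" "x = b + f * z" unfolding reg.B'_def by blast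
    have "f * z \<in> hom_comp m" using hom_comp_mult[OF f(1) b(2)] by simp
    moreover have "b \<in> hom_comp m" using b(1) by (simp add: ideal_comp_def)
    ultimately have "x \<in> hom_comp m"
      unfolding b(3) by (intro pol.subspace_add[OF pol.gradedD(1)[OF graded_hom_comp]])
    moreover have "x \<in> ideal_span (insert f S)"
      unfolding ideal_span_insert using b by (intro bexI[of _ b] exI[of _ z]) (auto simp: ideal_comp_def mult.commute)
    ultimately show "x \<in> ideal_comp (ideal_span (insert f S)) m" by (simp add: ideal_comp_def)
  next
    fix m x assume "x \<in> ideal_comp (ideal_span (insert f S)) m"
    then obtain b c where b: "x \<in> hom_comp m" "b \<in> ?J" "x = b + c * f" unfolding ideal_comp_def Int_iff ideal_span_insert by blast
    have "x = hom_part m x" using hom_part_id[OF b(1), of m] by simp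
    also have "\<dots> = hom_part m b + f * hom_part (m - e) c"
      by (simp add: b(3) hom_part_add hom_part_mult[OF f(1)] mult.commute)
    finally show "x \<in> reg.B' m"
      using D(4)[OF b(2)] hom_part_comp unfolding reg.B'_def ideal_comp_def by blast
  qed
  then show ?thesis using reg.kh_quotient[of p m] by simp
qed

text \<open>Q is the free module on one generator of degree 0. Its positive Koszul homology vanishes
  by \<open>free_acyclic\<close>, and H_0 is the residue field.\<close>

lemma kh_polynomial_ring:
  "pol.kh hom_comp (ideal_comp {0 :: ('v::finite, 'k::field) polynomial}) p m = (if p = 0 \<and> m = 0 then 1 else 0)"
proof -
  define r :: "nat \<Rightarrow> nat" where "r d = (if d = 0 then 1 else 0)" for d
  let ?F = "free_comp r :: int \<Rightarrow> (nat \<times> nat \<Rightarrow>\<^sub>0 ('v, 'k) polynomial) set" and ?N = "\<lambda>_ :: int. {0 :: nat \<times> nat \<Rightarrow>\<^sub>0 ('v, 'k) polynomial}"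
  let ?e = "\<lambda>_ :: nat \<times> nat. 1 :: ('v, 'k) polynomial"
  note gF = graded_free_comp[of r] and gN = fre.graded_zero
  have e: "?e (d, s) \<in> homog d" if "s < r d" for d s
    using that by (auto simp: r_def homog_def monomial_degree_def split: if_splits)
  have key: "b = (0, 0)" if "x \<in> free_module r" "b \<in> Poly_Mapping.keys x" for b and x :: "nat \<times> nat \<Rightarrow>\<^sub>0 'c::zero"
    using that by (cases b) (auto simp: free_module_def r_def split: if_splits)
  have keys: "Poly_Mapping.keys x \<subseteq> {(0, 0)}" if "x \<in> free_module r" for x :: "nat \<times> nat \<Rightarrow>\<^sub>0 'c::zero"
    using key[OF that] by blast
  have aug: "aug_map ?e x = Poly_Mapping.lookup x (0, 0)" if "x \<in> ?F m" for x m
    using aug_map_superset[of "{(0, 0)}" x ?e] keys free_comp_module that by auto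
  interpret ac: acyclic_module free_scale free_var ?F ?N
    by unfold_locales (simp_all add: gF gN fre.gradedD(4)[OF gF] free_acyclic)
  have zero: "homogeneous_ideal {0 :: ('v, 'k) polynomial}"
    by (simp add: homogeneous_ideal_def hom_part_zero)
  have "pol.kh hom_comp (ideal_comp {0 :: ('v, 'k) polynomial}) p m = fre.kh ?F ?N p m"
  proof (rule fp.kh_transport[symmetric, OF free_linear_aug_map free_var_aug_map gF gN graded_hom_comp graded_ideal_comp[OF zero]])
    show "?N m \<subseteq> ?F m" for m using fre.gradedD(4)[OF gF] by simp
    show "ideal_comp {0} m \<subseteq> hom_comp m" for m by (rule ideal_comp_sub)
    show h: "aug_map ?e x \<in> hom_comp m" if "x \<in> ?F m" for x m using aug_map_hom_comp[OF e that] .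
    show "aug_map ?e x \<in> ideal_comp {0} m \<longleftrightarrow> x \<in> ?N m" if "x \<in> ?F m" for x m
    proof
      assume "aug_map ?e x \<in> ideal_comp {0} m"
      then have "Poly_Mapping.lookup x (0, 0) = 0" using aug[OF that] by (simp add: ideal_comp_def)
      then have "Poly_Mapping.lookup x b = 0" for b
        using key[of x b] that free_comp_module[of r m] by (auto simp: in_keys_iff)
      then show "x \<in> ?N m" by (auto intro: poly_mapping_eqI)
    qed (simp add: aug_map_zero ideal_comp_def pol.gradedD(4)[OF graded_hom_comp])
    show "\<exists>x\<in>?F m. y - aug_map ?e x \<in> ideal_comp {0} m" if y: "y \<in> hom_comp m" for y m
    proof
      show F: "Poly_Mapping.single (0, 0) y \<in> ?F m"
        using y by (auto simp: free_comp_def hom_comp_def lookup_single when_def r_def)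
      show "y - aug_map ?e (Poly_Mapping.single (0, 0) y) \<in> ideal_comp {0} m"
        using aug[OF F] by (simp add: ideal_comp_def pol.gradedD(4)[OF graded_hom_comp])
    qed
  qed
  also have "\<dots> = (if p = 0 \<and> m = 0 then 1 else 0)"
  proof -
    consider "p < 0" | "p \<ge> 1" | "p = 0" by linarith
    then show ?thesis
    proof cases
      case 1
      then show ?thesis by (simp add: fre.kh_trivial[OF _ gF gN])
    next
      case 2
      have "fre.cyc ?F ?N p m = fre.bnd ?F ?N p m"
      proof (intro subset_antisym subsetI)
        fix c assume c: "c \<in> fre.cyc ?F ?N p m"
        then have "fre.bd c = 0" using fre.cycD(2)[OF c] fre.chains_zero_iff by blast
        then obtain a where "a \<in> fre.chains (p + 1) (?F (m - 1))" "c = fre.bd a"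
          using free_acyclic[OF 2 fre.cycD(1)[OF c]] by blast
        then show "c \<in> fre.bnd ?F ?N p m" using fre.bnd_boundary[OF gN] by blast
      qed (use fre.bnd_cyc[OF gF gN] fre.gradedD(4)[OF gF] in blast)
      then show ?thesis using 2 by (simp add: fre.kh_def)
    next
      case 3
      have U: "{x + y |x y. x \<in> fre.irr (?F (m - 1)) \<and> y \<in> ?N m} = {x \<in> ?F m. residue_map x = 0}"
      proof -
        have "residue_map x = 0 \<longleftrightarrow> (\<forall>b. coef x b 0 = 0)" for x :: "nat \<times> nat \<Rightarrow>\<^sub>0 ('v, 'k) polynomial"
          by (metis lookup_residue_map lookup_zero poly_mapping_eqI)
        then show ?thesis unfolding irr_free_comp by auto
      qed
      have "fre.kh ?F ?N p m = int (fre.dim (?F m)) - int (fre.dim {x \<in> ?F m. residue_map x = 0})"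
        using ac.kh_syzygy_0[of m] unfolding 3 U .
      also have "\<dots> = int (coordinate_space.dim (residue_map ` ?F m))"
        by (simp add: fc.rank_nullity[OF linear_residue_map fre.gradedD(1,2)[OF gF]])
      also have "\<dots> = (if m = 0 then 1 else 0)"
      proof (cases "m < 0")
        case True
        then have "residue_map ` ?F m = {0}"
          by (simp add: free_comp_neg[OF True, of r] fc.linear_0[OF linear_residue_map])
        then show ?thesis using True by (simp add: coord.dim_zero_subspace)
      next
        case False
        then obtain j where j: "m = int j" by (metis not_less zero_le_imp_eq_int)
        have "tensor_component r j = (if j = 0 then coordinate_space.span {Poly_Mapping.single (0, 0) (1 :: 'k)} else {0})"
        proof (cases "j = 0")
          case True
          have "tensor_component r 0 = range (\<lambda>c. smult c (Poly_Mapping.single (0, 0) (1 :: 'k)))"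
          proof (intro subset_antisym subsetI)
            fix v :: "nat \<times> nat \<Rightarrow>\<^sub>0 'k" assume "v \<in> tensor_component r 0"
            then have k: "Poly_Mapping.keys v \<subseteq> {(0, 0)}" using keys by (auto simp: tensor_component_def)
            have "v = smult (Poly_Mapping.lookup v (0, 0)) (Poly_Mapping.single (0, 0) 1)"
              by (rule poly_mapping_eqI) (use k in \<open>auto simp: lookup_smult lookup_single when_def in_keys_iff\<close>)
            then show "v \<in> range (\<lambda>c. smult c (Poly_Mapping.single (0, 0) 1))" by blast
          next
            fix v :: "nat \<times> nat \<Rightarrow>\<^sub>0 'k" assume "v \<in> range (\<lambda>c. smult c (Poly_Mapping.single (0, 0) 1))"
            then obtain c where "v = smult c (Poly_Mapping.single (0, 0) 1)" by blast
            then have "Poly_Mapping.keys v \<subseteq> {(0, 0)}"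
              by (auto simp: in_keys_iff lookup_smult lookup_single when_def split: if_splits)
            then show "v \<in> tensor_component r 0" by (auto simp: tensor_component_def free_module_def r_def)
          qed
          then show ?thesis using True by (simp add: coordinate_space.span_singleton)
        next
          case False
          have "v = 0" if "v \<in> tensor_component r j" for v :: "nat \<times> nat \<Rightarrow>\<^sub>0 'k"
          proof -
            have "Poly_Mapping.keys v \<subseteq> {(0, 0)}" "(0, 0) \<notin> Poly_Mapping.keys v"
              using that False keys by (auto simp: tensor_component_def)
            then have "Poly_Mapping.keys v = {}" by blast
            then show ?thesis by simp
          qed
          then show ?thesis using False by (auto simp: tensor_component_def free_module_def)
        qed
        moreover have "coordinate_space.dim {Poly_Mapping.single (0 :: nat, 0 :: nat) (1 :: 'k)} = 1"
        proof -
          have "\<not> coordinate_space.dependent {Poly_Mapping.single (0 :: nat, 0 :: nat) (1 :: 'k)}"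
            by (simp add: coordinate_space.dependent_single) (metis lookup_single_eq lookup_zero zero_neq_one)
          then show ?thesis by (simp add: coordinate_space.dim_eq_card_independent)
        qed
        ultimately show ?thesis
          unfolding j residue_map_component by (simp add: coord.dim_zero_subspace)
      qed
      finally show ?thesis using 3 by simp
    qed
  qed
  finally show ?thesis .
qed

section \<open>Complete intersections of quadrics\<close>

text \<open>The case d = 1 belongs to the Koszul complex on the variables, the case d = 2 to the
  quadrics.\<close>

lemma fps_one_minus_X_power_mult_nth:
  fixes A :: "'a::comm_ring_1 fps"
  shows "fps_nth ((1 - fps_X ^ d) ^ N * A) j =
    (\<Sum>p\<le>N. (- 1) ^ p * of_nat (N choose p) * (if d * p \<le> j then fps_nth A (j - d * p) else 0))"
proof -
  have "(1 - fps_X ^ d) ^ N = (\<Sum>p\<le>N. of_nat (N choose p) * (- (fps_X ^ d)) ^ p * (1 :: 'a fps) ^ (N - p))"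
    using binomial_ring[of "- (fps_X ^ d)" "1 :: 'a fps" N] by simp
  also have "\<dots> = (\<Sum>p\<le>N. fps_const ((- 1) ^ p * of_nat (N choose p)) * fps_X ^ (d * p))"
  proof (intro sum.cong refl)
    fix p
    have "(- (fps_X ^ d)) ^ p = (fps_const ((- 1) ^ p) * fps_X ^ (d * p) :: 'a fps)"
      unfolding power_minus[of "fps_X ^ d"] power_mult by (simp flip: fps_const_power fps_const_neg)
    then show "of_nat (N choose p) * (- (fps_X ^ d)) ^ p * 1 ^ (N - p) =
        (fps_const ((- 1) ^ p * of_nat (N choose p)) * fps_X ^ (d * p) :: 'a fps)"
      by (simp add: fps_of_nat[symmetric] mult_ac flip: fps_const_mult)
  qed
  finally have "(1 - fps_X ^ d) ^ N * A = (\<Sum>p\<le>N. fps_const ((- 1) ^ p * of_nat (N choose p)) * (fps_X ^ (d * p) * A))"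
    by (simp add: sum_distrib_right mult.assoc)
  then show ?thesis by (simp add: fps_sum_nth fps_X_power_mult_nth) (rule sum.cong, auto)
qed

lemma fps_one_plus_X_power_nth: "fps_nth ((1 + fps_X) ^ N) j = (of_nat (N choose j) :: 'a::comm_ring_1)"
proof -
  have eq: "(1 + fps_X) ^ N = (\<Sum>k\<le>N. fps_const (of_nat (N choose k)) * (fps_X :: 'a fps) ^ k)"
    using binomial_ring[of fps_X "1 :: 'a fps" N] by (simp add: add.commute fps_of_nat)
  have "fps_nth ((1 + fps_X) ^ N) j = (\<Sum>k\<le>N. if k = j then of_nat (N choose j) else (0 :: 'a))"
    unfolding eq fps_sum_nth by (intro sum.cong refl) (auto simp: fps_X_power_nth)
  then show ?thesis by (simp add: not_le binomial_eq_0)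
qed

lemma fps_one_minus_X_neq_0: "(1 - fps_X) ^ N \<noteq> (0 :: int fps)"
proof -
  have "fps_nth (1 - fps_X :: int fps) 0 \<noteq> 0" by simp
  then have "1 - fps_X \<noteq> (0 :: int fps)" by (metis fps_zero_nth)
  then show ?thesis by simp
qed

lemma fps_one_minus_square: "(1 - fps_X ^ 2) ^ N = (1 - fps_X) ^ N * (1 + fps_X :: int fps) ^ N"
  by (simp add: power_mult_distrib[symmetric] algebra_simps power2_eq_square)

lemma hom_comp_neg: "m < 0 \<Longrightarrow> hom_comp m = {0}"
  by (auto simp: hom_comp_def intro!: poly_mapping_eqI)

context
  fixes B :: "int \<Rightarrow> ('v::finite, 'k::field) polynomial set"
  assumes B: "pol.graded B" and sub: "\<And>m. B m \<subseteq> hom_comp m"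
begin

lemma hilb_neg: "m < 0 \<Longrightarrow> pol.hilb hom_comp B m = 0"
proof -
  assume m: "m < 0"
  have "B m = {0}" using hom_comp_neg[OF m] sub[of m] pol.gradedD(4)[OF B, of m] by blast
  then show ?thesis by (simp add: pol.hilb_def hom_comp_neg[OF m])
qed

lemma euler_fps:
  "(1 - fps_X) ^ CARD('v) * Abs_fps (\<lambda>m. pol.hilb hom_comp B (int m)) =
    Abs_fps (\<lambda>j. \<Sum>p\<le>CARD('v). (- 1) ^ p * pol.kh hom_comp B (int p) (int j - int p))"
proof (rule fps_ext)
  fix j
  have "fps_nth ((1 - fps_X) ^ CARD('v) * Abs_fps (\<lambda>m. pol.hilb hom_comp B (int m))) j =
    (\<Sum>p\<le>CARD('v). (- 1) ^ p * int (CARD('v) choose p) * pol.hilb hom_comp B (int j - int p))"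
    using fps_one_minus_X_power_mult_nth[of 1 "CARD('v)" "Abs_fps (\<lambda>m. pol.hilb hom_comp B (int m))" j] hilb_neg
    by (simp add: of_nat_diff not_le cong: if_cong) (intro sum.cong, auto simp: of_nat_diff)
  then show "fps_nth ((1 - fps_X) ^ CARD('v) * Abs_fps (\<lambda>m. pol.hilb hom_comp B (int m))) j =
    fps_nth (Abs_fps (\<lambda>j. \<Sum>p\<le>CARD('v). (- 1) ^ p * pol.kh hom_comp B (int p) (int j - int p))) j"
    using pol.euler_characteristic[OF graded_hom_comp B sub, of "int j"] by simp
qed

end

locale quadrics =
  fixes f :: "nat \<Rightarrow> ('v::finite, 'k::field) polynomial" and n l :: nat
  assumes n_card: "n = CARD('v)" and n_even: "n = 2 * l + 2"
    and quadric: "t \<in> {1..n + 1} \<Longrightarrow> f t \<in> homog 2"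
    and regular: "regular_sequence (map f [1..<n + 1])"
    and max_rank: "maximal_rank_element (ideal_span (f ` {1..n})) 2 (f (n + 1))"
begin

definition "J k = ideal_span (f ` {1..k})"

lemma quadric': "t \<in> {1..n + 1} \<Longrightarrow> f t \<in> hom_comp 2"
  using quadric[of t] hom_comp_homog[of 2] by auto

lemma homogeneous_J: "k \<le> n \<Longrightarrow> homogeneous_ideal (J k)"
  unfolding J_def using quadric' by (intro homogeneous_ideal_span) (auto intro!: exI[of _ 2])

lemma regular_step:
  assumes "k < n" "f (Suc k) * q \<in> J k"
  shows "q \<in> J k"
proof -
  have "set (take k (map f [1..<n + 1])) = f ` {1..k}"
  proof -
    have "take k [1..<n + 1] = [1..<k + 1]" using assms(1) by (subst take_upt) auto
    then show ?thesis by (simp add: take_map atLeastLessThanSuc_atLeastAtMost del: upt_Suc)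
  qed
  moreover have "map f [1..<n + 1] ! k = f (Suc k)" using assms(1) by (simp del: upt_Suc)
  moreover have "k < length (map f [1..<n + 1])" using assms(1) by simp
  ultimately show ?thesis using regular assms(2) unfolding regular_sequence_def J_def by metis
qed

text \<open>For a quadric, the second summand in \<open>kh_ideal_insert\<close> has both indices
  lowered by 1, so it stays on the diagonal p = m, that is, in total degree 2p. There the recursion
  is Pascal's rule.\<close>

lemma kh_J:
  "k \<le> n \<Longrightarrow> pol.kh hom_comp (ideal_comp (J k)) p m = (if p = m \<and> 0 \<le> p then int (k choose nat p) else 0)"
proof (induction k arbitrary: p m)
  case 0
  have "J 0 = {0}" using module.span_empty[OF module_ring_mult] by (simp add: J_def)
  then show ?case using kh_polynomial_ring[of p m, where 'v = 'v and 'k = 'k] by (cases "nat p") auto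
next
  case (Suc k)
  have "f ` {1..Suc k} = insert (f (Suc k)) (f ` {1..k})"
    using atLeastAtMostSuc_conv[of 1 k] by simp
  moreover have "pol.kh hom_comp (ideal_comp (ideal_span (insert (f (Suc k)) (f ` {1..k})))) p m =
      pol.kh hom_comp (ideal_comp (J k)) p m + pol.kh hom_comp (ideal_comp (J k)) (p - 1) (m + 1 - 2)"
  unfolding J_def
  proof (rule kh_ideal_insert)
    show "\<exists>d. a \<in> hom_comp d" if "a \<in> f ` {1..k}" for a using that quadric' Suc.prems by force
    show "f (Suc k) \<in> hom_comp 2" using quadric'[of "Suc k"] Suc.prems by simp
    show "q \<in> ideal_span (f ` {1..k})" if "f (Suc k) * q \<in> ideal_span (f ` {1..k})" for q
      using regular_step[of k q] that Suc.prems by (simp add: J_def)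
  qed simp
  ultimately have "pol.kh hom_comp (ideal_comp (J (Suc k))) p m =
      pol.kh hom_comp (ideal_comp (J k)) p m + pol.kh hom_comp (ideal_comp (J k)) (p - 1) (m - 1)" by (simp add: J_def)
  also have "\<dots> = (if p = m \<and> 0 \<le> p then int (k choose nat p) else 0) +
      (if p - 1 = m - 1 \<and> 0 \<le> p - 1 then int (k choose nat (p - 1)) else 0)"
    using Suc.IH[of p m] Suc.IH[of "p - 1" "m - 1"] Suc.prems by simp
  also have "\<dots> = (if p = m \<and> 0 \<le> p then int (Suc k choose nat p) else 0)"
  proof (cases "p = m \<and> 0 < p")
    case True
    then obtain q where "p = int (Suc q)" by (metis gr0_conv_Suc pos_int_cases)
    then show ?thesis using True by (simp add: nat_add_distrib)
  qed auto
  finally show ?case .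
qed

abbreviation "JJ \<equiv> ideal_comp (J n)"

lemmas hJ = homogeneous_J[OF order.refl] and gJ = graded_ideal_comp[OF homogeneous_J[OF order.refl]]

text \<open>By \<open>kh_J\<close> the series of Euler characteristics is (1 - t^2)^n; cancelling (1
  - t)^n leaves (1 + t)^n.\<close>

lemma hilb_J: "pol.hilb hom_comp JJ (int m) = int (n choose m)"
proof -
  let ?H = "Abs_fps (\<lambda>m. pol.hilb hom_comp JJ (int m))"
  have "(1 - fps_X) ^ n * ?H = (1 - fps_X) ^ n * (1 + fps_X) ^ n"
  proof (rule fps_ext)
    fix j
    have "fps_nth ((1 - fps_X) ^ n * ?H) j = (\<Sum>p\<le>n. (- 1) ^ p * (if int p = int j - int p then int (n choose p) else 0))"
      using arg_cong[OF euler_fps[OF gJ ideal_comp_sub], of "\<lambda>F. fps_nth F j"]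
      by (simp add: kh_J cong: if_cong flip: n_card)
    also have "\<dots> = fps_nth ((1 - fps_X ^ 2) ^ n * 1) j"
      unfolding fps_one_minus_X_power_mult_nth by (intro sum.cong) auto
    finally show "fps_nth ((1 - fps_X) ^ n * ?H) j = fps_nth ((1 - fps_X) ^ n * (1 + fps_X) ^ n) j"
      by (simp only: fps_one_minus_square mult_1_right)
  qed
  then have "?H = (1 + fps_X) ^ n" using fps_one_minus_X_neq_0 by simp
  then have "fps_nth ?H m = int (n choose m)" by (simp add: fps_one_plus_X_power_nth)
  then show ?thesis by simp
qed

lemma high_degree_J:
  assumes "int n < m" shows "hom_comp m = JJ m"
proof -
  obtain k where k: "m = int k" "n < k" using assms by (metis less_imp_of_nat_less of_nat_0_le_iff of_nat_less_iff order.strict_trans1 zero_le_imp_eq_int order.strict_implies_order)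
  have "pol.hilb hom_comp JJ m = 0" unfolding k(1) hilb_J using k(2) by (simp add: binomial_eq_0)
  then show ?thesis
    using pol.eq_if_dim_le[of "hom_comp m" "JJ m"] pol.gradedD[OF graded_hom_comp] pol.gradedD(1)[OF gJ] ideal_comp_sub
    unfolding pol.hilb_def by fastforce
qed

text \<open>Induction on n - m. Below degree n the top Koszul homology of P vanishes, so some
  variable does not annihilate \<open>u\<close> in P; in degree n the witness is 1.\<close>

lemma socle_J:
  assumes "u \<in> hom_comp m" "u \<notin> J n"
  shows "\<exists>y\<in>hom_comp (int n - m). u * y \<notin> J n"
proof -
  have "m \<le> int n"
  proof (rule ccontr)
    assume "\<not> m \<le> int n"
    then have "u \<in> JJ m" using high_degree_J[of m] assms(1) by simp
    then show False using assms(2) by (simp add: ideal_comp_def)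
  qed
  then show ?thesis using assms
  proof (induction "nat (int n - m)" arbitrary: m u)
    case 0
    then have "m = int n" by simp
    moreover have "1 \<in> hom_comp 0" by (simp add: hom_comp_def lookup_one when_def monomial_degree_def)
    ultimately show ?case using 0 by (intro bexI[of _ 1]) auto
  next
    case (Suc k)
    have "\<exists>v. poly_var v u \<notin> JJ (m + 1)"
    proof (rule ccontr)
      assume *: "\<not> (\<exists>v. poly_var v u \<notin> JJ (m + 1))"
      have "pol.kh hom_comp JJ (int CARD('v)) m = 0" using Suc.hyps(2) kh_J[of n "int n" m] by (simp add: n_card)
      then have "u \<in> JJ m"
        by (rule pol.socle[OF graded_hom_comp gJ ideal_comp_sub _ Suc.prems(2)]) (use * in blast)
      then show False using Suc.prems(3) by (simp add: ideal_comp_def)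
    qed
    then obtain v where v: "poly_var v u \<notin> JJ (m + 1)" by blast
    have vh: "poly_var v u \<in> hom_comp (m + 1)" using pol.gradedD(3)[OF graded_hom_comp Suc.prems(2)] .
    have vJ: "poly_var v u \<notin> J n" using v vh by (simp add: ideal_comp_def)
    have "k = nat (int n - (m + 1))" "m + 1 \<le> int n" using Suc.hyps(2) by auto
    then obtain y where y: "y \<in> hom_comp (int n - (m + 1))" "poly_var v u * y \<notin> J n"
      using Suc.hyps(1)[OF _ _ vh vJ] by blast
    have "poly_var v y \<in> hom_comp (int n - m)" using pol.gradedD(3)[OF graded_hom_comp y(1), of v] by simp
    moreover have "u * poly_var v y = poly_var v u * y" by (simp add: poly_var_def mult_ac)
    ultimately show ?case using y(2) by metis
  qed
qed

section \<open>The link and the maximal rank hypothesis\<close>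

definition "a = f (n + 1)"

text \<open>The colon ideal by \<open>colon_G\<close>; G/J is the kernel of multiplication by the
  last quadric on P.\<close>

definition "G = {q. q * a \<in> J n}"

abbreviation "GG \<equiv> ideal_comp G"

lemma a_hom: "a \<in> hom_comp 2"
  using quadric'[of "n + 1"] by (simp add: a_def)

lemma hG: "homogeneous_ideal G"
  unfolding G_def using homogeneous_ideal_colon[OF hJ a_hom] .

lemmas gG = graded_ideal_comp[OF hG]

lemma colon_G: "colon (ideal_span (f ` {1..n})) (ideal_span (f ` {1..n + 1})) = G"
proof -
  have "f ` {1..n + 1} = insert a (f ` {1..n})"
    using atLeastAtMostSuc_conv[of 1 n] by (simp add: a_def)
  then show ?thesis using colon_span_insert[OF hJ[unfolded J_def], of a] by (simp add: G_def J_def)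
qed

lemma J_G: "JJ m \<subseteq> GG m"
  using homogeneous_idealD(3)[OF hJ] by (auto simp: ideal_comp_def G_def mult.commute)

text \<open>Multiplication by \<open>a\<close> induces an isomorphism from A_m onto the image of P_m
  in P_(m+2).\<close>

lemma hilb_G_image:
  "pol.hilb hom_comp GG m = int (pol.dim {a * u + w |u w. u \<in> hom_comp m \<and> w \<in> JJ (m + 2)}) - int (pol.dim (JJ (m + 2)))"
  unfolding pol.hilb_def
proof (rule pol.vv.dim_diff_eq_dim_diff[OF linear_mult])
  show "a * u \<in> JJ (m + 2) \<longleftrightarrow> u \<in> GG m" if "u \<in> hom_comp m" for u
    using that hom_comp_mult[OF that a_hom] by (auto simp: ideal_comp_def G_def mult.commute)
  show "GG m \<subseteq> hom_comp m" by (rule ideal_comp_sub)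
qed (rule refl pol.gradedD(1,2)[OF graded_hom_comp] pol.gradedD(1)[OF gG] pol.gradedD(1,2)[OF gJ])+

lemma image_sub: "{a * u + w |u w. u \<in> hom_comp m \<and> w \<in> JJ (m + 2)} \<subseteq> hom_comp (m + 2)"
proof -
  have "a * u + w \<in> hom_comp (m + 2)" if "u \<in> hom_comp m" "w \<in> JJ (m + 2)" for u w
    using hom_comp_mult[OF a_hom that(1)] that(2) ideal_comp_sub
    by (intro pol.subspace_add[OF pol.gradedD(1)[OF graded_hom_comp]]) (auto simp: add.commute)
  then show ?thesis by blast
qed

lemma hilb_G_le: "pol.hilb hom_comp GG m \<le> pol.hilb hom_comp JJ m" "pol.hilb hom_comp GG m \<le> pol.hilb hom_comp JJ (m + 2)"
proof -
  show "pol.hilb hom_comp GG m \<le> pol.hilb hom_comp JJ m"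
    using pol.dim_mono_fin_dim[OF pol.gradedD(2)[OF gG] J_G, of m] by (simp add: pol.hilb_def)
  show "pol.hilb hom_comp GG m \<le> pol.hilb hom_comp JJ (m + 2)"
    using pol.dim_mono_fin_dim[OF pol.gradedD(2)[OF graded_hom_comp] image_sub, of m]
    unfolding hilb_G_image by (simp add: pol.hilb_def)
qed

lemma quot_mult_coset: "quot_mult (J n) a (q +o J n) = (a * q) +o J n"
proof -
  note D = homogeneous_idealD[OF hJ]
  have "(a * x) +o J n = (a * q) +o J n" if "x \<in> q +o J n" for x
  proof -
    have "a * (x - q) \<in> J n" using D(3)[OF set_plus_imp_minus[OF that]] .
    then show ?thesis using coset_eq_iff[OF hJ] by (simp add: right_diff_distrib)
  qed
  moreover have "q \<in> q +o J n" using D(1) by (metis add.right_neutral set_plus_intro2)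
  ultimately show ?thesis unfolding quot_mult_def by blast
qed

text \<open>If multiplication by \<open>a\<close> is injective on P_i, then G and J agree in degree
  i; if it is surjective onto P_(i+2), then A_i is isomorphic to P_(i+2).\<close>

lemma hilb_G_cases:
  "pol.hilb hom_comp GG (int i) = pol.hilb hom_comp JJ (int i) \<or> pol.hilb hom_comp GG (int i) = pol.hilb hom_comp JJ (int i + 2)"
proof -
  consider "inj_on (quot_mult (J n) a) (quot_component (J n) i)"
    | "quot_mult (J n) a ` quot_component (J n) i = quot_component (J n) (i + 2)"
    using max_rank unfolding maximal_rank_element_def J_def a_def by blast
  then show ?thesis
  proof cases
    case 1
    have "GG (int i) \<subseteq> JJ (int i)"
    proof
      fix q assume q: "q \<in> GG (int i)"
      then have "(a * q) +o J n = (a * 0) +o J n"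
        using coset_eq_iff[OF hJ, of "a * q" "a * 0"] by (simp add: ideal_comp_def G_def mult.commute)
      then have "quot_mult (J n) a (q +o J n) = quot_mult (J n) a (0 +o J n)" by (simp only: quot_mult_coset)
      moreover have "q +o J n \<in> quot_component (J n) i" "0 +o J n \<in> quot_component (J n) i"
        using q pol.gradedD(4)[OF graded_hom_comp, of "int i"]
        unfolding quot_component_def hom_comp_homog[symmetric] ideal_comp_def by blast+
      ultimately have "q +o J n = 0 +o J n" using inj_onD[OF 1] by blast
      then show "q \<in> JJ (int i)" using coset_eq_iff[OF hJ, of q 0] q by (simp add: ideal_comp_def)
    qed
    then have "GG (int i) = JJ (int i)" using J_G by blast
    then show ?thesis by (simp add: pol.hilb_def)
  next
    case 2
    have "hom_comp (int i + 2) \<subseteq> {a * u + w |u w. u \<in> hom_comp (int i) \<and> w \<in> JJ (int i + 2)}"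
    proof
      fix y :: "('v, 'k) polynomial" assume y: "y \<in> hom_comp (int i + 2)"
      then have "y \<in> homog (i + 2)" unfolding hom_comp_homog[symmetric] by (simp add: add.commute)
      then have "y +o J n \<in> quot_component (J n) (i + 2)" unfolding quot_component_def by (rule imageI)
      then have "y +o J n \<in> quot_mult (J n) a ` quot_component (J n) i" unfolding 2 .
      then obtain q where q: "q \<in> hom_comp (int i)" "y +o J n = (a * q) +o J n"
        unfolding quot_component_def hom_comp_homog by (auto simp: quot_mult_coset)
      have "y - a * q \<in> J n" using q(2) coset_eq_iff[OF hJ] by blast
      moreover have "y - a * q \<in> hom_comp (int i + 2)"
        using hom_comp_mult[OF a_hom q(1)] by (intro pol.subspace_diff[OF pol.gradedD(1)[OF graded_hom_comp] y]) (simp add: add.commute)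
      ultimately have "y - a * q \<in> JJ (int i + 2)" by (simp add: ideal_comp_def)
      then show "y \<in> {a * u + w |u w. u \<in> hom_comp (int i) \<and> w \<in> JJ (int i + 2)}"
        using q(1) by (intro CollectI exI[of _ q] exI[of _ "y - a * q"]) simp
    qed
    then have "{a * u + w |u w. u \<in> hom_comp (int i) \<and> w \<in> JJ (int i + 2)} = hom_comp (int i + 2)"
      using image_sub[of "int i"] by blast
    then show ?thesis unfolding hilb_G_image by (simp add: pol.hilb_def)
  qed
qed

text \<open>As n = 2l + 2, the indices l and l + 2 are symmetric about the centre l + 1, so a step
  of 2 does not decrease the binomial coefficient up to i = l, where equality holds.\<close>

lemma binomial_two_up: "i \<le> l \<Longrightarrow> n choose i \<le> n choose (i + 2)"
proof (cases "2 * (i + 2) \<le> n")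
  case False
  assume "i \<le> l"
  then have "n choose i \<le> n choose (n - (i + 2))" using False n_even by (intro binomial_mono) auto
  then show ?thesis using binomial_symmetric[of "i + 2" n] \<open>i \<le> l\<close> n_even by simp
qed (auto intro: binomial_mono)

lemma binomial_two_down: "l \<le> i \<Longrightarrow> n choose (i + 2) \<le> n choose i"
proof (cases "i = l")
  case True
  then show ?thesis using binomial_symmetric[of l n] n_even by simp
next
  case False
  assume "l \<le> i"
  then have "n div 2 \<le> i" using False n_even by simp
  then show ?thesis
  proof (cases "i + 2 \<le> n")
    case True
    then show ?thesis using \<open>n div 2 \<le> i\<close> by (intro binomial_antimono) auto
  qed (simp add: binomial_eq_0)
qed

lemma hilb_J_2: "pol.hilb hom_comp JJ (int i + 2) = int (n choose (i + 2))"
  using hilb_J[of "i + 2"] by (simp add: add.commute)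

text \<open>The value is one of two numbers and bounded by both, hence their minimum: up to i = l
  this is the first one, from i = l on the second.\<close>

lemma hilb_G_low: "i \<le> l \<Longrightarrow> pol.hilb hom_comp GG (int i) = int (n choose i)"
  using hilb_G_cases[of i] hilb_G_le[of "int i"] binomial_two_up[of i] unfolding hilb_J hilb_J_2 by linarith

lemma hilb_G_high: "l \<le> i \<Longrightarrow> pol.hilb hom_comp GG (int i) = int (n choose (i + 2))"
  using hilb_G_cases[of i] hilb_G_le[of "int i"] binomial_two_down[of i] unfolding hilb_J hilb_J_2 by linarith

lemma G_low:
  assumes "m \<le> int l" shows "GG m = JJ m"
proof (cases "m < 0")
  case True
  then show ?thesis
    using hom_comp_neg[OF True, where 'a = 'v and 'b = 'k] ideal_comp_sub[of G m] ideal_comp_sub[of "J n" m] pol.gradedD(4)[OF gG, of m] pol.gradedD(4)[OF gJ, of m] by auto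
next
  case False
  then obtain i where i: "m = int i" by (metis not_less zero_le_imp_eq_int)
  have "pol.hilb hom_comp GG m = pol.hilb hom_comp JJ m" using assms hilb_G_low[of i] by (simp add: i hilb_J)
  then have "pol.dim (GG m) \<le> pol.dim (JJ m)" by (simp add: pol.hilb_def)
  then show ?thesis using pol.eq_if_dim_le[OF pol.gradedD(2)[OF gG] pol.gradedD(1)[OF gJ] J_G, of m] by simp
qed

text \<open>With coefficients in degree \<open>m\<close>, relations enter only in the degrees m and
  m + 1, where A and P still agree.\<close>

lemma kh_G_low: "m < int l \<Longrightarrow> pol.kh hom_comp GG p m = (if p = m \<and> 0 \<le> p then int (n choose nat p) else 0)"
  unfolding kh_J[OF order.refl, symmetric] by (simp add: pol.kh_def pol.cyc_def pol.bnd_def G_low)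

text \<open>In homological degree 0 every chain is a cycle, so relations of degree l + 1 have no
  influence and the comparison with P extends to coefficient degree l. This is the initial value of
  the recursion for the middle strand.\<close>

lemma kh_G_0: "pol.kh hom_comp GG 0 (int l) = (if l = 0 then 1 else 0)"
proof -
  have "pol.cyc hom_comp GG 0 (int l) = pol.cyc hom_comp JJ 0 (int l)"
    unfolding pol.cyc_def
    using pol.chains_neg[of "- 1"] pol.bd_graded[OF graded_hom_comp, of _ 0 "int l"]
      pol.chains_zero[OF pol.gradedD(1)[OF gG]] pol.chains_zero[OF pol.gradedD(1)[OF gJ]] by fastforce
  then have "pol.kh hom_comp GG 0 (int l) = pol.kh hom_comp JJ 0 (int l)"
    by (simp add: pol.kh_def pol.bnd_def G_low)
  then show ?thesis by (simp add: kh_J)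
qed

end

section \<open>The numerical sequences\<close>

text \<open>For positive \<open>n\<close>, the coefficients of (1 - t)^(-n), which are the Hilbert
  function of the polynomial ring.\<close>

definition neg_binom :: "nat \<Rightarrow> nat \<Rightarrow> int" where
  "neg_binom n m = int ((n - 1 + m) choose (n - 1))"

lemma fps_neg_binom: "(1 - fps_X) ^ Suc k * Abs_fps (neg_binom (Suc k)) = 1"
proof (induction k)
  case 0
  show ?case by (rule fps_ext) (simp add: neg_binom_def left_diff_distrib fps_X_mult_nth)
next
  case (Suc k)
  have "(1 - fps_X) * Abs_fps (neg_binom (Suc (Suc k))) = Abs_fps (neg_binom (Suc k))"
  proof (rule fps_ext)
    fix m
    show "fps_nth ((1 - fps_X) * Abs_fps (neg_binom (Suc (Suc k)))) m = fps_nth (Abs_fps (neg_binom (Suc k))) m"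
      by (cases m) (simp_all add: neg_binom_def left_diff_distrib fps_X_mult_nth)
  qed
  then have "(1 - fps_X) ^ Suc k * ((1 - fps_X) * Abs_fps (neg_binom (Suc (Suc k)))) = 1"
    using Suc.IH by simp
  then show ?case by (simp add: mult_ac)
qed

lemma fps_mult_neg_binom_cancel:
  assumes "n \<ge> 1" "(1 - fps_X) ^ n * F = E"
  shows "F = E * Abs_fps (neg_binom n)"
proof -
  obtain k where "n = Suc k" using assms(1) by (cases n) auto
  then have "(1 - fps_X) ^ n * Abs_fps (neg_binom n) = 1" using fps_neg_binom by simp
  then show ?thesis using assms(2) by (metis mult.commute mult.left_commute mult_1_right)
qed

text \<open>Coefficients of (1 + t)^n = (1 - t^2)^n (1 - t)^(-n).\<close>

lemma binomial_neg_binom: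
  assumes "n \<ge> 1"
  shows "int (n choose m) = (\<Sum>i\<le>n. (- 1) ^ i * int (n choose i) * (if 2 * i \<le> m then neg_binom n (m - 2 * i) else 0))"
proof -
  have "(1 + fps_X) ^ n = (1 - fps_X ^ 2) ^ n * Abs_fps (neg_binom n)"
    using assms fps_one_minus_square[of n, symmetric] by (rule fps_mult_neg_binom_cancel)
  then show ?thesis
    using fps_one_plus_X_power_nth[of n m, where 'a = int] fps_one_minus_X_power_mult_nth[of 2 n "Abs_fps (neg_binom n)" m]
    by (simp cong: if_cong)
qed

lemma binomial_neg_binom_truncated:
  assumes "n \<ge> 1" "c \<le> n + 1" "m < 2 * c"
  shows "int (n choose m) = (\<Sum>i<c. (- 1) ^ i * int (n choose i) * (if 2 * i \<le> m then neg_binom n (m - 2 * i) else 0))"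
  by (rule trans[OF binomial_neg_binom[OF assms(1)]], rule sum.mono_neutral_right) (use assms in auto)

text \<open>Subtraction is truncated: for 2i > m the upper entry drops below the positive number n -
  1, and the binomial coefficient is 0.\<close>

lemma shifted_binomial:
  "n \<ge> 2 \<Longrightarrow> int ((n - 1 + m - 2 * i) choose (n - 1)) = (if 2 * i \<le> m then neg_binom n (m - 2 * i) else 0)"
  by (auto simp: neg_binom_def intro!: binomial_eq_0)

lemma minus_one_power_cancel: "(- 1) ^ k * ((- 1) ^ (i + k) * (x :: int)) = (- 1) ^ i * x"
  by (simp add: power_add mult.left_commute)

locale even_index =
  fixes n l :: nat
  assumes n_even: "n = 2 * l + 2"
begin

lemma n_ge: "n \<ge> 1" "n \<ge> 2"
  using n_even by auto

lemma ell_n: "ell n = l"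
  using n_even by (simp add: ell_def)

lemma gamma_0: "gamma_seq n 0 = (if l = 0 then 1 else 0)"
  using n_even by (simp add: gamma_seq.simps)

text \<open>The recursion multiplied by (-1)^k and rearranged. The new value becomes the summand i =
  k, because \<open>neg_binom n 0\<close> is 1, and the left-hand side becomes a coefficient of a
  product with (1 - t)^(-n).\<close>

lemma gamma_rec:
  assumes "1 \<le> k" "k \<le> l + 1"
  shows "(\<Sum>i\<le>k. (- 1) ^ i * (gamma_seq n i * neg_binom n (k - i))) =
    int (n choose (k + l + 2)) - (\<Sum>i<l. (- 1) ^ i * int (n choose i) * (if 2 * i \<le> k + l then neg_binom n (k + l - 2 * i) else 0))"
proof -
  have "gamma_seq n k = (- 1) ^ k * int (n choose (k + l + 2))
      - (\<Sum>i<k. (- 1) ^ (i + k) * int ((n - 1 + k - i) choose (n - 1)) * gamma_seq n i)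
      - (\<Sum>i<l. (- 1) ^ (i + k) * int ((n - 1 + l + k - 2 * i) choose (n - 1)) * int (n choose i))"
    using assms gamma_seq.simps[of n k] by (simp add: ell_n atLeast0LessThan)
  then have "(- 1) ^ k * gamma_seq n k = (- 1) ^ k * ((- 1) ^ k * int (n choose (k + l + 2)))
      - (\<Sum>i<k. (- 1) ^ k * ((- 1) ^ (i + k) * (int ((n - 1 + k - i) choose (n - 1)) * gamma_seq n i)))
      - (\<Sum>i<l. (- 1) ^ k * ((- 1) ^ (i + k) * (int ((n - 1 + l + k - 2 * i) choose (n - 1)) * int (n choose i))))"
    by (simp add: right_diff_distrib sum_distrib_left mult.assoc)
  also have "(\<Sum>i<k. (- 1) ^ k * ((- 1) ^ (i + k) * (int ((n - 1 + k - i) choose (n - 1)) * gamma_seq n i))) =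
      (\<Sum>i<k. (- 1) ^ i * (gamma_seq n i * neg_binom n (k - i)))"
    unfolding minus_one_power_cancel by (intro sum.cong refl) (simp add: neg_binom_def)
  also have "(\<Sum>i<l. (- 1) ^ k * ((- 1) ^ (i + k) * (int ((n - 1 + l + k - 2 * i) choose (n - 1)) * int (n choose i)))) =
      (\<Sum>i<l. (- 1) ^ i * int (n choose i) * (if 2 * i \<le> k + l then neg_binom n (k + l - 2 * i) else 0))"
    unfolding minus_one_power_cancel using shifted_binomial[OF n_ge(2), of "k + l"]
    by (intro sum.cong refl) (simp add: add_ac mult.commute cong: if_cong)
  also have "(- 1) ^ k * ((- 1) ^ k * int (n choose (k + l + 2))) = int (n choose (k + l + 2))"
    by (simp flip: mult.assoc power_add mult_2)
  finally show ?thesis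
    by (simp add: neg_binom_def lessThan_Suc_atMost[symmetric])
qed

lemma rho_rec:
  assumes "1 \<le> k"
  shows "(\<Sum>i\<le>k. (- 1) ^ i * (rho_seq n i * neg_binom n (k - i))) =
    - (\<Sum>i\<le>l. (- 1) ^ i * int ((n + 1) choose i) * (if 2 * i \<le> k + l + 1 then neg_binom n (k + l + 1 - 2 * i) else 0))"
proof -
  have c: "(- 1) ^ k * ((- 1) ^ (i + k + 1) * (x :: int)) = - ((- 1) ^ i * x)" for i x
    using minus_one_power_cancel[of k i x] by simp
  have "rho_seq n k = (\<Sum>i<k. (- 1) ^ (i + k + 1) * int ((n + k - i - 1) choose (n - 1)) * rho_seq n i)
      + (\<Sum>i\<le>l. (- 1) ^ (i + k + 1) * int ((n + k + l - 2 * i) choose (n - 1)) * int ((n + 1) choose i))"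
    using assms rho_seq.simps[of n k] by (simp add: ell_n atLeast0LessThan atLeast0AtMost)
  then have "(- 1) ^ k * rho_seq n k =
      (\<Sum>i<k. (- 1) ^ k * ((- 1) ^ (i + k + 1) * (int ((n + k - i - 1) choose (n - 1)) * rho_seq n i)))
      + (\<Sum>i\<le>l. (- 1) ^ k * ((- 1) ^ (i + k + 1) * (int ((n + k + l - 2 * i) choose (n - 1)) * int ((n + 1) choose i))))"
    by (simp only: distrib_left sum_distrib_left mult.assoc)
  also have "(\<Sum>i<k. (- 1) ^ k * ((- 1) ^ (i + k + 1) * (int ((n + k - i - 1) choose (n - 1)) * rho_seq n i))) =
      - (\<Sum>i<k. (- 1) ^ i * (rho_seq n i * neg_binom n (k - i)))"
    unfolding c sum_negf using n_ge by (intro arg_cong[where f = uminus] sum.cong refl) (simp add: neg_binom_def)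
  also have "(\<Sum>i\<le>l. (- 1) ^ k * ((- 1) ^ (i + k + 1) * (int ((n + k + l - 2 * i) choose (n - 1)) * int ((n + 1) choose i)))) =
      - (\<Sum>i\<le>l. (- 1) ^ i * int ((n + 1) choose i) * (if 2 * i \<le> k + l + 1 then neg_binom n (k + l + 1 - 2 * i) else 0))"
  proof -
    have "n + k + l = n - 1 + (k + l + 1)" using n_ge by simp
    then have "int ((n + k + l - 2 * i) choose (n - 1)) = (if 2 * i \<le> k + l + 1 then neg_binom n (k + l + 1 - 2 * i) else 0)" for i
      using shifted_binomial[OF n_ge(2), of "k + l + 1" i] by (simp only: \<open>n + k + l = n - 1 + (k + l + 1)\<close>)
    then show ?thesis unfolding c sum_negf by (intro arg_cong[where f = uminus] sum.cong refl) (simp add: mult.commute)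
  qed
  finally show ?thesis by (simp add: neg_binom_def lessThan_Suc_atMost[symmetric])
qed

text \<open>The linear system is triangular with diagonal entries 1 or -1.\<close>

lemma neg_binom_recursion_unique:
  fixes u v :: "nat \<Rightarrow> int"
  assumes "\<And>k. k \<le> K \<Longrightarrow> (\<Sum>i\<le>k. (- 1) ^ i * (u i * neg_binom n (k - i))) = (\<Sum>i\<le>k. (- 1) ^ i * (v i * neg_binom n (k - i)))"
  shows "k \<le> K \<Longrightarrow> u k = v k"
proof (induction k rule: less_induct)
  case (less k)
  have "(\<Sum>i<k. (- 1) ^ i * (u i * neg_binom n (k - i))) = (\<Sum>i<k. (- 1) ^ i * (v i * neg_binom n (k - i)))"
    using less by (intro sum.cong) auto
  then have "(- 1) ^ k * u k = (- 1) ^ k * v k"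
    using assms[OF less.prems] by (simp add: neg_binom_def lessThan_Suc_atMost[symmetric])
  then show ?case by simp
qed

text \<open>Both sides solve the same triangular system. Its right-hand sides agree because (1 -
  t^2)^(n+1) = (1 - t^2)(1 - t^2)^n and because C(n,k+l+2) has a short expansion in this
  range.\<close>

lemma gamma_eq_rho:
  assumes "i + 1 \<le> l"
  shows "gamma_seq n i = rho_seq n (i + 1)"
proof (rule neg_binom_recursion_unique[where u = "gamma_seq n" and v = "\<lambda>i. rho_seq n (i + 1)" and K = "l - 1"])
  show "i \<le> l - 1" using assms by simp
  fix k assume "k \<le> l - 1"
  then have k: "k + 1 \<le> l" using assms by simp
  let ?N = "\<lambda>m i. if 2 * i \<le> m then neg_binom n (m - 2 * i) else 0"
  \<comment> \<open>\<open>rho_seq\<close> starts with 0, so lowering the index by one loses no term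
    and changes every sign.\<close>
  have shift: "(\<Sum>i\<le>k + 1. (- 1) ^ i * (rho_seq n i * neg_binom n (k + 1 - i))) =
      - (\<Sum>i\<le>k. (- 1) ^ i * (rho_seq n (i + 1) * neg_binom n (k - i)))"
    unfolding Suc_eq_plus1[symmetric] sum.atMost_Suc_shift by (simp add: sum_negf rho_seq.simps[of n 0])
  have e: "k + 1 + l + 1 = k + l + 2" by simp
  have rho: "(\<Sum>i\<le>k. (- 1) ^ i * (rho_seq n (i + 1) * neg_binom n (k - i))) =
      (\<Sum>i\<le>l. (- 1) ^ i * int ((n + 1) choose i) * ?N (k + l + 2) i)"
    using rho_rec[of "k + 1"] shift unfolding e by linarith
  have gamma: "(\<Sum>i\<le>k. (- 1) ^ i * (gamma_seq n i * neg_binom n (k - i))) =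
      int (n choose (k + l + 2)) - (\<Sum>i<l. (- 1) ^ i * int (n choose i) * ?N (k + l) i)"
  \<comment> \<open>\<open>gamma_rec\<close> starts at k = 1. At k = 0 the left side is 0, as l is
    positive, and the right side is C(n,l+2) - C(n,l) = 0.\<close>
  proof (cases "k = 0")
    case True
    have "n choose l = n choose (l + 2)" using binomial_symmetric[of l n] n_even by simp
    moreover have "int (n choose l) = (\<Sum>i<l. (- 1) ^ i * int (n choose i) * ?N l i)"
      by (rule binomial_neg_binom_truncated[OF n_ge(1)]) (use k n_even in auto)
    ultimately show ?thesis using True k by (simp add: gamma_0 cong: if_cong)
  qed (use gamma_rec[of k] k in auto)
  \<comment> \<open>The bound k < l enters here: k + l + 2 < 2(l + 1), so the summands beyond i = l
    vanish.\<close>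
  have "int (n choose (k + l + 2)) = (\<Sum>i<l + 1. (- 1) ^ i * int (n choose i) * ?N (k + l + 2) i)"
    by (rule binomial_neg_binom_truncated[OF n_ge(1)]) (use k n_even in auto)
  also have "{..<l + 1} = {..l}" by auto
  finally have b: "int (n choose (k + l + 2)) = (\<Sum>i\<le>l. (- 1) ^ i * int (n choose i) * ?N (k + l + 2) i)" .
  \<comment> \<open>Pascal's rule under the sum, which relates the truncations of (1 - t^2)^(n+1)
    and of (1 - t^2)^n. The upper limit is left general for the induction.\<close>
  have "(\<Sum>i\<le>L. (- 1) ^ i * int ((n + 1) choose i) * ?N (k + l + 2) i) =
      (\<Sum>i\<le>L. (- 1) ^ i * int (n choose i) * ?N (k + l + 2) i) - (\<Sum>i<L. (- 1) ^ i * int (n choose i) * ?N (k + l) i)" for L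
  proof (induction L)
    case (Suc L)
    have N: "?N (k + l + 2) (Suc L) = ?N (k + l) L" by simp
    have "(- 1) ^ Suc L * int ((n + 1) choose Suc L) * ?N (k + l + 2) (Suc L) =
        (- 1) ^ Suc L * int (n choose Suc L) * ?N (k + l + 2) (Suc L) - (- 1) ^ L * int (n choose L) * ?N (k + l) L"
      unfolding N by (simp add: algebra_simps del: binomial_Suc_Suc) (simp add: algebra_simps)
    then show ?case unfolding sum.atMost_Suc sum.lessThan_Suc Suc.IH by linarith
  qed simp
  from this[of l]
  show "(\<Sum>i\<le>k. (- 1) ^ i * (gamma_seq n i * neg_binom n (k - i))) =
      (\<Sum>i\<le>k. (- 1) ^ i * (rho_seq n (i + 1) * neg_binom n (k - i)))"
    using rho gamma b by linarith
qed

text \<open>The recursion at k = 1 gives C(n,l+1) - C(n,l+3). For m = l + 2, 2m = n + 2, the Catalan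
  number is C(2m,m) - C(2m,m+1); Pascal's rule applied twice and C(n,l) = C(n,l+2) make the two
  agree.\<close>

lemma gamma_1_catalan:
  assumes "2 \<le> l"
  shows "of_int (gamma_seq n 1) = catalan (l + 2)"
proof -
  let ?N = "\<lambda>m i. if 2 * i \<le> m then neg_binom n (m - 2 * i) else 0"
  \<comment> \<open>For l >= 2 the expansion of C(n,l+1) stops before i = l, as l + 1 < 2l, and so
    equals the sum in the recursion.\<close>
  have "int (n choose (1 + l)) = (\<Sum>i<l. (- 1) ^ i * int (n choose i) * ?N (1 + l) i)"
    by (rule binomial_neg_binom_truncated[OF n_ge(1)]) (use assms n_even in auto)
  moreover have "(\<Sum>i\<le>1. (- 1) ^ i * (gamma_seq n i * neg_binom n (1 - i))) = - gamma_seq n 1"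
    using assms by (simp add: gamma_0 neg_binom_def)
  ultimately have g: "gamma_seq n 1 = int (n choose (1 + l)) - int (n choose (1 + l + 2))"
    using gamma_rec[of 1] assms by simp
  define m where "m = l + 2"
  have m: "2 * m = Suc (Suc n)" "m = Suc (Suc l)" by (simp_all add: m_def n_even)
  have "n choose (l + 2) = n choose l" using binomial_symmetric[of l n] n_even by simp
  then have AB: "(2 * m choose m) + (n choose (1 + l + 2)) = (2 * m choose (m + 1)) + (n choose (1 + l))"
    unfolding m(1) by (simp add: m(2))
  have "Suc m * ((2 * m choose m) + (2 * m choose Suc m)) = Suc (2 * m) * (2 * m choose m)"
    using Suc_times_binomial[of m "2 * m"] by (simp del: mult_Suc mult_Suc_right)
  then have "(of_nat (Suc m) :: rat) * (of_nat (2 * m choose m) + of_nat (2 * m choose Suc m)) = of_nat (Suc (2 * m)) * of_nat (2 * m choose m)"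
    unfolding of_nat_mult[symmetric] of_nat_add[symmetric] by (rule arg_cong)
  then have "of_nat (m + 1) * (of_nat (2 * m choose m) - of_nat (2 * m choose Suc m)) = (of_nat (2 * m choose m) :: rat)"
    by (simp add: algebra_simps)
  then have "catalan m = of_nat (2 * m choose m) - of_nat (2 * m choose Suc m)"
    unfolding catalan_def by (simp add: field_simps)
  also have "\<dots> = of_int (int (2 * m choose m) - int (2 * m choose Suc m))" by simp
  also have "int (2 * m choose m) - int (2 * m choose Suc m) = gamma_seq n 1"
    using AB g by simp
  finally show ?thesis by (simp add: m_def)
qed

end

section \<open>The Betti numbers of the link\<close>

context quadrics
begin

sublocale even_index n l
  by unfold_locales (rule n_even)

text \<open>P_n has dimension C(n,n) = 1, so a single vector completes a basis of J_n to one of Q_n;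
  the functional takes the coordinate along it.\<close>

lemma exists_socle_functional:
  "\<exists>\<tau>. Vector_Spaces.linear poly_scale (*) \<tau> \<and> (\<forall>x\<in>hom_comp (int n). \<tau> x = 0 \<longleftrightarrow> x \<in> J n)"
proof -
  interpret k: fd_space "(*) :: 'k \<Rightarrow> 'k \<Rightarrow> 'k" by (rule fd_space_mult)
  interpret p: fd_space_pair "poly_scale :: 'k \<Rightarrow> ('v, 'k) polynomial \<Rightarrow> _" "(*) :: 'k \<Rightarrow> 'k \<Rightarrow> 'k" ..
  let ?H = "hom_comp (int n) :: ('v, 'k) polynomial set" and ?J = "JJ (int n)"
  obtain B where B: "B \<subseteq> ?J" "pol.independent B" "?J \<subseteq> pol.span B"
    using pol.maximal_independent_subset by blast
  have "B \<subseteq> ?H" using B(1) ideal_comp_sub by blast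
  then obtain C where C: "B \<subseteq> C" "C \<subseteq> ?H" "pol.independent C" "?H \<subseteq> pol.span C"
    using pol.maximal_independent_subset_extend[of B ?H] B(2) by blast
  have "finite C" using pol.fin_dim_independent(1)[OF pol.gradedD(2)[OF graded_hom_comp]] C by blast
  have "card B = pol.dim ?J" "card C = pol.dim ?H"
    using pol.basis_card_eq_dim[OF B(1,3,2)] pol.basis_card_eq_dim[OF C(2,4,3)] by auto
  moreover have "int (pol.dim ?H) - int (pol.dim ?J) = 1" using hilb_J[of n] by (simp add: pol.hilb_def)
  ultimately have "card (C - B) = 1"
    using C(1) \<open>finite C\<close> by (simp add: card_Diff_subset finite_subset)
  then obtain w where w: "C - B = {w}" by (auto simp: card_1_singleton_iff)
  then have Cw: "C = insert w B" using C(1) by blast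
  obtain \<tau> where \<tau>: "p.lin \<tau>" "\<forall>x\<in>C. \<tau> x = (if x \<in> B then 0 else 1)"
    using p.linear_independent_extend[OF C(3), of "\<lambda>x. if x \<in> B then 0 else 1"] by blast
  have 0: "\<tau> x = 0" if "x \<in> pol.span B" for x
    by (rule p.linear_eq_0_on_span[OF \<tau>(1) _ that]) (use \<tau>(2) C(1) in auto)
  have "\<tau> x = 0 \<longleftrightarrow> x \<in> J n" if x: "x \<in> ?H" for x
  proof
    assume x0: "\<tau> x = 0"
    have "x \<in> pol.span (insert w B)" using C(4) x Cw by blast
    then obtain c where c: "x - poly_scale c w \<in> pol.span B" unfolding pol.span_breakdown_eq by blast
    have "\<tau> (x - poly_scale c w) = \<tau> x - c * \<tau> w" by (simp add: p.linear_diff[OF \<tau>(1)] p.linear_scale[OF \<tau>(1)])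
    moreover have "w \<in> C" "w \<notin> B" using w by blast+
    then have "\<tau> w = 1" using \<tau>(2) by simp
    ultimately have "c = 0" using 0[OF c] x0 by simp
    then have "x \<in> pol.span B" using c by simp
    then have "x \<in> ?J" using pol.span_minimal[OF B(1) pol.gradedD(1)[OF gJ]] by blast
    then show "x \<in> J n" by (simp add: ideal_comp_def)
  next
    assume "x \<in> J n"
    then have "x \<in> ?J" using x by (simp add: ideal_comp_def)
    then show "\<tau> x = 0" using 0 B(3) by blast
  qed
  then show ?thesis using \<tau>(1) by blast
qed

text \<open>The factor \<open>a\<close> uses up two degrees, so complementary degrees in A add up to
  n - 2 = 2l. If \<open>x\<close> is not in G, then x a is nonzero in P, and \<open>socle_J\<close>
  provides a \<open>y\<close> with x a y nonzero in P_n.\<close>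

lemma kh_G_dual: "pol.kh hom_comp GG p m = pol.kh hom_comp GG (int n - p) (2 * int l - m)"
proof -
  obtain \<tau> where \<tau>: "Vector_Spaces.linear poly_scale (*) \<tau>" "\<And>x. x \<in> hom_comp (int n) \<Longrightarrow> \<tau> x = 0 \<longleftrightarrow> x \<in> J n"
    using exists_socle_functional by blast
  have \<tau>_add: "\<tau> (x + y) = \<tau> x + \<tau> y" and \<tau>_scale: "\<tau> (poly_scale c x) = c * \<tau> x" for x y c
    using \<tau>(1) by (auto simp: Vector_Spaces.linear_iff)
  interpret gor: gorenstein poly_scale poly_var hom_comp GG "\<lambda>x y. \<tau> (x * y * a)" "2 * int l" "int n"
  proof unfold_locales
    show "int n = int CARD('v)" by (simp add: n_card)
    show "pol.graded hom_comp" "pol.graded GG" by (rule graded_hom_comp, rule gG)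
    show "GG m \<subseteq> hom_comp m" for m by (rule ideal_comp_sub)
    show "\<tau> ((x + y) * z * a) = \<tau> (x * z * a) + \<tau> (y * z * a)" for x y z by (simp add: distrib_right \<tau>_add)
    show "\<tau> (poly_scale c x * z * a) = c * \<tau> (x * z * a)" for c x z
      by (simp add: mult.assoc flip: \<tau>_scale) (simp add: poly_scale_def mult.assoc)
    show "\<tau> (x * y * a) = \<tau> (y * x * a)" for x y by (simp add: mult.commute[of x])
    show "\<tau> (poly_var v x * y * a) = \<tau> (x * poly_var v y * a)" for v x y by (simp add: poly_var_def mult_ac)
    fix x :: "('v, 'k) polynomial" and m assume x: "x \<in> hom_comp m"
    have deg: "x * y * a \<in> hom_comp (int n)" if "y \<in> hom_comp (2 * int l - m)" for y
    proof -
      have "m + (2 * int l - m) + 2 = int n" using n_even by simp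
      then show ?thesis using hom_comp_mult[OF hom_comp_mult[OF x that] a_hom] by (simp only:)
    qed
    show "(\<forall>y\<in>hom_comp (2 * int l - m). \<tau> (x * y * a) = 0) \<longleftrightarrow> x \<in> GG m"
    proof
      assume *: "\<forall>y\<in>hom_comp (2 * int l - m). \<tau> (x * y * a) = 0"
      show "x \<in> GG m"
      proof (rule ccontr)
        assume "x \<notin> GG m"
        then have "x * a \<notin> J n" using x by (simp add: ideal_comp_def G_def)
        moreover have "x * a \<in> hom_comp (m + 2)" using hom_comp_mult[OF x a_hom] .
        ultimately obtain y where y: "y \<in> hom_comp (int n - (m + 2))" "x * a * y \<notin> J n" using socle_J by blast
        have "y \<in> hom_comp (2 * int l - m)" using y(1) by (simp add: n_even)
        then have "x * y * a \<in> J n" using * \<tau>(2) deg by blast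
        then show False using y(2) by (simp add: mult_ac)
      qed
    next
      assume "x \<in> GG m"
      then have "y * (x * a) \<in> J n" for y
        using homogeneous_idealD(3)[OF hJ] by (simp add: ideal_comp_def G_def)
      then show "\<forall>y\<in>hom_comp (2 * int l - m). \<tau> (x * y * a) = 0" using \<tau>(2) deg by (simp add: mult_ac)
    qed
  qed
  show ?thesis by (rule gor.kh_duality)
qed

abbreviation middle :: "nat \<Rightarrow> int" where
  "middle i \<equiv> pol.kh hom_comp GG (int i) (int l)"

text \<open>Coefficient degrees above l are dual to those below l, and the diagonal n - p = 2l - m
  of \<open>kh_G_low\<close> reads m = p - 2.\<close>

lemma kh_G_high:
  assumes "int l < m"
  shows "pol.kh hom_comp GG p m = (if m = p - 2 \<and> p \<le> int n then int (n choose nat (int n - p)) else 0)"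
  using kh_G_low[of "2 * int l - m" "int n - p"] assms unfolding kh_G_dual[of p m] by (auto simp: n_even)

text \<open>The coefficient of t^(k+l) in H = E (1 - t)^(-n), with H the Hilbert series of A and E
  its series of Euler characteristics. The left value is C(n,k+l+2) by \<open>hilb_G_high\<close>,
  and E may be replaced by \<open>E'\<close>, the contribution of the lower strands and of the
  middle one.\<close>

lemma middle_gamma_rec:
  assumes "k \<le> l + 1"
  shows "(\<Sum>i\<le>k. (- 1) ^ i * (middle i * neg_binom n (k - i))) =
    int (n choose (k + l + 2)) - (\<Sum>i<l. (- 1) ^ i * int (n choose i) * (if 2 * i \<le> k + l then neg_binom n (k + l - 2 * i) else 0))"
proof -
  let ?H = "Abs_fps (\<lambda>m. pol.hilb hom_comp GG (int m))" and ?N = "Abs_fps (neg_binom n)"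
  define E where "E = Abs_fps (\<lambda>j. \<Sum>p\<le>n. (- 1) ^ p * pol.kh hom_comp GG (int p) (int j - int p))"
  define E' where "E' = (\<Sum>p<l. fps_const ((- 1) ^ p * int (n choose p)) * fps_X ^ (2 * p)) +
      (\<Sum>p\<le>l + 1. fps_const ((- 1) ^ p * middle p) * fps_X ^ (p + l))"
  have "(1 - fps_X) ^ n * ?H = E" unfolding E_def using euler_fps[OF gG ideal_comp_sub] by (simp only: n_card)
  then have H: "?H = E * ?N" by (rule fps_mult_neg_binom_cancel[OF n_ge(1)])
  \<comment> \<open>The upper strands have total degree 2p - 2 with p >= l + 3, so they start at 2l
    + 4. Up to degree 2l + 1 they are absent, and the middle strand contributes only for p <= l +
    1.\<close>
  have EE': "fps_nth E j = fps_nth E' j" if j: "j \<le> 2 * l + 1" for j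
  proof -
    have kh: "pol.kh hom_comp GG (int p) (int j - int p) =
        (if j = 2 * p \<and> p < l then int (n choose p) else 0) + (if j = p + l then middle p else 0)" if "p \<le> n" for p
    proof -
      consider "int j - int p < int l" | "int j - int p = int l" | "int l < int j - int p" by linarith
      then show ?thesis
      proof cases
        case 1
        then show ?thesis using kh_G_low[OF 1, of "int p"] by auto
      next
        case 2
        then show ?thesis by auto
      next
        case 3
        then show ?thesis using kh_G_high[OF 3, of "int p"] j by auto
      qed
    qed
    have "fps_nth E j = (\<Sum>p\<le>n. (if j = 2 * p \<and> p < l then (- 1) ^ p * int (n choose p) else 0)) +
        (\<Sum>p\<le>n. (if j = p + l then (- 1) ^ p * middle p else 0))"
      unfolding E_def fps_nth_Abs_fps sum.distrib[symmetric] by (intro sum.cong refl) (simp add: kh)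
    also have "(\<Sum>p\<le>n. (if j = 2 * p \<and> p < l then (- 1) ^ p * int (n choose p) else 0)) =
        (\<Sum>p<l. (if j = 2 * p then (- 1) ^ p * int (n choose p) else 0))"
      by (intro sum.mono_neutral_cong_right) (auto simp: n_even)
    also have "(\<Sum>p\<le>n. (if j = p + l then (- 1) ^ p * middle p else 0)) =
        (\<Sum>p\<le>l + 1. (if j = p + l then (- 1) ^ p * middle p else 0))"
      using j by (intro sum.mono_neutral_cong_right) (auto simp: n_even)
    also have "(\<Sum>p<l. (if j = 2 * p then (- 1) ^ p * int (n choose p) else 0)) +
        (\<Sum>p\<le>l + 1. (if j = p + l then (- 1) ^ p * middle p else 0)) = fps_nth E' j"
      unfolding E'_def fps_add_nth fps_sum_nth
      by (intro arg_cong2[where f = "(+)"] sum.cong refl) (auto simp: fps_X_power_nth)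
    finally show ?thesis .
  qed
  have "int (n choose (k + l + 2)) = fps_nth ?H (k + l)" using hilb_G_high[of "k + l"] by simp
  also have "\<dots> = (\<Sum>i = 0..k + l. fps_nth E i * fps_nth ?N (k + l - i))" unfolding H fps_mult_nth ..
  also have "\<dots> = (\<Sum>i = 0..k + l. fps_nth E' i * fps_nth ?N (k + l - i))"
    using assms by (intro sum.cong refl) (simp add: EE')
  also have "\<dots> = fps_nth (E' * ?N) (k + l)" unfolding fps_mult_nth ..
  also have "E' * ?N = (\<Sum>p<l. fps_const ((- 1) ^ p * int (n choose p)) * (fps_X ^ (2 * p) * ?N)) +
      (\<Sum>p\<le>l + 1. fps_const ((- 1) ^ p * middle p) * (fps_X ^ (p + l) * ?N))"
    unfolding E'_def distrib_right sum_distrib_right mult.assoc ..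
  also have "fps_nth \<dots> (k + l) =
      (\<Sum>p<l. (- 1) ^ p * int (n choose p) * (if 2 * p \<le> k + l then neg_binom n (k + l - 2 * p) else 0)) +
      (\<Sum>p\<le>l + 1. (- 1) ^ p * middle p * (if p \<le> k then neg_binom n (k - p) else 0))"
    unfolding fps_add_nth fps_sum_nth fps_mult_left_const_nth fps_X_power_mult_nth
    by (intro arg_cong2[where f = "(+)"] sum.cong refl) auto
  also have "(\<Sum>p\<le>l + 1. (- 1) ^ p * middle p * (if p \<le> k then neg_binom n (k - p) else 0)) =
      (\<Sum>i\<le>k. (- 1) ^ i * (middle i * neg_binom n (k - i)))"
    using assms by (intro sum.mono_neutral_cong_right) auto
  finally show ?thesis by linarith
qed

lemma middle_low:
  assumes "k \<le> l + 1"
  shows "middle k = gamma_seq n k"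
proof (rule neg_binom_recursion_unique[where u = middle and v = "gamma_seq n" and K = "l + 1"])
  fix k assume k: "k \<le> l + 1"
  show "(\<Sum>i\<le>k. (- 1) ^ i * (middle i * neg_binom n (k - i))) = (\<Sum>i\<le>k. (- 1) ^ i * (gamma_seq n i * neg_binom n (k - i)))"
  proof (cases "k = 0")
    case True
    then show ?thesis using kh_G_0 by (simp add: gamma_0)
  next
    case False
    then show ?thesis using middle_gamma_rec[OF k] gamma_rec[OF _ k] by simp
  qed
qed (rule assms)

text \<open>The coefficient degree l is half the socle degree, so duality reverses the middle
  strand, exactly as the symmetry clause of \<open>gamma_seq\<close> does.\<close>

lemma middle_gamma:
  assumes "k \<le> n"
  shows "middle k = gamma_seq n k"
proof (cases "k \<le> l + 1")
  case False
  have "middle k = middle (n - k)"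
    using kh_G_dual[of "int k" "int l"] assms by (simp add: of_nat_diff)
  also have "\<dots> = gamma_seq n (n - k)" using False n_even by (intro middle_low) simp
  also have "\<dots> = gamma_seq n k" using False assms gamma_seq.simps[of n k] by (simp add: ell_n)
  finally show ?thesis .
qed (rule middle_low)

text \<open>The coefficient degree j - i decides: below l the only contribution is at i = j - i,
  above l at i = j - i + 2, and at l it is the middle strand.\<close>

lemma betti_G:
  "int (graded_betti G i j) =
    (if (j = 2 * i \<and> i < l) \<or> (j + 2 = 2 * i \<and> l + 3 \<le> i \<and> i \<le> n) then int (n choose i)
     else if j = i + l \<and> i \<le> n then gamma_seq n i else 0)"
proof (cases "i \<le> n")
  case False
  then have "int (graded_betti G i j) = 0"
    unfolding graded_betti_kh[OF hG] by (intro pol.kh_trivial graded_hom_comp gG) (simp add: n_card)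
  moreover have "\<not> (j = 2 * i \<and> i < l)" using False n_even by simp
  ultimately show ?thesis using False by simp
next
  case True
  consider "int j - int i < int l" | "int j - int i = int l" | "int l < int j - int i" by linarith
  then show ?thesis
  proof cases
    case 1
    then show ?thesis
      using kh_G_low[OF 1, of "int i"] True unfolding graded_betti_kh[OF hG] by auto
  next
    case 2
    then have "j = i + l" by linarith
    then show ?thesis using middle_gamma[OF True] True unfolding graded_betti_kh[OF hG] 2 by auto
  next
    case 3
    have "n choose nat (int n - int i) = n choose i"
      using binomial_symmetric[OF True] True by (simp add: nat_diff_distrib)
    then show ?thesis
      using 3 True unfolding graded_betti_kh[OF hG] kh_G_high[OF 3] by auto
  qed
qed

end

theorem proposition3p13:
  fixes n l :: nat
  assumes "n = CARD('v::finite)" and "n \<ge> 2" and "even n" and "l = (n - 2) div 2"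
  shows "(\<forall>f :: nat \<Rightarrow> ('v, 'k::field) polynomial.
            let J = ideal_span (f ` {1..n});
                I = ideal_span (f ` {1..n + 1});
                G = colon J I
            in (\<forall>t\<in>{1..n + 1}. f t \<in> homog 2) \<longrightarrow>
               regular_sequence (map f [1..<n + 1]) \<longrightarrow>
               f (n + 1) \<notin> J \<longrightarrow>
               maximal_rank_element J 2 (f (n + 1)) \<longrightarrow>
               (\<forall>i j. int (graded_betti G i j) =
                  (if (j = 2 * i \<and> i < l) \<or> (j + 2 = 2 * i \<and> l + 3 \<le> i \<and> i \<le> n)
                   then int (n choose i)
                   else if j = i + l \<and> i \<le> n then gamma_seq n i
                   else 0)))
       \<and> (n \<ge> 6 \<longrightarrow>
            of_int (gamma_seq n 1) = catalan (l + 2) \<and>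
            gamma_seq n 1 = gamma_seq n (n - 1) \<and>
            (\<forall>i. i + 1 \<le> l \<longrightarrow> gamma_seq n i = rho_seq n (i + 1)))"
proof -
  have n_even: "n = 2 * l + 2" using assms(2-4) by (auto elim!: evenE)
  interpret even_index n l by unfold_locales (rule n_even)
  have "int (graded_betti (colon (ideal_span (f ` {1..n})) (ideal_span (f ` {1..n + 1}))) i j) =
      (if (j = 2 * i \<and> i < l) \<or> (j + 2 = 2 * i \<and> l + 3 \<le> i \<and> i \<le> n) then int (n choose i)
       else if j = i + l \<and> i \<le> n then gamma_seq n i else 0)"
    if "\<forall>t\<in>{1..n + 1}. f t \<in> homog 2" "regular_sequence (map f [1..<n + 1])"
      "maximal_rank_element (ideal_span (f ` {1..n})) 2 (f (n + 1))"
    for f :: "nat \<Rightarrow> ('v, 'k) polynomial" and i j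
  proof -
    interpret quadrics f n l by unfold_locales (use assms(1) n_even that in auto)
    show ?thesis unfolding colon_G by (rule betti_G)
  qed
  \<comment> \<open>For n >= 6 the index n - 1 = 2l + 1 exceeds l + 1, so \<open>gamma_seq\<close>
    is given there by its symmetry clause.\<close>
  moreover have "gamma_seq n 1 = gamma_seq n (n - 1)" if "n \<ge> 6"
  proof -
    have "n - 1 \<noteq> 0" "\<not> n - 1 \<le> ell n + 1" "n - 1 \<le> n" "n - (n - 1) = 1"
      unfolding ell_n using that n_even by linarith+
    then show ?thesis by (subst (2) gamma_seq.simps) (simp only: if_False if_True)
  qed
  ultimately show ?thesis
    unfolding Let_def using gamma_1_catalan gamma_eq_rho n_even by auto
qed

end
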